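(* Let $p\ge 2$, $\alpha\in(0,1)$, $n>p\alpha$, $0\le \mu<C_{n,\alpha,p}$, let $\Omega\subset\mathbb{R}^n$ be a domain (possibly unbounded, possibly $\Omega=\mathbb{R}^n$) with Lipschitz boundary and $0\in\Omega$, and let $V$ satisfy assumption $(A_p)$ on $\Omega$. Then the infimum $$\lambda_1:=\inf\Big\{J_\mu(u): u\in X_0,\ \int_\Omega V|u|^p\,dx=1\Big\}$$ is attained, i.e. there is $u\in X_0$ with $\int_\Omega V|u|^p\,dx=1$ and $J_\mu(u)=\lambda_1$.
   Context: $V^\pm=\max\{\pm V,0\}$. Assumption $(A_p)$ on $V:\Omega\to\mathbb{R}$: $V\in L^1_{loc}(\Omega)$, and $V^+=V_1+V_2\neq 0$ with $V_1\in L^{n/(p\alpha)}(\Omega)$ and $V_2$ such that $\lim_{x\to y,\,x\in\Omega}|x-y|^{p\alpha}V_2(x)=0$ for all $y\in\overline\Omega$ and $\lim_{|x|\to\infty,\,x\in\Omega}|x|^{p\alpha}V_2(x)=0$. $C_{n,\alpha,p}>0$ is the optimal constant in the fractional Hardy inequality $\iint_{\mathbb{R}^n\times\mathbb{R}^n}\frac{|u(x)-u(y)|^p}{|x-y|^{n+p\alpha}}dxdy\ge C_{n,\alpha,p}\int_{\mathbb{R}^n}\frac{|u(x)|^p}{|x|^{p\alpha}}dx$; explicitly $C_{n,\alpha,p}=2\int_0^1 r^{p\alpha-1}|1-r^{(n-p\alpha)/p}|^p\Phi_{n,\alpha,p}(r)\,dr$, with $\Phi_{n,\alpha,p}(r)=|\mathbb{S}^{n-2}|\int_{-1}^1\frac{(1-t^2)^{(n-3)/2}}{(1-2rt+r^2)^{(n+p\alpha)/2}}dt$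 for $n\ge2$ and $\Phi_{1,\alpha,p}(r)=(1-r)^{-1-p\alpha}+(1+r)^{-1-p\alpha}$. $X_0$ is the completion of $\{u\in C_c^\infty(\mathbb{R}^n): u=0\text{ in }\mathbb{R}^n\setminus\Omega\}$ with respect to the norm $\|u\|_{X_0}=\big(\int_{Q}\frac{|u(x)-u(y)|^p}{|x-y|^{n+p\alpha}}dxdy\big)^{1/p}$, $Q=\mathbb{R}^{2n}\setminus\big((\mathbb{R}^n\setminus\Omega)\times(\mathbb{R}^n\setminus\Omega)\big)$; since $n>p\alpha$, it is a space of functions on $\mathbb{R}^n$ vanishing a.e. outside $\Omega$. $J_\mu(u)=\int_Q\frac{|u(x)-u(y)|^p}{|x-y|^{n+p\alpha}}dxdy-\mu\int_\Omega\frac{|u|^p}{|x|^{p\alpha}}dx$ for $u\in X_0$. The constraint $\int_\Omega V|u|^p\,dx=1$ includes the requirement that $V|u|^p$ be integrable on $\Omega$. *)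

theory Defs
  imports "HOL-Analysis.Analysis"
begin

text \<open>
  The space \<open>\<real>\<^sup>n\<close> is an arbitrary \<^class>\<open>euclidean_space\<close> \<open>'a\<close> with \<open>n = DIM('a)\<close>.
  Measurability and integrals refer to Lebesgue (not just Borel) sets and functions.
\<close>

primrec Ck :: "nat \<Rightarrow> ('a::euclidean_space \<Rightarrow> real) \<Rightarrow> bool" where
  "Ck 0 f \<longleftrightarrow> continuous_on UNIV f"
| "Ck (Suc k) f \<longleftrightarrow> f differentiable_on UNIV \<and>
     (\<forall>b\<in>Basis. Ck k (\<lambda>x. frechet_derivative f (at x) b))"

definition test_functions :: "'a::euclidean_space set \<Rightarrow> ('a \<Rightarrow> real) set" where
  "test_functions \<Omega> = {u. (\<forall>k. Ck k u) \<and> compact (closure {x. u x \<noteq> 0}) \<and> (\<forall>x. x \<notin> \<Omega> \<longrightarrow> u x = 0)}"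

definition Q :: "'a set \<Rightarrow> ('a \<times> 'a) set" where
  "Q \<Omega> = - ((- \<Omega>) \<times> (- \<Omega>))"

text \<open>The \<open>p\<close>-th power of the norm of \<open>X\<^sub>0\<close>. The integrand is \<open>0\<close> on the (null) diagonal.\<close>

definition gagliardo :: "real \<Rightarrow> real \<Rightarrow> 'a::euclidean_space set \<Rightarrow> ('a \<Rightarrow> real) \<Rightarrow> ennreal" where
  "gagliardo p \<alpha> \<Omega> u =
     (\<integral>\<^sup>+z\<in>Q \<Omega>. ennreal (\<bar>u (fst z) - u (snd z)\<bar> powr p
         / norm (fst z - snd z) powr (real DIM('a) + p * \<alpha>)) \<partial>lebesgue)"

text \<open>
  The completion of the test functions, realised as a set of functions: the elements are the
  functions that are at the same time the norm limit and the a.e. limit of a sequence of test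
  functions. For \<open>n > p \<alpha>\<close>, by the fractional Sobolev inequality, every norm-Cauchy sequence of
  test functions has a subsequence with such a limit, and the limit is unique up to null sets
  and independent of the choices. The a.e. convergence cannot be dropped: for \<open>\<Omega> = \<real>\<^sup>n\<close>
  constants have norm zero. As elements of \<open>X\<^sub>0\<close> are represented by functions, a.e. equal
  functions are not identified.
\<close>

definition X0 :: "real \<Rightarrow> real \<Rightarrow> 'a::euclidean_space set \<Rightarrow> ('a \<Rightarrow> real) set" where
  "X0 p \<alpha> \<Omega> = {u. u \<in> borel_measurable lebesgue \<and>
     (\<exists>\<phi>. (\<forall>k. \<phi> k \<in> test_functions \<Omega>) \<and>
          (\<lambda>k. gagliardo p \<alpha> \<Omega> (\<lambda>x. \<phi> k x - u x)) \<longlonglongrightarrow> 0 \<and>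
          (AE x in lebesgue. (\<lambda>k. \<phi> k x) \<longlonglongrightarrow> u x))}"

text \<open>
  The optimal constant in the fractional Hardy inequality on \<open>\<real>\<^sup>n\<close>; note that
  \<open>Q UNIV = UNIV\<close>, so that the left-hand side of the inequality is the full double integral.
\<close>

definition hardy_const :: "'a::euclidean_space itself \<Rightarrow> real \<Rightarrow> real \<Rightarrow> real" where
  "hardy_const _ \<alpha> p = Sup {C. C \<ge> 0 \<and>
     (\<forall>u \<in> test_functions (UNIV :: 'a set).
        gagliardo p \<alpha> UNIV u \<ge>
          ennreal C * (\<integral>\<^sup>+x. ennreal (\<bar>u x\<bar> powr p / norm x powr (p * \<alpha>)) \<partial>lebesgue))}"

definition J :: "real \<Rightarrow> real \<Rightarrow> real \<Rightarrow> 'a::euclidean_space set \<Rightarrow> ('a \<Rightarrow> real) \<Rightarrow> real" where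
  "J p \<alpha> \<mu> \<Omega> u = enn2real (gagliardo p \<alpha> \<Omega> u)
     - \<mu> * (LINT x:\<Omega>|lebesgue. \<bar>u x\<bar> powr p / norm x powr (p * \<alpha>))"

definition admissible ::
    "real \<Rightarrow> real \<Rightarrow> 'a::euclidean_space set \<Rightarrow> ('a \<Rightarrow> real) \<Rightarrow> ('a \<Rightarrow> real) set" where
  "admissible p \<alpha> \<Omega> V = {u \<in> X0 p \<alpha> \<Omega>.
     set_integrable lebesgue \<Omega> (\<lambda>x. V x * \<bar>u x\<bar> powr p) \<and>
     (LINT x:\<Omega>|lebesgue. V x * \<bar>u x\<bar> powr p) = 1}"

text \<open>An infimum in the extended reals, so that it is meaningful without a priori bounds.\<close>

definition lambda1 ::
    "real \<Rightarrow> real \<Rightarrow> real \<Rightarrow> 'a::euclidean_space set \<Rightarrow> ('a \<Rightarrow> real) \<Rightarrow> ereal" where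
  "lambda1 p \<alpha> \<mu> \<Omega> V = (INF u \<in> admissible p \<alpha> \<Omega> V. ereal (J p \<alpha> \<mu> \<Omega> u))"

text \<open>
  Near each boundary point, \<open>\<Omega>\<close> is the set above the graph of a Lipschitz function in suitable
  orthogonal coordinates: \<open>e\<close> is the vertical direction, \<open>x \<bullet> e\<close> the height of \<open>x\<close>, and
  \<open>x - (x \<bullet> e) *\<^sub>R e\<close> its projection to the hyperplane orthogonal to \<open>e\<close>. No uniformity along
  the boundary is required.
\<close>

definition lipschitz_boundary :: "'a::euclidean_space set \<Rightarrow> bool" where
  "lipschitz_boundary \<Omega> \<longleftrightarrow> (\<forall>y \<in> frontier \<Omega>. \<exists>r>0. \<exists>e L. \<exists>\<gamma> :: 'a \<Rightarrow> real.
     norm e = 1 \<and> L-lipschitz_on {z. z \<bullet> e = 0} \<gamma> \<and>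
     (\<forall>x \<in> ball y r. x \<in> \<Omega> \<longleftrightarrow> x \<bullet> e > \<gamma> (x - (x \<bullet> e) *\<^sub>R e)))"

definition locally_integrable :: "'a::euclidean_space set \<Rightarrow> ('a \<Rightarrow> real) \<Rightarrow> bool" where
  "locally_integrable \<Omega> f \<longleftrightarrow> (\<forall>K. compact K \<and> K \<subseteq> \<Omega> \<longrightarrow> set_integrable lebesgue K f)"

definition in_Lp :: "real \<Rightarrow> 'a::euclidean_space set \<Rightarrow> ('a \<Rightarrow> real) \<Rightarrow> bool" where
  "in_Lp q \<Omega> f \<longleftrightarrow> set_borel_measurable lebesgue \<Omega> f \<and>
     set_integrable lebesgue \<Omega> (\<lambda>x. \<bar>f x\<bar> powr q)"

text \<open>Only the values of \<open>V\<close> on \<open>\<Omega>\<close> matter, and \<open>V\<^sup>+ \<noteq> 0\<close> is meant a.e.\<close>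

definition assumption_A ::
    "real \<Rightarrow> real \<Rightarrow> 'a::euclidean_space set \<Rightarrow> ('a \<Rightarrow> real) \<Rightarrow> bool" where
  "assumption_A p \<alpha> \<Omega> V \<longleftrightarrow>
     locally_integrable \<Omega> V \<and>
     \<not> (AE x in lebesgue. x \<in> \<Omega> \<longrightarrow> max (V x) 0 = 0) \<and>
     (\<exists>V\<^sub>1 V\<^sub>2.
        (AE x in lebesgue. x \<in> \<Omega> \<longrightarrow> max (V x) 0 = V\<^sub>1 x + V\<^sub>2 x) \<and>
        in_Lp (real DIM('a) / (p * \<alpha>)) \<Omega> V\<^sub>1 \<and>
        (\<forall>y \<in> closure \<Omega>.
           ((\<lambda>x. norm (x - y) powr (p * \<alpha>) * V\<^sub>2 x) \<longlongrightarrow> 0) (at y within \<Omega>)) \<and>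
        ((\<lambda>x. norm x powr (p * \<alpha>) * V\<^sub>2 x) \<longlongrightarrow> 0) (inf at_infinity (principal \<Omega>)))"

end

theory Submission
  imports Defs "HOL-Complex_Analysis.Great_Picard"
begin

text \<open>
  A minimising sequence \<open>u k\<close> is bounded in the seminorm, because \<open>\<mu>\<close> lies below an admissible Hardy
  constant. Comparing \<open>u k\<close> with its averages over a fine mesh gives a subsequence that converges
  locally in \<open>L\<^sup>p\<close> and a.e. to some \<open>w\<close>, and Clarkson's inequality, applied to almost minimisers
  over tails, shows that \<open>w\<close> stays in the completion. By the Brezis-Lieb lemma
  \<open>J (u k) = J w + J (u k - w) + o(1)\<close>, and \<open>J (u k - w) \<ge> 0\<close> by Hardy's inequality, so
  \<open>J w \<le> \<lambda>\<^sub>1\<close>. The term with \<open>V\<^sup>+\<close> is compact: up to a small multiple of the seminorm it is controlled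
  by the Sobolev inequality (large values of \<open>V\<^sub>1\<close>) and Hardy's inequality at finitely many centres
  and at infinity (\<open>V\<^sub>2\<close>), and the rest is a local \<open>L\<^sup>p\<close> norm. Fatou's lemma for \<open>V\<^sup>-\<close> then gives
  \<open>s = \<integral> V \<bar>w\<bar>\<^sup>p \<ge> 1\<close>, and \<open>s powr (- 1 / p) * w\<close> is a minimiser.
\<close>

section \<open>Powers and p-th power integrals\<close>

text \<open>Neither the functional nor the constraint is continuous under the convergence that
  bounded energy provides: the Hardy term scales like the seminorm under dilations about 0, and the
  integral of V^- passes to the limit in one direction only. Both losses have a favourable sign. The
  energy that escapes is nonnegative, and a loss in V^- can only push the constraint value of the
  limit above 1. Functional and constraint are homogeneous of the same degree p, and J w >= 0, so
  dividing by s >= 1 does not increase J; strong convergence of the minimising sequence is never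
  established. A Hardy constant above \<mu> serves several purposes: coercivity, the sign of the
  escaping energy, and a local L^p bound, since the weight is bounded below on balls. It also turns
  fast decay of the seminorm into a.e. convergence, which the seminorm alone cannot do because
  constants have seminorm 0 on the whole space. The space is closed under a.e. limits of bounded
  energy by uniform convexity; this is where p >= 2 enters, through the form of Clarkson's
  inequality.\<close>

lemma powr_add_le_weighted:
  fixes s t p \<theta> :: real
  assumes p: "1 \<le> p" and st: "0 \<le> s" "0 \<le> t" and \<theta>: "0 < \<theta>" "\<theta> < 1"
  shows "(s + t) powr p \<le> (1 - \<theta>) powr (1 - p) * s powr p + \<theta> powr (1 - p) * t powr p"
proof -
  have ge1: "1 \<le> a powr (1 - p)" if "0 < a" "a < 1" for a :: real
  proof -
    have "1 powr (1-p) \<le> a powr (1-p)" using that p by (intro powr_mono2') auto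
    then show ?thesis by simp
  qed
  consider "s = 0" | "t = 0" | "s > 0" "t > 0" using st by linarith
  then show ?thesis
  proof cases
    case 1
    have "1 * t powr p \<le> \<theta> powr (1-p) * t powr p" using ge1[of \<theta>] \<theta> by (intro mult_right_mono) auto
    then show ?thesis using 1 p by simp
  next
    case 2
    have "1 * s powr p \<le> (1-\<theta>) powr (1-p) * s powr p" using ge1[of "1-\<theta>"] \<theta> by (intro mult_right_mono) auto
    then show ?thesis using 2 p by simp
  next
    case 3
    \<comment> \<open>Convexity of the power is applied at \<open>s/(1-\<theta>)\<close> and
      \<open>t/\<theta>\<close>, whose weighted mean is \<open>s + t\<close>; this identity
      evaluates the two resulting terms.\<close>
    have *: "a * (x / a) powr p = a powr (1-p) * x powr p" if "0 < a" "0 < x" for a x :: real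
      using that by (simp add: powr_divide powr_diff)
    have "((1 - \<theta>) *\<^sub>R (s/(1-\<theta>)) + \<theta> *\<^sub>R (t/\<theta>)) powr p
        \<le> (1-\<theta>) * (s/(1-\<theta>)) powr p + \<theta> * (t/\<theta>) powr p"
      using 3 \<theta> by (intro convex_onD[OF powr_convex[OF p]]) auto
    then show ?thesis using 3 \<theta> *[of "1-\<theta>" s] *[of \<theta> t] by simp
  qed
qed

text \<open>As \<theta> tends to 0 in the weighted inequality, the first coefficient tends to 1, so
  the whole price of the mixed terms is charged to \<open>b\<close>.\<close>

lemma powr_add_le_eps:
  fixes p \<epsilon> :: real
  assumes p: "1 \<le> p" and \<epsilon>: "0 < \<epsilon>"
  obtains C where "0 < C" "\<And>a b::real. \<bar>a + b\<bar> powr p \<le> (1 + \<epsilon>) * \<bar>a\<bar> powr p + C * \<bar>b\<bar> powr p"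
proof -
  have "((\<lambda>\<theta>. (1 - \<theta>) powr (1 - p)) \<longlongrightarrow> (1 - 0) powr (1 - p)) (at_right 0)"
    by (intro tendsto_intros) auto
  then have "\<forall>\<^sub>F \<theta> in at_right 0. (1 - \<theta>) powr (1 - p) < 1 + \<epsilon>"
    using \<epsilon> by (intro order_tendstoD(2)) auto
  moreover have "\<forall>\<^sub>F \<theta> in at_right 0. \<theta> \<in> {0<..<1::real}"
    by (intro eventually_at_right_real) auto
  ultimately have "\<forall>\<^sub>F \<theta> in at_right 0. (1 - \<theta>) powr (1 - p) < 1 + \<epsilon> \<and> \<theta> \<in> {0<..<1::real}"
    by eventually_elim auto
  then obtain \<theta> where \<theta>: "(1 - \<theta>) powr (1 - p) < 1 + \<epsilon>" "0 < \<theta>" "\<theta> < (1::real)"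
    by (auto dest: eventually_happens)
  show thesis
  proof
    show "0 < \<theta> powr (1 - p)" using \<theta> by simp
    fix a b :: real
    have "\<bar>a + b\<bar> powr p \<le> (\<bar>a\<bar> + \<bar>b\<bar>) powr p" using p by (intro powr_mono2) auto
    also have "\<dots> \<le> (1 - \<theta>) powr (1 - p) * \<bar>a\<bar> powr p + \<theta> powr (1 - p) * \<bar>b\<bar> powr p"
      using \<theta> p by (intro powr_add_le_weighted) auto
    also have "\<dots> \<le> (1 + \<epsilon>) * \<bar>a\<bar> powr p + \<theta> powr (1 - p) * \<bar>b\<bar> powr p"
      using \<theta> by (intro add_right_mono mult_right_mono) auto
    finally show "\<bar>a + b\<bar> powr p \<le> (1 + \<epsilon>) * \<bar>a\<bar> powr p + \<theta> powr (1 - p) * \<bar>b\<bar> powr p" .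
  qed
qed

lemma powr_add_le_two:
  fixes a b p :: real
  assumes p: "1 \<le> p"
  shows "\<bar>a + b\<bar> powr p \<le> 2 powr p * (\<bar>a\<bar> powr p + \<bar>b\<bar> powr p)"
proof -
  have "\<bar>a + b\<bar> powr p \<le> (2 * max \<bar>a\<bar> \<bar>b\<bar>) powr p" using p by (intro powr_mono2) auto
  also have "\<dots> = 2 powr p * max \<bar>a\<bar> \<bar>b\<bar> powr p" by (simp add: powr_mult)
  also have "\<dots> \<le> 2 powr p * (\<bar>a\<bar> powr p + \<bar>b\<bar> powr p)"
    by (intro mult_left_mono) (auto simp: max_def)
  finally show ?thesis .
qed

text \<open>The two signs come from \<open>powr_add_le_eps\<close>, once for the pair
  \<open>a\<close>, \<open>b\<close> and once for \<open>a + b\<close>, \<open>- b\<close>. The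
  second use leaves the power of \<open>a + b\<close> on the right with factor \<delta>; the
  division by \<open>2 powr p\<close> in \<delta> lets the crude bound absorb it.\<close>

lemma powr_diff_le_eps:
  fixes p \<epsilon> :: real
  assumes p: "1 \<le> p" and \<epsilon>: "0 < \<epsilon>"
  obtains C where "0 < C"
    "\<And>a b::real. \<bar>\<bar>a + b\<bar> powr p - \<bar>a\<bar> powr p\<bar> \<le> \<epsilon> * \<bar>a\<bar> powr p + C * \<bar>b\<bar> powr p"
proof -
  define \<delta> where "\<delta> = \<epsilon> / 2 powr p"
  have \<delta>: "0 < \<delta>" "\<delta> * 2 powr p = \<epsilon>" using \<epsilon> by (auto simp: \<delta>_def)
  have "1 \<le> 2 powr p" using p ge_one_powr_ge_zero[of 2 p] by simp
  then have "\<delta> * 1 \<le> \<delta> * 2 powr p" using \<delta> by (intro mult_left_mono) auto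
  then have \<delta>\<epsilon>: "\<delta> \<le> \<epsilon>" using \<delta> by simp
  obtain C where C: "0 < C" "\<And>a b::real. \<bar>a + b\<bar> powr p \<le> (1 + \<delta>) * \<bar>a\<bar> powr p + C * \<bar>b\<bar> powr p"
    using powr_add_le_eps[OF p \<delta>(1)] by blast
  show thesis
  proof
    show "0 < C + \<epsilon>" using C \<epsilon> by simp
    fix a b :: real
    have 1: "\<bar>a + b\<bar> powr p \<le> (1 + \<delta>) * \<bar>a\<bar> powr p + C * \<bar>b\<bar> powr p" by (rule C)
    have 2: "\<bar>a\<bar> powr p \<le> (1 + \<delta>) * \<bar>a + b\<bar> powr p + C * \<bar>b\<bar> powr p"
      using C(2)[of "a + b" "-b"] by simp
    have 3: "\<delta> * \<bar>a + b\<bar> powr p \<le> \<epsilon> * \<bar>a\<bar> powr p + \<epsilon> * \<bar>b\<bar> powr p"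
    proof -
      have "\<delta> * \<bar>a + b\<bar> powr p \<le> \<delta> * (2 powr p * (\<bar>a\<bar> powr p + \<bar>b\<bar> powr p))"
        using \<delta> p by (intro mult_left_mono powr_add_le_two) auto
      also have "\<dots> = (\<delta> * 2 powr p) * (\<bar>a\<bar> powr p + \<bar>b\<bar> powr p)" by (simp add: algebra_simps)
      finally show ?thesis unfolding \<delta> by (simp add: algebra_simps)
    qed
    have 4: "\<delta> * \<bar>a\<bar> powr p \<le> \<epsilon> * \<bar>a\<bar> powr p" "0 \<le> \<epsilon> * \<bar>b\<bar> powr p" using \<delta>\<epsilon> \<epsilon>
      by (auto intro!: mult_right_mono)
    show "\<bar>\<bar>a + b\<bar> powr p - \<bar>a\<bar> powr p\<bar> \<le> \<epsilon> * \<bar>a\<bar> powr p + (C + \<epsilon>) * \<bar>b\<bar> powr p"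
      using 1 2 3 4 by (simp add: algebra_simps abs_le_iff)
  qed
qed

text \<open>With q = p / 2 >= 1 this becomes a statement about squares: superadditivity of the q-th
  power, then the parallelogram identity, then convexity of the q-th power at a midpoint.\<close>

lemma clarkson:
  fixes a b p :: real
  assumes p: "2 \<le> p"
  shows "\<bar>(a + b) / 2\<bar> powr p + \<bar>(a - b) / 2\<bar> powr p \<le> (\<bar>a\<bar> powr p + \<bar>b\<bar> powr p) / 2"
proof -
  define q where "q = p / 2"
  have q: "1 \<le> q" using p by (simp add: q_def)
  have sq: "\<bar>x\<bar> powr p = (x\<^sup>2) powr q" for x :: real
  proof -
    have "x\<^sup>2 = \<bar>x\<bar> powr 2" by simp
    then show ?thesis by (simp only: powr_powr q_def) simp
  qed
  have le1: "z powr q \<le> z" if "0 \<le> z" "z \<le> 1" for z :: real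
    using that q by (cases "z = 0") (auto intro: powr_le_one_le)
  \<comment> \<open>After normalisation the bound \<open>z powr q \<le> z\<close> on the unit
    interval is applied to the shares \<open>x / (x+y)\<close> and \<open>y / (x+y)\<close>, which
    add up to 1.\<close>
  have sup: "x powr q + y powr q \<le> (x + y) powr q" if "0 \<le> x" "0 \<le> y" for x y :: real
  proof (cases "x + y = 0")
    case True then show ?thesis using that by (simp add: add_nonneg_eq_0_iff)
  next
    case False
    then have pos: "x + y > 0" using that by simp
    have "(x / (x+y)) powr q \<le> x / (x+y)" "(y / (x+y)) powr q \<le> y / (x+y)"
      using that pos by (auto intro!: le1)
    moreover have "x / (x+y) + y / (x+y) = 1" using pos by (simp add: add_divide_distrib[symmetric])
    ultimately have "(x / (x+y)) powr q + (y / (x+y)) powr q \<le> 1" by linarith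
    then show ?thesis using pos that by (simp add: powr_divide field_simps)
  qed
  have "((a+b)/2)\<^sup>2 + ((a-b)/2)\<^sup>2 = a\<^sup>2/2 + b\<^sup>2/2" by (simp add: power2_eq_square field_simps)
  then have "\<bar>(a + b) / 2\<bar> powr p + \<bar>(a - b) / 2\<bar> powr p \<le> (a\<^sup>2/2 + b\<^sup>2/2) powr q"
    unfolding sq using sup[of "((a+b)/2)\<^sup>2" "((a-b)/2)\<^sup>2"] by simp
  also have "\<dots> \<le> (1/2) powr (1 - q) * (a\<^sup>2/2) powr q + (1/2) powr (1 - q) * (b\<^sup>2/2) powr q"
    using powr_add_le_weighted[of q "a\<^sup>2/2" "b\<^sup>2/2" "1/2"] q by simp
  also have "\<dots> = ((a\<^sup>2) powr q + (b\<^sup>2) powr q) / 2"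
  proof -
    have "(1/2) powr (1 - q) * (x/2) powr q = x powr q / 2" if "0 \<le> x" for x :: real
      using that by (simp add: powr_divide powr_diff)
    from this[of "a\<^sup>2"] this[of "b\<^sup>2"] show ?thesis by simp
  qed
  finally show ?thesis unfolding sq .
qed

text \<open>The p-th power of the L^p norm, without the root: the energies of the problem are p-th
  powers, and two substitutes for the triangle inequality, with factor \<open>2 powr p\<close> or
  with a factor near 1, are enough. Values in \<open>ennreal\<close> postpone questions of
  integrability.\<close>

definition pint :: "real \<Rightarrow> 'a measure \<Rightarrow> ('a \<Rightarrow> real) \<Rightarrow> ennreal" where
  "pint p M f = (\<integral>\<^sup>+x. ennreal (\<bar>f x\<bar> powr p) \<partial>M)"

lemma pint_zero [simp]: "pint p M (\<lambda>x. 0) = 0"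
  by (simp add: pint_def)

lemma pint_cmult:
  assumes [measurable]: "f \<in> borel_measurable M"
  shows "pint p M (\<lambda>x. c * f x) = ennreal (\<bar>c\<bar> powr p) * pint p M f"
  unfolding pint_def by (simp add: abs_mult powr_mult ennreal_mult nn_integral_cmult)

lemma pint_uminus [simp]: "pint p M (\<lambda>x. - f x) = pint p M f"
  by (simp add: pint_def)

text \<open>The constant is fixed before the measure and the functions, so that the bound can be
  used along a sequence.\<close>

lemma pint_add_le_eps:
  fixes p \<epsilon> :: real
  assumes p: "1 \<le> p" and \<epsilon>: "0 < \<epsilon>"
  obtains C where "0 < C"
    "\<And>(M::'m measure) f g. f \<in> borel_measurable M \<Longrightarrow> g \<in> borel_measurable M \<Longrightarrow>
        pint p M (\<lambda>x. f x + g x) \<le> ennreal (1 + \<epsilon>) * pint p M f + ennreal C * pint p M g"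
proof -
  obtain C where C: "0 < C" "\<And>a b::real. \<bar>a + b\<bar> powr p \<le> (1 + \<epsilon>) * \<bar>a\<bar> powr p + C * \<bar>b\<bar> powr p"
    using powr_add_le_eps[OF p \<epsilon>] by blast
  show thesis
  proof
    show "0 < C" by (rule C)
    fix M :: "'m measure" and f g :: "'m \<Rightarrow> real"
    assume [measurable]: "f \<in> borel_measurable M" "g \<in> borel_measurable M"
    have "pint p M (\<lambda>x. f x + g x) \<le>
        (\<integral>\<^sup>+x. ennreal (1 + \<epsilon>) * ennreal (\<bar>f x\<bar> powr p) + ennreal C * ennreal (\<bar>g x\<bar> powr p) \<partial>M)"
      unfolding pint_def using C \<epsilon>
      by (intro nn_integral_mono) (auto simp flip: ennreal_mult ennreal_plus intro!: ennreal_leI)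
    also have "\<dots> = ennreal (1 + \<epsilon>) * pint p M f + ennreal C * pint p M g"
      unfolding pint_def by (simp add: nn_integral_add nn_integral_cmult)
    finally show "pint p M (\<lambda>x. f x + g x) \<le> ennreal (1 + \<epsilon>) * pint p M f + ennreal C * pint p M g" .
  qed
qed

lemma pint_add_le:
  assumes p: "1 \<le> p" and [measurable]: "f \<in> borel_measurable M" "g \<in> borel_measurable M"
  shows "pint p M (\<lambda>x. f x + g x) \<le> ennreal (2 powr p) * (pint p M f + pint p M g)"
proof -
  have "pint p M (\<lambda>x. f x + g x) \<le>
      (\<integral>\<^sup>+x. ennreal (2 powr p) * (ennreal (\<bar>f x\<bar> powr p) + ennreal (\<bar>g x\<bar> powr p)) \<partial>M)"
    unfolding pint_def using powr_add_le_two[OF p]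
    by (intro nn_integral_mono) (auto simp flip: ennreal_mult ennreal_plus intro!: ennreal_leI)
  also have "\<dots> = ennreal (2 powr p) * (pint p M f + pint p M g)"
    unfolding pint_def by (simp add: nn_integral_add nn_integral_cmult)
  finally show ?thesis .
qed

lemma pint_diff_le:
  assumes p: "1 \<le> p" and [measurable]: "f \<in> borel_measurable M" "g \<in> borel_measurable M"
  shows "pint p M (\<lambda>x. f x - g x) \<le> ennreal (2 powr p) * (pint p M f + pint p M g)"
  using pint_add_le[OF p, of f M "\<lambda>x. - g x"] by simp

lemma pint_clarkson:
  assumes p: "2 \<le> p" and [measurable]: "f \<in> borel_measurable M" "g \<in> borel_measurable M"
  shows "pint p M (\<lambda>x. (f x + g x) / 2) + pint p M (\<lambda>x. (f x - g x) / 2)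
    \<le> ennreal (1/2) * (pint p M f + pint p M g)"
proof -
  have "pint p M (\<lambda>x. (f x + g x) / 2) + pint p M (\<lambda>x. (f x - g x) / 2) =
    (\<integral>\<^sup>+x. ennreal (\<bar>(f x + g x)/2\<bar> powr p) + ennreal (\<bar>(f x - g x)/2\<bar> powr p) \<partial>M)"
    unfolding pint_def by (rule nn_integral_add[symmetric]) measurable
  also have "\<dots> \<le> (\<integral>\<^sup>+x. ennreal (1/2) * (ennreal (\<bar>f x\<bar> powr p) + ennreal (\<bar>g x\<bar> powr p)) \<partial>M)"
  proof (intro nn_integral_mono)
    fix x
    have "ennreal (\<bar>(f x + g x)/2\<bar> powr p) + ennreal (\<bar>(f x - g x)/2\<bar> powr p)
      = ennreal (\<bar>(f x + g x)/2\<bar> powr p + \<bar>(f x - g x)/2\<bar> powr p)"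
      by (intro ennreal_plus[symmetric]) auto
    also have "\<dots> \<le> ennreal (1/2 * (\<bar>f x\<bar> powr p + \<bar>g x\<bar> powr p))"
      using clarkson[OF p, of "f x" "g x"] by (intro ennreal_leI) simp
    also have "\<dots> = ennreal (1/2) * (ennreal (\<bar>f x\<bar> powr p) + ennreal (\<bar>g x\<bar> powr p))"
      by (subst ennreal_mult) auto
    finally show "ennreal (\<bar>(f x + g x)/2\<bar> powr p) + ennreal (\<bar>(f x - g x)/2\<bar> powr p)
      \<le> ennreal (1/2) * (ennreal (\<bar>f x\<bar> powr p) + ennreal (\<bar>g x\<bar> powr p))" .
  qed
  also have "\<dots> = ennreal (1/2) * (pint p M f + pint p M g)"
    unfolding pint_def by (simp add: nn_integral_add nn_integral_cmult)
  finally show ?thesis .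
qed

section \<open>Limits of p-th power integrals and the Brezis-Lieb lemma\<close>

lemma tendsto_abs_powr:
  fixes p :: real
  assumes "(f \<longlongrightarrow> l) F" "0 < p"
  shows "((\<lambda>x. \<bar>f x\<bar> powr p) \<longlongrightarrow> \<bar>l\<bar> powr p) F"
  using assms by (intro tendsto_powr2 tendsto_intros) auto

lemma pint_fatou:
  assumes p: "0 < p" and [measurable]: "\<And>k::nat. f k \<in> borel_measurable M" "g \<in> borel_measurable M"
    and ae: "AE x in M. (\<lambda>k. f k x) \<longlonglongrightarrow> g x"
  shows "pint p M g \<le> liminf (\<lambda>k. pint p M (f k))"
proof -
  have "pint p M g = (\<integral>\<^sup>+x. liminf (\<lambda>k. ennreal (\<bar>f k x\<bar> powr p)) \<partial>M)"
    unfolding pint_def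
  proof (intro nn_integral_cong_AE, use ae in eventually_elim)
    case (elim x)
    then have "(\<lambda>k. ennreal (\<bar>f k x\<bar> powr p)) \<longlonglongrightarrow> ennreal (\<bar>g x\<bar> powr p)"
      using p by (intro tendsto_ennrealI tendsto_abs_powr)
    then show ?case by (rule lim_imp_Liminf[OF sequentially_bot, symmetric])
  qed
  also have "\<dots> \<le> liminf (\<lambda>k. pint p M (f k))"
    unfolding pint_def by (intro nn_integral_liminf) measurable
  finally show ?thesis .
qed

lemma pint_fatou_bound:
  assumes "0 < p" "\<And>k::nat. f k \<in> borel_measurable M" "g \<in> borel_measurable M"
    and "AE x in M. (\<lambda>k. f k x) \<longlonglongrightarrow> g x" and ev: "\<forall>\<^sub>F k in sequentially. pint p M (f k) \<le> K"
  shows "pint p M g \<le> K"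
proof -
  have "pint p M g \<le> liminf (\<lambda>k. pint p M (f k))" using assms by (intro pint_fatou) auto
  also have "\<dots> \<le> liminf (\<lambda>k::nat. K)" using ev by (rule Liminf_mono)
  also have "\<dots> = K" by (simp add: Liminf_const)
  finally show ?thesis .
qed

text \<open>The counterpart of Fatou's lemma: convergence in norm bounds the energies of the
  approximants from above.\<close>

lemma pint_limsup:
  assumes p: "1 \<le> p" and [measurable]: "\<And>k::nat. f k \<in> borel_measurable M" "g \<in> borel_measurable M"
    and fin: "pint p M g < \<infinity>" and conv: "(\<lambda>k. pint p M (\<lambda>x. f k x - g x)) \<longlonglongrightarrow> 0" and \<epsilon>: "0 < \<epsilon>"
  shows "\<forall>\<^sub>F k in sequentially. pint p M (f k) \<le> pint p M g + ennreal \<epsilon>"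
proof -
  obtain r where r: "pint p M g = ennreal r" "0 \<le> r"
    using fin by (cases "pint p M g") auto
  \<comment> \<open>One half of \<epsilon> pays for the factor \<open>1 + \<delta>\<close> in front
    of the integral of \<open>g\<close>, the other half for the small difference;
    \<open>r + 1\<close> allows \<open>r = 0\<close>.\<close>
  define \<delta> where "\<delta> = \<epsilon> / (2 * (r + 1))"
  have \<delta>: "0 < \<delta>" "\<delta> * r \<le> \<epsilon> / 2" using r \<epsilon> by (auto simp: \<delta>_def field_simps)
  obtain C where C: "0 < C"
    "\<And>(M::'a measure) f g. f \<in> borel_measurable M \<Longrightarrow> g \<in> borel_measurable M \<Longrightarrow>
        pint p M (\<lambda>x. f x + g x) \<le> ennreal (1 + \<delta>) * pint p M f + ennreal C * pint p M g"
    using pint_add_le_eps[OF p \<delta>(1)] by metis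
  have "\<forall>\<^sub>F k in sequentially. pint p M (\<lambda>x. f k x - g x) < ennreal (\<epsilon> / (2 * C))"
    using C \<epsilon> conv by (intro order_tendstoD) auto
  then show ?thesis
  proof eventually_elim
    case (elim k)
    have "pint p M (\<lambda>x. g x + (f k x - g x)) \<le> ennreal (1 + \<delta>) * ennreal r + ennreal C * pint p M (\<lambda>x. f k x - g x)"
      unfolding r(1)[symmetric] by (intro C) measurable
    also have "\<dots> \<le> ennreal (1 + \<delta>) * ennreal r + ennreal C * ennreal (\<epsilon> / (2 * C))"
      using elim by (intro add_left_mono mult_left_mono) auto
    also have "\<dots> = ennreal ((1 + \<delta>) * r + C * (\<epsilon> / (2 * C)))"
    proof -
      have "ennreal (1 + \<delta>) * ennreal r = ennreal ((1 + \<delta>) * r)"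
        by (rule ennreal_mult[symmetric]) (use \<delta> r in auto)
      moreover have "ennreal C * ennreal (\<epsilon> / (2 * C)) = ennreal (C * (\<epsilon> / (2 * C)))"
        by (rule ennreal_mult[symmetric]) (use C \<epsilon> in auto)
      ultimately show ?thesis
        using C \<epsilon> \<delta> r by (simp only:) (intro ennreal_plus[symmetric], auto)
    qed
    also have "\<dots> \<le> ennreal (r + \<epsilon>)" using C \<delta> by (intro ennreal_leI) (auto simp: algebra_simps)
    finally show ?case using r \<epsilon> by simp
  qed
qed

text \<open>Pointwise, the defect is at most \<delta> times the p-th power of \<open>f k - g\<close>
  plus a fixed multiple of that of \<open>g\<close>. The first part is small uniformly in
  \<open>k\<close> because the differences are bounded; what exceeds it tends to 0 by dominated
  convergence.\<close>

lemma brezis_lieb: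
  assumes p: "1 \<le> p" and [measurable]: "\<And>k::nat. f k \<in> borel_measurable M" "g \<in> borel_measurable M"
    and ae: "AE x in M. (\<lambda>k. f k x) \<longlonglongrightarrow> g x" and bd: "\<And>k. pint p M (f k) \<le> ennreal K"
  shows "(\<lambda>k. enn2real (pint p M (f k)) - enn2real (pint p M (\<lambda>x. f k x - g x)))
    \<longlonglongrightarrow> enn2real (pint p M g)"
proof -
  \<comment> \<open>A bound for the differences; \<open>max K 0\<close> because
    \<open>ennreal\<close> reads a negative \<open>K\<close> as 0.\<close>
  define K' where "K' = 2 powr p * (2 * max K 0)"
  have K'0: "0 \<le> K'" by (simp add: K'_def)
  have pg: "pint p M g \<le> ennreal K" using p ae bd by (intro pint_fatou_bound[of p f]) auto
  then have gfin: "pint p M g < \<infinity>" using ennreal_less_top le_less_trans by fastforce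
  have ffin: "pint p M (f k) < \<infinity>" for k using bd[of k] ennreal_less_top le_less_trans by fastforce
  have dbd: "pint p M (\<lambda>x. f k x - g x) \<le> ennreal K'" for k
  proof -
    have "pint p M (\<lambda>x. f k x - g x) \<le> ennreal (2 powr p) * (pint p M (f k) + pint p M g)"
      using p by (intro pint_diff_le) auto
    also have "\<dots> \<le> ennreal (2 powr p) * (ennreal (max K 0) + ennreal (max K 0))"
      using bd[of k] pg by (intro mult_left_mono add_mono) (auto simp: max_def ennreal_neg split: if_splits)
    also have "\<dots> = ennreal K'" by (simp add: K'_def ennreal_mult flip: ennreal_plus)
    finally show ?thesis .
  qed
  have dfin: "pint p M (\<lambda>x. f k x - g x) < \<infinity>" for k
    using dbd[of k] ennreal_less_top le_less_trans by fastforce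
  have int: "integrable M (\<lambda>x. \<bar>h x\<bar> powr p)" if "h \<in> borel_measurable M" "pint p M h < \<infinity>" for h
    using that by (intro integrableI_nonneg) (auto simp: pint_def)
  have eq: "enn2real (pint p M h) = (\<integral>x. \<bar>h x\<bar> powr p \<partial>M)" if [measurable]: "h \<in> borel_measurable M" for h
    unfolding pint_def by (subst integral_eq_nn_integral) auto
  note [simp] = int[OF _ ffin] int[OF _ gfin] int[OF _ dfin]
  have "\<exists>N. \<forall>k\<ge>N. \<bar>enn2real (pint p M (f k)) - enn2real (pint p M (\<lambda>x. f k x - g x)) - enn2real (pint p M g)\<bar> < \<epsilon>"
    if \<epsilon>: "0 < \<epsilon>" for \<epsilon>
  proof -
    define \<delta> where "\<delta> = \<epsilon> / (2 * (K' + 1))"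
    have \<delta>: "0 < \<delta>" "\<delta> * K' \<le> \<epsilon> / 2" using K'0 \<epsilon> by (auto simp: \<delta>_def field_simps)
    obtain C where C: "0 < C" "\<And>a b::real. \<bar>\<bar>a + b\<bar> powr p - \<bar>a\<bar> powr p\<bar> \<le> \<delta> * \<bar>a\<bar> powr p + C * \<bar>b\<bar> powr p"
      using powr_diff_le_eps[OF p \<delta>(1)] by blast
    \<comment> \<open>The excess of the defect over its uniformly small part. It is dominated by
      \<open>(C + 1) * \<bar>g x\<bar> powr p\<close> for every \<open>k\<close> and tends to 0
      almost everywhere.\<close>
    define W where "W k x = max 0 (\<bar>\<bar>f k x\<bar> powr p - \<bar>f k x - g x\<bar> powr p - \<bar>g x\<bar> powr p\<bar> - \<delta> * \<bar>f k x - g x\<bar> powr p)" for k x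
    have [measurable]: "W k \<in> borel_measurable M" for k unfolding W_def by measurable
    have Wb: "\<bar>W k x\<bar> \<le> (C + 1) * \<bar>g x\<bar> powr p" for k x
    proof -
      have "\<bar>\<bar>f k x\<bar> powr p - \<bar>f k x - g x\<bar> powr p\<bar> \<le> \<delta> * \<bar>f k x - g x\<bar> powr p + C * \<bar>g x\<bar> powr p"
        using C(2)[of "f k x - g x" "g x"] by simp
      moreover have "0 \<le> C * \<bar>g x\<bar> powr p" "0 \<le> \<bar>g x\<bar> powr p" using C by auto
      moreover have "\<bar>\<bar>f k x\<bar> powr p - \<bar>f k x - g x\<bar> powr p - \<bar>g x\<bar> powr p\<bar>
          \<le> \<bar>\<bar>f k x\<bar> powr p - \<bar>f k x - g x\<bar> powr p\<bar> + \<bar>g x\<bar> powr p"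
        using abs_triangle_ineq4[of "\<bar>f k x\<bar> powr p - \<bar>f k x - g x\<bar> powr p" "\<bar>g x\<bar> powr p"] by simp
      ultimately have "\<bar>\<bar>f k x\<bar> powr p - \<bar>f k x - g x\<bar> powr p - \<bar>g x\<bar> powr p\<bar> - \<delta> * \<bar>f k x - g x\<bar> powr p
          \<le> (C + 1) * \<bar>g x\<bar> powr p"
        unfolding distrib_right by simp
      moreover have "0 \<le> (C + 1) * \<bar>g x\<bar> powr p" using C by simp
      ultimately show ?thesis unfolding W_def by simp
    qed
    have "(\<lambda>k. \<integral>x. W k x \<partial>M) \<longlonglongrightarrow> (\<integral>x. 0 \<partial>M)"
    proof (rule integral_dominated_convergence)
      show "integrable M (\<lambda>x. (C + 1) * \<bar>g x\<bar> powr p)" by simp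
      show "AE x in M. (\<lambda>k. W k x) \<longlonglongrightarrow> 0"
      proof (use ae in eventually_elim)
        case (elim x)
        have "(\<lambda>k. W k x) \<longlonglongrightarrow> max 0 (\<bar>\<bar>g x\<bar> powr p - \<bar>g x - g x\<bar> powr p - \<bar>g x\<bar> powr p\<bar> - \<delta> * \<bar>g x - g x\<bar> powr p)"
          unfolding W_def using elim p by (intro tendsto_intros tendsto_abs_powr) auto
        then show ?case by simp
      qed
    qed (use Wb in auto)
    then have "(\<lambda>k. \<integral>x. W k x \<partial>M) \<longlonglongrightarrow> 0" by simp
    then have "\<forall>\<^sub>F k in sequentially. (\<integral>x. W k x \<partial>M) < \<epsilon> / 2" using \<epsilon> by (intro order_tendstoD) auto
    then obtain N where N: "\<And>k. k \<ge> N \<Longrightarrow> (\<integral>x. W k x \<partial>M) < \<epsilon> / 2" by (auto simp: eventually_sequentially)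
    have "\<bar>enn2real (pint p M (f k)) - enn2real (pint p M (\<lambda>x. f k x - g x)) - enn2real (pint p M g)\<bar> < \<epsilon>"
      if k: "k \<ge> N" for k
    proof -
      have Wint: "integrable M (W k)"
        by (rule Bochner_Integration.integrable_bound[of M "\<lambda>x. (C + 1) * \<bar>g x\<bar> powr p"])
           (use Wb[of k] C in \<open>auto simp: abs_mult\<close>)
      have "enn2real (pint p M (f k)) - enn2real (pint p M (\<lambda>x. f k x - g x)) - enn2real (pint p M g)
        = (\<integral>x. \<bar>f k x\<bar> powr p - \<bar>f k x - g x\<bar> powr p - \<bar>g x\<bar> powr p \<partial>M)"
        by (simp add: eq)
      also have "\<bar>\<dots>\<bar> \<le> (\<integral>x. \<bar>\<bar>f k x\<bar> powr p - \<bar>f k x - g x\<bar> powr p - \<bar>g x\<bar> powr p\<bar> \<partial>M)"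
        by (rule integral_abs_bound)
      also have "\<dots> \<le> (\<integral>x. W k x + \<delta> * \<bar>f k x - g x\<bar> powr p \<partial>M)"
      proof (rule integral_mono)
        fix x
        show "\<bar>\<bar>f k x\<bar> powr p - \<bar>f k x - g x\<bar> powr p - \<bar>g x\<bar> powr p\<bar>
            \<le> W k x + \<delta> * \<bar>f k x - g x\<bar> powr p"
          unfolding W_def max_def by simp
      qed (use Wint in auto)
      also have "\<dots> = (\<integral>x. W k x \<partial>M) + \<delta> * enn2real (pint p M (\<lambda>x. f k x - g x))"
        using Wint by (simp add: eq)
      also have "\<dots> < \<epsilon> / 2 + \<delta> * K'"
        using N[OF k] dbd[of k] K'0 \<delta> by (intro add_less_le_mono mult_left_mono enn2real_leI) auto
      finally show ?thesis using \<delta> by simp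
    qed
    then show ?thesis by blast
  qed
  then show ?thesis unfolding LIMSEQ_iff by simp
qed

text \<open>Monotone convergence makes the sum of the p-th powers finite almost everywhere, so its
  terms tend to 0.\<close>

lemma summable_pint_imp_AE_tendsto_0:
  assumes p: "0 < p" and [measurable]: "\<And>k::nat. f k \<in> borel_measurable M"
    and s: "(\<Sum>k. pint p M (f k)) < \<infinity>"
  shows "AE x in M. (\<lambda>k. f k x) \<longlonglongrightarrow> 0"
proof -
  have "(\<integral>\<^sup>+x. (\<Sum>k. ennreal (\<bar>f k x\<bar> powr p)) \<partial>M) = (\<Sum>k. pint p M (f k))"
    unfolding pint_def by (intro nn_integral_suminf) measurable
  then have "AE x in M. (\<Sum>k. ennreal (\<bar>f k x\<bar> powr p)) \<noteq> \<infinity>"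
    using s by (intro nn_integral_PInf_AE) auto
  then show ?thesis
  proof eventually_elim
    case (elim x)
    then have "summable (\<lambda>k. \<bar>f k x\<bar> powr p)" by (intro summable_suminf_not_top) auto
    then have "(\<lambda>k. \<bar>f k x\<bar> powr p) \<longlonglongrightarrow> 0" by (rule summable_LIMSEQ_zero)
    then have "(\<lambda>k. (\<bar>f k x\<bar> powr p) powr (1/p)) \<longlonglongrightarrow> 0 powr (1/p)"
      using p by (intro tendsto_powr2 tendsto_intros) auto
    then show ?case using p by (simp add: powr_powr tendsto_rabs_zero_iff)
  qed
qed

text \<open>Decay with ratio 1/4 leaves room for a weight: multiplied by
  \<open>2 powr (k / p)\<close> the increments still have summable integrals and hence tend to 0, so
  the increments themselves are eventually below a geometric series with ratio
  \<open>2 powr (- (1 / p))\<close>.\<close>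

lemma summable_pint_imp_AE_convergent:
  assumes p: "0 < p" and [measurable]: "\<And>k::nat. f k \<in> borel_measurable M"
    and s: "\<And>k. (k0::nat) \<le> k \<Longrightarrow> pint p M (\<lambda>x. f (Suc k) x - f k x) \<le> ennreal ((1/4) ^ k)"
  shows "AE x in M. convergent (\<lambda>k. f k x)"
proof -
  \<comment> \<open>The shift by \<open>k0\<close> is there because on a ball of radius
    \<open>R\<close> the increments will be controlled only from index \<open>R\<close> on.\<close>
  define g where "g k x = 2 powr (real k / p) * (f (Suc (k+k0)) x - f (k+k0) x)" for k x
  have [measurable]: "g k \<in> borel_measurable M" for k unfolding g_def by measurable
  have "pint p M (g k) \<le> ennreal ((1/2)^k)" for k
  proof -
    have "pint p M (g k) = ennreal (2 ^ k) * pint p M (\<lambda>x. f (Suc (k+k0)) x - f (k+k0) x)"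
      unfolding g_def using p by (subst pint_cmult) (auto simp: powr_powr powr_realpow)
    also have "\<dots> \<le> ennreal (2 ^ k) * ennreal ((1/4) ^ (k+k0))"
      using s[of "k+k0"] by (intro mult_left_mono) auto
    also have "\<dots> = ennreal (2^k * (1/4)^(k+k0))" by (simp add: ennreal_mult)
    also have "\<dots> \<le> ennreal ((1/2)^k)"
    proof (rule ennreal_leI)
      have "2^k * (1/4)^(k+k0) = (2 * (1/4))^k * ((1/4)^k0 :: real)"
        by (simp add: power_add power_mult_distrib del: times_divide_eq_right)
      also have "\<dots> \<le> (2 * (1/4))^k * 1" by (intro mult_left_mono power_le_one) auto
      finally show "2^k * (1/4)^(k+k0) \<le> ((1/2)^k :: real)" by simp
    qed
    finally show ?thesis .
  qed
  then have "(\<Sum>k. pint p M (g k)) \<le> (\<Sum>k. ennreal ((1/2)^k))" by (intro suminf_le) auto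
  also have "\<dots> < \<infinity>" by (subst suminf_ennreal2) (auto simp: summable_geometric)
  finally have "AE x in M. (\<lambda>k. g k x) \<longlonglongrightarrow> 0"
    using p by (intro summable_pint_imp_AE_tendsto_0[of p]) auto
  then show ?thesis
  proof eventually_elim
    case (elim x)
    define c where "c = 2 powr (- (1 / p))"
    have c: "0 < c" "c < 1" using p by (auto simp: c_def powr_less_one)
    have "\<forall>\<^sub>F k in sequentially. norm (g k x) < 1" using tendsto_norm[OF elim] by (intro order_tendstoD) auto
    then have "\<forall>\<^sub>F k in sequentially. norm (f (Suc (k+k0)) x - f (k+k0) x) \<le> c ^ k"
    proof eventually_elim
      case (elim k)
      have ck: "c ^ k * 2 powr (real k / p) = 1"
        by (simp add: c_def powr_realpow[symmetric] powr_powr flip: powr_add)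
      have "c ^ k * norm (g k x) \<le> c ^ k * 1" using elim c by (intro mult_left_mono) auto
      moreover have "c ^ k * norm (g k x) = (c ^ k * 2 powr (real k / p)) * norm (f (Suc (k+k0)) x - f (k+k0) x)"
        by (simp add: g_def abs_mult)
      ultimately show ?case unfolding ck by simp
    qed
    then have "summable (\<lambda>k. f (Suc (k+k0)) x - f (k+k0) x)"
      using c by (intro summable_comparison_test_ev[OF _ summable_geometric[of c]]) auto
    then have "convergent (\<lambda>k. (\<Sum>i<k. f (Suc (i+k0)) x - f (i+k0) x))" by (simp add: summable_iff_convergent)
    moreover have "(\<Sum>i<k. f (Suc (i+k0)) x - f (i+k0) x) = f (k+k0) x - f k0 x" for k
      by (induction k) auto
    ultimately have "convergent (\<lambda>k. f (k+k0) x - f k0 x)" by simp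
    then have "convergent (\<lambda>k. f (k+k0) x)" by (simp add: convergent_diff_const_right_iff)
    then show ?case using convergent_ignore_initial_segment[of "\<lambda>k. f k x" k0] by simp
  qed
qed

section \<open>Test functions\<close>

lemma Ck_SucI:
  assumes "\<And>x. (f has_derivative f' x) (at x)" "\<And>b. b \<in> Basis \<Longrightarrow> Ck k (\<lambda>x. f' x b)"
  shows "Ck (Suc k) f"
proof -
  have "frechet_derivative f (at x) = f' x" for x
    using assms(1) by (metis frechet_derivative_at)
  then show ?thesis using assms by (auto simp: differentiable_on_def differentiable_def intro: has_derivative_at_withinI)
qed

lemma Ck_SucD:
  assumes "Ck (Suc k) f"
  shows "(f has_derivative frechet_derivative f (at x)) (at x)"
    "b \<in> Basis \<Longrightarrow> Ck k (\<lambda>x. frechet_derivative f (at x) b)"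
  using assms by (auto simp: differentiable_on_def frechet_derivative_works)

declare Ck.simps(2) [simp del]

lemma Ck_SucE: "Ck (Suc k) f \<Longrightarrow> Ck k f"
  by (induction k arbitrary: f) (auto simp: Ck.simps(2) intro: differentiable_imp_continuous_on)

lemma Ck_const: "Ck k (\<lambda>x. c)"
proof (induction k arbitrary: c)
  case (Suc k)
  then show ?case by (intro Ck_SucI[where f' = "\<lambda>x h. 0"]) auto
qed auto

lemma Ck_inner: "Ck k (\<lambda>x. (x - c) \<bullet> b)"
proof (cases k)
  case (Suc m)
  then show ?thesis
    by (auto intro!: Ck_SucI[where f' = "\<lambda>x h. h \<bullet> b"] derivative_eq_intros Ck_const)
qed (auto intro!: continuous_intros)

lemma Ck_add: "Ck k f \<Longrightarrow> Ck k g \<Longrightarrow> Ck k (\<lambda>x. f x + g x)"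
proof (induction k arbitrary: f g)
  case (Suc k)
  show ?case
    by (rule Ck_SucI[OF has_derivative_add[OF Ck_SucD(1)[OF Suc.prems(1)] Ck_SucD(1)[OF Suc.prems(2)]]])
      (use Suc in \<open>auto intro!: Suc.IH Ck_SucD(2)\<close>)
qed (auto intro!: continuous_intros)

lemma Ck_mult: "Ck k f \<Longrightarrow> Ck k g \<Longrightarrow> Ck k (\<lambda>x. f x * g x)"
proof (induction k arbitrary: f g)
  case (Suc k)
  show ?case
    by (rule Ck_SucI[OF has_derivative_mult[OF Ck_SucD(1)[OF Suc.prems(1)] Ck_SucD(1)[OF Suc.prems(2)]]])
      (intro Ck_add Suc.IH Ck_SucD(2) Suc.prems Ck_SucE; assumption)
qed (auto intro!: continuous_intros)

lemma Ck_uminus: "Ck k f \<Longrightarrow> Ck k (\<lambda>x. - f x)"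
  using Ck_mult[OF Ck_const[of k "-1"]] by simp

lemma Ck_diff: "Ck k f \<Longrightarrow> Ck k g \<Longrightarrow> Ck k (\<lambda>x. f x - g x)"
  using Ck_add[OF _ Ck_uminus] by simp

lemma Ck_prod: "(\<And>i. i \<in> I \<Longrightarrow> Ck k (f i)) \<Longrightarrow> Ck k (\<lambda>x. \<Prod>i\<in>I. f i x)"
  by (induction I rule: infinite_finite_induct) (auto intro: Ck_const Ck_mult)

lemma Ck_power: "Ck k f \<Longrightarrow> Ck k (\<lambda>x. f x ^ m)"
  by (induction m) (auto intro: Ck_const Ck_mult)

lemma Ck_translate: "Ck k f \<Longrightarrow> Ck k (\<lambda>x. f (x + c))"
proof (induction k arbitrary: f)
  case (Suc k)
  show ?case
  proof (rule Ck_SucI)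
    show "((\<lambda>x. f (x + c)) has_derivative frechet_derivative f (at (x + c))) (at x)" for x
      by (rule has_derivative_compose[of "\<lambda>x. x + c" "\<lambda>h. h" x UNIV, OF _ Ck_SucD(1)[OF Suc.prems]])
        (auto intro!: derivative_eq_intros)
    show "Ck k (\<lambda>x. frechet_derivative f (at (x + c)) b)" if "b \<in> Basis" for b
      by (rule Suc.IH) (rule Ck_SucD(2)[OF Suc.prems that])
  qed
qed (auto intro!: continuous_on_compose2[of UNIV _ UNIV "\<lambda>x. x + c"] continuous_intros)

lemma test_functionsI:
  assumes "\<And>k. Ck k u" "bounded {x. u x \<noteq> 0}" "\<And>x. x \<notin> \<Omega> \<Longrightarrow> u x = 0"
  shows "u \<in> test_functions \<Omega>"
  using assms by (auto simp: test_functions_def)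

lemma test_functionsD:
  assumes "u \<in> test_functions \<Omega>"
  shows "Ck k u" "bounded {x. u x \<noteq> 0}" "x \<notin> \<Omega> \<Longrightarrow> u x = 0"
  using assms by (auto simp: test_functions_def dest: compact_imp_bounded bounded_subset[OF _ closure_subset])

lemma test_functions_continuous: "u \<in> test_functions \<Omega> \<Longrightarrow> continuous_on UNIV u"
  using test_functionsD(1)[of u \<Omega> 0] by simp

lemma test_functions_borel [measurable_dest]: "u \<in> test_functions \<Omega> \<Longrightarrow> u \<in> borel_measurable borel"
  by (intro borel_measurable_continuous_onI test_functions_continuous)

lemma test_functions_add:
  assumes "u \<in> test_functions \<Omega>" "v \<in> test_functions \<Omega>"
  shows "(\<lambda>x. u x + v x) \<in> test_functions \<Omega>"
proof (rule test_functionsI)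
  have "bounded ({x. u x \<noteq> 0} \<union> {x. v x \<noteq> 0})" using assms by (simp add: test_functionsD)
  then show "bounded {x. u x + v x \<noteq> 0}" by (rule bounded_subset) auto
qed (use assms in \<open>auto intro!: Ck_add simp: test_functionsD\<close>)

lemma test_functions_cmult:
  assumes "u \<in> test_functions \<Omega>"
  shows "(\<lambda>x. c * u x) \<in> test_functions \<Omega>"
proof (rule test_functionsI)
  have "bounded {x. u x \<noteq> 0}" using assms by (simp add: test_functionsD)
  then show "bounded {x. c * u x \<noteq> 0}" by (rule bounded_subset) auto
qed (use assms in \<open>auto intro!: Ck_mult Ck_const simp: test_functionsD\<close>)

lemma test_functions_diff:
  assumes "u \<in> test_functions \<Omega>" "v \<in> test_functions \<Omega>"
  shows "(\<lambda>x. u x - v x) \<in> test_functions \<Omega>"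
  using test_functions_add[OF assms(1) test_functions_cmult[OF assms(2), of "-1"]] by simp

lemma test_functions_mono: "u \<in> test_functions \<Omega> \<Longrightarrow> \<Omega> \<subseteq> \<Omega>' \<Longrightarrow> u \<in> test_functions \<Omega>'"
  by (auto simp: test_functions_def)

text \<open>Moves the centre of Hardy's inequality, which is given at 0, to other points; the whole
  space is used because \<Omega> itself would move.\<close>

lemma test_functions_translate:
  assumes "u \<in> test_functions UNIV"
  shows "(\<lambda>x. u (x + c)) \<in> test_functions UNIV"
proof (rule test_functionsI)
  have "bounded ((\<lambda>x. x - c) ` {x. u x \<noteq> 0})"
    using assms by (intro bounded_minus_comp bounded_translation_minus) (simp add: test_functionsD)
  then show "bounded {x. u (x + c) \<noteq> 0}" by (rule bounded_subset) (auto simp: image_iff diff_eq_eq eq_diff_eq)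
qed (use assms in \<open>auto intro!: Ck_translate dest: test_functionsD\<close>)

lemma test_functions_bounded:
  assumes "u \<in> test_functions \<Omega>"
  obtains B where "0 < B" "\<And>x. \<bar>u x\<bar> \<le> B"
proof -
  have "compact (closure {x. u x \<noteq> 0})" using assms by (auto simp: test_functions_def)
  moreover have "continuous_on (closure {x. u x \<noteq> 0}) u"
    using test_functions_continuous[OF assms] continuous_on_subset by blast
  ultimately have "bounded (u ` closure {x. u x \<noteq> 0})"
    by (intro compact_imp_bounded compact_continuous_image)
  then obtain B where B: "\<And>x. x \<in> closure {x. u x \<noteq> 0} \<Longrightarrow> \<bar>u x\<bar> \<le> B" "0 < B" by (auto simp: bounded_pos)
  have "\<bar>u x\<bar> \<le> B" for x using B closure_subset[of "{x. u x \<noteq> 0}"] by (cases "u x = 0") auto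
  then show thesis using B that by blast
qed

lemma test_functions_support:
  assumes "u \<in> test_functions \<Omega>"
  obtains R where "0 < R" "\<And>x. norm x > R \<Longrightarrow> u x = 0"
proof -
  obtain R where "0 < R" "\<And>x. u x \<noteq> 0 \<Longrightarrow> norm x \<le> R"
    using test_functionsD(2)[OF assms] by (auto simp: bounded_pos)
  then show thesis using that by (metis not_less)
qed

text \<open>The partial derivatives are continuous, hence bounded on the closed ball, and the ball
  is convex, so the mean value inequality applies.\<close>

lemma test_functions_lipschitz:
  fixes u :: "'a::euclidean_space \<Rightarrow> real"
  assumes u: "u \<in> test_functions \<Omega>" and R: "0 \<le> R"
  obtains L where "0 < L" "\<And>x y. norm x \<le> R \<Longrightarrow> norm y \<le> R \<Longrightarrow> \<bar>u x - u y\<bar> \<le> L * norm (x - y)"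
proof -
  define D where "D x = frechet_derivative u (at x)" for x
  have Ck1: "Ck (Suc 0) u" using u by (rule test_functionsD)
  have der: "(u has_derivative D x) (at x)" for x unfolding D_def by (rule Ck_SucD(1)[OF Ck1])
  have "\<exists>B>0. \<forall>x\<in>cball 0 R. \<bar>D x b\<bar> \<le> B" if "b \<in> Basis" for b
  proof -
    have "continuous_on UNIV (\<lambda>x. D x b)" using Ck_SucD(2)[OF Ck1 that] by (simp add: D_def)
    then have "continuous_on (cball 0 R) (\<lambda>x. D x b)" using continuous_on_subset by blast
    then have "bounded ((\<lambda>x. D x b) ` cball 0 R)"
      by (intro compact_imp_bounded compact_continuous_image) auto
    then show ?thesis by (auto simp: bounded_pos)
  qed
  then obtain B where B: "\<And>b. b \<in> Basis \<Longrightarrow> 0 < B b"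
    "\<And>b x. b \<in> Basis \<Longrightarrow> x \<in> cball 0 R \<Longrightarrow> \<bar>D x b\<bar> \<le> B b" by metis
  define L where "L = (\<Sum>b\<in>Basis. B b)"
  have L: "0 < L" unfolding L_def using B by (intro sum_pos) auto
  have on: "onorm (D x) \<le> L" if x: "x \<in> cball 0 R" for x
  proof (rule onorm_le)
    fix h
    interpret linear "D x" using der[of x] by (rule has_derivative_linear)
    have "norm (D x h) = \<bar>\<Sum>b\<in>Basis. (h \<bullet> b) * D x b\<bar>"
      by (subst euclidean_representation[symmetric, of h]) (simp add: sum scaleR)
    also have "\<dots> \<le> (\<Sum>b\<in>Basis. \<bar>(h \<bullet> b) * D x b\<bar>)" by (rule sum_abs)
    also have "\<dots> \<le> (\<Sum>b\<in>Basis. norm h * B b)"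
      using B x Basis_le_norm by (intro sum_mono) (auto simp: abs_mult intro!: mult_mono)
    also have "\<dots> = L * norm h" by (simp add: L_def sum_distrib_left mult.commute)
    finally show "norm (D x h) \<le> L * norm h" .
  qed
  show thesis
  proof
    show "0 < L" by (rule L)
    fix x y :: 'a assume "norm x \<le> R" "norm y \<le> R"
    then have "norm (u x - u y) \<le> L * norm (x - y)"
      by (intro differentiable_bound[of "cball 0 R" u D])
        (auto intro: has_derivative_at_withinI der on)
    then show "\<bar>u x - u y\<bar> \<le> L * norm (x - y)" by simp
  qed
qed

section \<open>A smooth function positive exactly on a ball\<close>

lemma tendsto_power_poly_exp_minus:
  fixes P :: "real poly"
  shows "((\<lambda>y. y ^ k * poly P y * exp (- y)) \<longlongrightarrow> 0) at_top"
proof (induction P arbitrary: k)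
  case 0
  then show ?case by simp
next
  case (pCons a P)
  have "((\<lambda>y. a * (y ^ k / exp y) + y ^ Suc k * poly P y * exp (- y)) \<longlongrightarrow> a * 0 + 0) at_top"
    by (intro tendsto_intros tendsto_power_div_exp_0 pCons.IH)
  then show ?case by (simp add: algebra_simps exp_minus divide_inverse)
qed

text \<open>These functions are closed under differentiation: \<open>P\<close> is replaced by X^2 (P
  - P'). Smoothness of exp (-1/t), extended by 0, thus becomes an induction over all polynomials
  \<open>P\<close>.\<close>

definition flat :: "real poly \<Rightarrow> real \<Rightarrow> real" where
  "flat P t = (if 0 < t then poly P (1/t) * exp (- (1/t)) else 0)"

lemma flat_has_derivative:
  "(flat P has_real_derivative flat ([:0,0,1:] * (P - pderiv P)) t) (at t)"
proof -
  consider "t > 0" | "t < 0" | "t = 0" by linarith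
  then show ?thesis
  proof cases
    case 1
    have "((\<lambda>t. poly P (1/t) * exp (- (1/t))) has_real_derivative flat ([:0,0,1:] * (P - pderiv P)) t) (at t)"
    proof -
      have inv: "((\<lambda>t. 1/t) has_real_derivative - (1/t * (1/t))) (at t)"
        using 1 by (auto intro!: derivative_eq_intros simp: power2_eq_square)
      have "((\<lambda>t. poly P (1/t) * exp (- (1/t))) has_real_derivative
          poly (pderiv P) (1/t) * - (1/t * (1/t)) * exp (- (1/t))
            + exp (- (1/t)) * - (- (1/t * (1/t))) * poly P (1/t)) (at t)"
        by (intro DERIV_mult DERIV_chain2[OF poly_DERIV inv] DERIV_chain2[OF DERIV_exp] DERIV_minus inv)
      moreover have "poly (pderiv P) (1/t) * - (1/t * (1/t)) * exp (- (1/t))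
            + exp (- (1/t)) * - (- (1/t * (1/t))) * poly P (1/t)
          = flat ([:0,0,1:] * (P - pderiv P)) t"
        unfolding flat_def using 1 by (simp only: if_True poly_mult poly_diff) (simp add: algebra_simps)
      ultimately show ?thesis by simp
    qed
    then show ?thesis
      by (rule has_field_derivative_transform_within_open[where S = "{0<..}"])
        (use 1 in \<open>auto simp: flat_def\<close>)
  next
    case 2
    have "((\<lambda>t. 0) has_real_derivative flat ([:0,0,1:] * (P - pderiv P)) t) (at t)"
      using 2 by (auto simp: flat_def)
    then show ?thesis
      by (rule has_field_derivative_transform_within_open[where S = "{..<0}"])
        (use 2 in \<open>auto simp: flat_def\<close>)
  next
    case 3
    \<comment> \<open>With y = 1/h the difference quotient at 0 is
      \<open>y * poly P y * exp (- y)\<close>, and the exponential beats every polynomial.\<close>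
    have right: "((\<lambda>h. flat P h / h) \<longlongrightarrow> 0) (at_right 0)"
    proof -
      have "((\<lambda>h. (inverse h) ^ 1 * poly P (inverse h) * exp (- inverse h)) \<longlongrightarrow> 0) (at_right 0)"
        by (rule filterlim_compose[OF tendsto_power_poly_exp_minus filterlim_inverse_at_top_right])
      moreover have "\<forall>\<^sub>F h in at_right 0. (inverse h) ^ 1 * poly P (inverse h) * exp (- inverse h) = flat P h / h"
        using eventually_at_right_less[of 0]
        by eventually_elim (simp add: flat_def divide_inverse)
      ultimately show ?thesis by (rule Lim_transform_eventually)
    qed
    have left: "((\<lambda>h. flat P h / h) \<longlongrightarrow> 0) (at_left 0)"
      by (rule tendsto_eventually) (auto simp: flat_def eventually_at_filter)
    have "((\<lambda>h. flat P h / h) \<longlongrightarrow> 0) (at 0)"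
      using left right by (simp add: filterlim_split_at)
    then show ?thesis using 3 by (simp add: DERIV_def flat_def)
  qed
qed

text \<open>The squared distance is chosen because it is a polynomial in \<open>x\<close>. Each
  directional derivative is an affine function times a term of the same form with another
  polynomial, so the induction ranges over all \<open>P\<close>.\<close>

lemma Ck_flat_ball:
  fixes c :: "'a::euclidean_space"
  shows "Ck k (\<lambda>x. flat P (r\<^sup>2 - (x - c) \<bullet> (x - c)))"
proof (induction k arbitrary: P)
  case 0
  have "continuous_on UNIV (flat P)"
    by (intro continuous_at_imp_continuous_on ballI DERIV_isCont[OF flat_has_derivative])
  then have "continuous_on UNIV (\<lambda>x::'a. flat P (r\<^sup>2 - (x - c) \<bullet> (x - c)))"
    by (rule continuous_on_compose2) (auto intro!: continuous_intros)
  then show ?case by simp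
next
  case (Suc k)
  let ?P = "[:0,0,1:] * (P - pderiv P)"
  show ?case
  proof (rule Ck_SucI)
    fix x :: 'a
    show "((\<lambda>x. flat P (r\<^sup>2 - (x - c) \<bullet> (x - c))) has_derivative
      (\<lambda>h. flat ?P (r\<^sup>2 - (x - c) \<bullet> (x - c)) * (- 2 * ((x - c) \<bullet> h)))) (at x)"
    proof -
      have "((\<lambda>x. r\<^sup>2 - (x - c) \<bullet> (x - c)) has_derivative (\<lambda>h. - 2 * ((x - c) \<bullet> h))) (at x)"
        by (auto intro!: derivative_eq_intros simp: inner_commute)
      from has_derivative_compose[OF this flat_has_derivative[unfolded has_field_derivative_def]]
      show ?thesis by simp
    qed
    show "Ck k (\<lambda>x. flat ?P (r\<^sup>2 - (x - c) \<bullet> (x - c)) * (- 2 * ((x - c) \<bullet> b)))" for b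
      by (intro Ck_mult Suc.IH Ck_const Ck_inner)
  qed
qed

text \<open>As \<open>flat 1 t\<close> is exp (-1/t) for positive \<open>t\<close>, this is the
  usual mollifier without normalisation; what counts is its smoothness, the set where it is
  positive, and its range within [0, 1).\<close>

definition bump :: "'a::euclidean_space \<Rightarrow> real \<Rightarrow> 'a \<Rightarrow> real" where
  "bump c r x = flat 1 (r\<^sup>2 - (x - c) \<bullet> (x - c))"

lemma bump_Ck: "Ck k (bump c r)"
  unfolding bump_def by (rule Ck_flat_ball)

lemma bump_bounds: "0 \<le> bump c r x" "bump c r x < 1"
  by (auto simp: bump_def flat_def)

lemma bump_pos_iff:
  assumes "0 \<le> r"
  shows "0 < bump c r x \<longleftrightarrow> x \<in> ball c r"
proof -
  have "0 < bump c r x \<longleftrightarrow> (norm (x - c))\<^sup>2 < r\<^sup>2"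
    by (auto simp: bump_def flat_def power2_norm_eq_inner)
  also have "\<dots> \<longleftrightarrow> norm (x - c) < r" 
    using power_mono_iff[of r "norm (x - c)" 2] assms by (simp flip: not_le)
  finally show ?thesis by (simp add: dist_norm norm_minus_commute)
qed

section \<open>The Gagliardo seminorm and the Hardy integral\<close>

lemma ball_cball_borel [measurable]:
  fixes c :: "'a::euclidean_space"
  shows "ball c r \<in> sets borel" "cball c r \<in> sets borel" "- cball c r \<in> sets borel"
  by auto

lemma nn_integral_lborel_translate:
  fixes f :: "'a::euclidean_space \<Rightarrow> ennreal"
  assumes [measurable]: "f \<in> borel_measurable borel"
  shows "(\<integral>\<^sup>+x. f (x + c) \<partial>lborel) = (\<integral>\<^sup>+x. f x \<partial>lborel)"
proof -
  have "(\<integral>\<^sup>+x. f x \<partial>lborel) = (\<integral>\<^sup>+x. f x \<partial>(distr lborel borel ((+) c)))" by (simp add: lborel_distr_plus)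
  also have "\<dots> = (\<integral>\<^sup>+x. f (c + x) \<partial>lborel)" by (rule nn_integral_distr) auto
  finally show ?thesis by (simp add: add.commute)
qed

text \<open>A substitute for polar coordinates: \<open>f\<close> is dominated by a countable sum of
  constants on balls, whose contributions form a geometric series.\<close>

lemma nn_integral_dyadic_bound:
  fixes f :: "'a::euclidean_space \<Rightarrow> ennreal" and c r :: "nat \<Rightarrow> real"
  assumes le: "\<And>z. f z \<noteq> 0 \<Longrightarrow> \<exists>j. norm z \<le> r j \<and> f z \<le> ennreal (c j)"
    and cr: "\<And>j. 0 \<le> c j" "\<And>j. 0 \<le> r j"
    and q: "0 \<le> q" "q < 1" "\<And>j. c j * r j ^ DIM('a) \<le> B * q ^ j"
  shows "(\<integral>\<^sup>+z. f z \<partial>lborel) < \<infinity>"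
proof -
  define v where "v = unit_ball_vol (real DIM('a))"
  have v: "0 \<le> v" by (simp add: v_def)
  have pt: "f z \<le> (\<Sum>j. ennreal (c j) * indicator (cball 0 (r j)) z)" for z
  proof (cases "f z = 0")
    case False
    then obtain j where "norm z \<le> r j" "f z \<le> ennreal (c j)" using le by blast
    then have "f z \<le> ennreal (c j) * indicator (cball 0 (r j)) z" by simp
    also have "\<dots> \<le> (\<Sum>j. ennreal (c j) * indicator (cball 0 (r j)) z)"
      using sum_le_suminf[of "\<lambda>j. ennreal (c j) * indicator (cball 0 (r j)) z" "{j}"]
      by (simp del: indicator_simps sum_mult_indicator)
    finally show ?thesis .
  qed auto
  have "(\<integral>\<^sup>+z. f z \<partial>lborel) \<le> (\<integral>\<^sup>+z. (\<Sum>j. ennreal (c j) * indicator (cball 0 (r j)) z) \<partial>(lborel :: 'a measure))"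
    by (intro nn_integral_mono pt)
  also have "\<dots> = (\<Sum>j. ennreal (c j) * emeasure lborel (cball (0::'a) (r j)))"
    by (subst nn_integral_suminf) (auto simp: nn_integral_cmult_indicator)
  also have "\<dots> \<le> (\<Sum>j. ennreal (v * B * q ^ j))"
  proof (intro suminf_le)
    fix j
    have "ennreal (c j) * emeasure lborel (cball (0::'a) (r j)) = ennreal (c j * (v * r j ^ DIM('a)))"
      using cr v by (simp add: emeasure_cball v_def flip: ennreal_mult)
    also have "\<dots> \<le> ennreal (v * B * q ^ j)"
      using mult_left_mono[OF q(3) v, of j] by (intro ennreal_leI) (simp add: mult_ac)
    finally show "ennreal (c j) * emeasure lborel (cball (0::'a) (r j)) \<le> ennreal (v * B * q ^ j)" .
  qed auto
  also have "\<dots> < \<infinity>"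
  proof -
    have "0 \<le> c 0 * r 0 ^ DIM('a)" using cr by simp
    also have "\<dots> \<le> B" using q(3)[of 0] by simp
    finally have "0 \<le> B" .
    then have "\<And>j. 0 \<le> v * B * q ^ j" using q v by auto
    moreover have "summable (\<lambda>j. v * B * q ^ j)" using q by (intro summable_mult summable_geometric) auto
    ultimately show ?thesis by (subst suminf_ennreal2) auto
  qed
  finally show ?thesis .
qed

lemma dyadic_below_one:
  fixes r :: real
  assumes "0 < r" "r \<le> 1"
  obtains j :: nat where "1 / 2 ^ Suc j < r" "r \<le> 1 / 2 ^ j"
proof -
  have ex: "\<exists>j::nat. 1 / 2 ^ Suc j < r"
  proof -
    obtain n where "(1/2) ^ n < r" using real_arch_pow_inv[of r "1/2"] assms by auto
    moreover have "(1/2) ^ Suc n \<le> (1/2::real) ^ n" by simp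
    ultimately show ?thesis by (metis le_less_trans power_one_over)
  qed
  define j where "j = (LEAST j::nat. 1 / 2 ^ Suc j < r)"
  have "1 / 2 ^ Suc j < r" unfolding j_def by (rule LeastI_ex[OF ex])
  moreover have "r \<le> 1 / 2 ^ j"
  proof (cases j)
    case (Suc i)
    then have "\<not> 1 / 2 ^ Suc i < r" unfolding j_def by (intro not_less_Least) simp
    then show ?thesis using Suc by simp
  qed (use assms in simp)
  ultimately show thesis by (rule that)
qed

lemma dyadic_above_one:
  fixes r :: real
  assumes "1 < r"
  obtains j :: nat where "2 ^ j < r" "r \<le> 2 ^ Suc j"
proof -
  have ex: "\<exists>j::nat. r \<le> 2 ^ Suc j"
  proof -
    obtain n where "r < 2 ^ n" using real_arch_pow[of 2 r] by auto
    moreover have "2 ^ n \<le> (2::real) ^ Suc n" by simp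
    ultimately show ?thesis by (meson less_imp_le order_trans)
  qed
  define j where "j = (LEAST j::nat. r \<le> 2 ^ Suc j)"
  have "r \<le> 2 ^ Suc j" unfolding j_def by (rule LeastI_ex[OF ex])
  moreover have "2 ^ j < r"
  proof (cases j)
    case (Suc i)
    then have "\<not> r \<le> 2 ^ Suc i" unfolding j_def by (intro not_less_Least) simp
    then show ?thesis using Suc by simp
  qed (use assms in simp)
  ultimately show thesis using that by blast
qed

lemma nn_integral_norm_powr_near:
  fixes a :: real
  assumes a: "0 < a"
  shows "(\<integral>\<^sup>+z. ennreal (norm z powr (a - real DIM('a))) * indicator (cball 0 1) z \<partial>(lborel :: 'a::euclidean_space measure)) < \<infinity>"
proof (rule nn_integral_dyadic_bound)
  \<comment> \<open>The exponent \<open>- s\<close> can have either sign, since \<open>a\<close> may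
    exceed the dimension. The factor \<open>2 powr \<bar>s\<bar>\<close> below covers the ratio of
    the norm to its dyadic scale in both cases.\<close>
  define s where "s = real DIM('a) - a"
  define c where "c j = 2 powr \<bar>s\<bar> * (2 ^ j) powr s" for j :: nat
  show "0 \<le> c j" for j by (simp add: c_def)
  show "\<exists>j. norm z \<le> 1 / 2 ^ j \<and>
      ennreal (norm z powr (a - real DIM('a))) * indicator (cball 0 1) z \<le> ennreal (c j)"
    if nz: "ennreal (norm z powr (a - real DIM('a))) * indicator (cball 0 1) z \<noteq> 0" for z :: 'a
  proof -
    have z: "0 < norm z" "norm z \<le> 1" using nz by (auto simp: indicator_def split: if_splits)
    then obtain j where j: "1 / 2 ^ Suc j < norm z" "norm z \<le> 1 / 2 ^ j" using dyadic_below_one by blast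
    define t where "t = 2 ^ j * norm z"
    have t: "1 / 2 < t" "t \<le> 1" "0 < t" using j z by (auto simp: t_def field_simps)
    have "t powr (- s) \<le> 2 powr \<bar>s\<bar>"
    proof (cases "0 \<le> s")
      case True
      have "t powr (- s) \<le> (1/2) powr (- s)" using t True by (intro powr_mono2') auto
      then show ?thesis using True by (simp add: powr_minus powr_divide)
    next
      case False
      have "t powr (- s) \<le> 1 powr (- s)" using t False by (intro powr_mono2) auto
      also have "1 powr (- s) \<le> 2 powr \<bar>s\<bar>" by (simp add: ge_one_powr_ge_zero)
      finally show ?thesis .
    qed
    moreover have "norm z powr (- s) = (2 ^ j) powr s * t powr (- s)"
      by (simp add: t_def powr_mult powr_minus)
    ultimately have "norm z powr (- s) \<le> c j"
      by (simp add: c_def mult.commute)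
    then show ?thesis using j z by (intro exI[of _ j]) (auto simp: s_def intro: ennreal_leI)
  qed
  show "c j * (1 / 2 ^ j) ^ DIM('a) \<le> 2 powr \<bar>s\<bar> * (2 powr - a) ^ j" for j
  proof -
    have "(1 / 2 ^ j) ^ DIM('a) = 2 powr (- real j * real DIM('a))"
      by (simp add: powr_minus powr_realpow[symmetric] powr_powr divide_inverse power_inverse flip: powr_realpow)
    moreover have "(2 ^ j) powr s = 2 powr (real j * s)" by (simp add: powr_powr flip: powr_realpow)
    moreover have "(2 powr - a) ^ j = 2 powr (- a * real j)" by (simp add: powr_powr flip: powr_realpow)
    ultimately show ?thesis by (simp add: c_def s_def algebra_simps flip: powr_add)
  qed
  show "2 powr - a < 1" using a by (intro powr_less_one) auto
qed auto

lemma nn_integral_norm_powr_far: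
  fixes b :: real
  assumes b: "0 < b"
  shows "(\<integral>\<^sup>+z. ennreal (norm z powr (- (real DIM('a) + b))) * indicator (- cball 0 1) z \<partial>(lborel :: 'a::euclidean_space measure)) < \<infinity>"
proof (rule nn_integral_dyadic_bound)
  define c where "c j = (2 ^ j) powr (- (real DIM('a) + b))" for j :: nat
  show "0 \<le> c j" for j by (simp add: c_def)
  show "\<exists>j. norm z \<le> 2 ^ Suc j \<and>
      ennreal (norm z powr (- (real DIM('a) + b))) * indicator (- cball 0 1) z \<le> ennreal (c j)"
    if nz: "ennreal (norm z powr (- (real DIM('a) + b))) * indicator (- cball 0 1) z \<noteq> 0" for z :: 'a
  proof -
    have z: "1 < norm z" using nz by (auto simp: indicator_def split: if_splits)
    then obtain j where j: "2 ^ j < norm z" "norm z \<le> 2 ^ Suc j" using dyadic_above_one by blast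
    have "norm z powr (- (real DIM('a) + b)) \<le> c j"
      unfolding c_def using b j by (intro powr_mono2') auto
    then show ?thesis using j z by (intro exI[of _ j]) (auto intro: ennreal_leI)
  qed
  show "c j * (2 ^ Suc j) ^ DIM('a) \<le> 2 ^ DIM('a) * (2 powr - b) ^ j" for j
  proof -
    have "(2 ^ Suc j) ^ DIM('a) = 2 ^ DIM('a) * 2 powr (real j * real DIM('a))"
      by (simp add: power_mult_distrib powr_powr flip: powr_realpow)
    moreover have "c j = 2 powr (- real j * (real DIM('a) + b))" by (simp add: c_def powr_powr algebra_simps flip: powr_realpow)
    moreover have "(2 powr - b) ^ j = 2 powr (- b * real j)" by (simp add: powr_powr flip: powr_realpow)
    moreover have "2 powr (- real j * (real DIM('a) + b)) * 2 powr (real j * real DIM('a)) = 2 powr (- b * real j)"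
      by (simp add: algebra_simps flip: powr_add)
    ultimately show ?thesis by (simp add: mult_ac)
  qed
  show "2 powr - b < 1" using b by (intro powr_less_one) auto
qed auto

text \<open>The weighted difference quotient and the Hardy quotient are linear in \<open>u\<close>, so that the
  seminorm and the Hardy integral become \<open>p\<close>-th powers of \<open>L\<^sup>p\<close> norms.\<close>

definition dq :: "real \<Rightarrow> real \<Rightarrow> ('a::euclidean_space \<Rightarrow> real) \<Rightarrow> 'a \<times> 'a \<Rightarrow> real" where
  "dq p \<alpha> u z = (u (fst z) - u (snd z)) / norm (fst z - snd z) powr (real DIM('a) / p + \<alpha>)"

definition gag :: "real \<Rightarrow> real \<Rightarrow> ('a::euclidean_space \<Rightarrow> real) \<Rightarrow> ennreal" where
  "gag p \<alpha> u = pint p lborel (dq p \<alpha> u)"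

definition hq :: "real \<Rightarrow> 'a::euclidean_space \<Rightarrow> ('a \<Rightarrow> real) \<Rightarrow> 'a \<Rightarrow> real" where
  "hq \<alpha> c u x = u x / norm (x - c) powr \<alpha>"

definition hardy :: "real \<Rightarrow> real \<Rightarrow> 'a::euclidean_space \<Rightarrow> ('a \<Rightarrow> real) \<Rightarrow> ennreal" where
  "hardy p \<alpha> c u = pint p lborel (hq \<alpha> c u)"

text \<open>The inner integral of the seminorm. It bounds the mean oscillation of \<open>u\<close>
  around the single point \<open>x\<close>, which is how the Sobolev inequality and the comparison
  with mesh averages both make use of the seminorm.\<close>

definition energy_density :: "real \<Rightarrow> real \<Rightarrow> ('a::euclidean_space \<Rightarrow> real) \<Rightarrow> 'a \<Rightarrow> ennreal" where
  "energy_density p \<alpha> u x =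
     (\<integral>\<^sup>+y. ennreal (\<bar>u x - u y\<bar> powr p / norm (x - y) powr (real DIM('a) + p * \<alpha>)) \<partial>lborel)"

section \<open>Measurability and linearity of the quotients\<close>

lemma borel_measurable_fst_snd [measurable]:
  "(fst :: 'a::euclidean_space \<times> 'a \<Rightarrow> 'a) \<in> borel_measurable borel"
  "(snd :: 'a::euclidean_space \<times> 'a \<Rightarrow> 'a) \<in> borel_measurable borel"
  by (auto intro!: borel_measurable_continuous_onI continuous_intros)

lemma dq_measurable [measurable (raw)]:
  fixes u :: "'a::euclidean_space \<Rightarrow> real"
  assumes [measurable]: "u \<in> borel_measurable borel"
  shows "dq p \<alpha> u \<in> borel_measurable borel"
proof -
  have [measurable]: "(\<lambda>z::'a \<times> 'a. norm (fst z - snd z)) \<in> borel_measurable borel"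
    by (intro borel_measurable_continuous_onI continuous_intros)
  show ?thesis unfolding dq_def by measurable
qed

lemma hq_measurable [measurable (raw)]:
  fixes u :: "'a::euclidean_space \<Rightarrow> real"
  assumes [measurable]: "u \<in> borel_measurable borel"
  shows "hq \<alpha> c u \<in> borel_measurable borel"
  unfolding hq_def by measurable

lemma abs_dq_powr:
  fixes u :: "'a::euclidean_space \<Rightarrow> real"
  assumes "p \<noteq> 0"
  shows "\<bar>dq p \<alpha> u z\<bar> powr p
    = \<bar>u (fst z) - u (snd z)\<bar> powr p / norm (fst z - snd z) powr (real DIM('a) + p * \<alpha>)"
  using assms by (simp add: dq_def abs_div powr_divide powr_powr algebra_simps)

lemma abs_hq_powr: "\<bar>hq \<alpha> c u x\<bar> powr p = \<bar>u x\<bar> powr p / norm (x - c) powr (p * \<alpha>)"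
  by (simp add: hq_def abs_div powr_divide powr_powr mult.commute)

lemma dq_add: "dq p \<alpha> (\<lambda>x. u x + v x) = (\<lambda>z. dq p \<alpha> u z + dq p \<alpha> v z)"
  and dq_diff: "dq p \<alpha> (\<lambda>x. u x - v x) = (\<lambda>z. dq p \<alpha> u z - dq p \<alpha> v z)"
  and dq_cmult: "dq p \<alpha> (\<lambda>x. c * u x) = (\<lambda>z. c * dq p \<alpha> u z)"
  by (auto simp: dq_def algebra_simps diff_divide_distrib add_divide_distrib)

lemma hq_diff: "hq \<alpha> c (\<lambda>x. u x - v x) = (\<lambda>z. hq \<alpha> c u z - hq \<alpha> c v z)"
  and hq_cmult: "hq \<alpha> c (\<lambda>x. k * u x) = (\<lambda>z. k * hq \<alpha> c u z)"
  by (auto simp: hq_def algebra_simps diff_divide_distrib add_divide_distrib)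

lemma energy_density_measurable [measurable (raw)]:
  fixes u :: "'a::euclidean_space \<Rightarrow> real"
  assumes [measurable]: "u \<in> borel_measurable borel"
  shows "energy_density p \<alpha> u \<in> borel_measurable borel"
  unfolding energy_density_def by measurable

lemma gag_eq_energy:
  fixes u :: "'a::euclidean_space \<Rightarrow> real"
  assumes p: "p \<noteq> 0" and [measurable]: "u \<in> borel_measurable borel"
  shows "gag p \<alpha> u = (\<integral>\<^sup>+x. energy_density p \<alpha> u x \<partial>lborel)"
proof -
  let ?f = "\<lambda>z::'a \<times> 'a. ennreal (\<bar>u (fst z) - u (snd z)\<bar> powr p / norm (fst z - snd z) powr (real DIM('a) + p * \<alpha>))"
  have "gag p \<alpha> u = (\<integral>\<^sup>+z. ?f z \<partial>(lborel \<Otimes>\<^sub>M lborel))"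
    unfolding gag_def pint_def abs_dq_powr[OF p] lborel_prod ..
  also have "\<dots> = (\<integral>\<^sup>+x. \<integral>\<^sup>+y. ?f (x, y) \<partial>lborel \<partial>lborel)"
    by (rule lborel.nn_integral_fst[symmetric]) measurable
  finally show ?thesis by (simp add: energy_density_def)
qed

text \<open>Near the diagonal the Lipschitz bound improves the kernel to the power
  \<open>p * (1 - \<alpha>) - n\<close>, integrable at 0 because \<alpha> < 1; far from it,
  boundedness leaves the integrable tail \<open>- (n + p * \<alpha>)\<close>. The integrand vanishes
  unless one of the two points lies in the ball carrying the support, and the integral over the
  other point does not depend on where that one lies.\<close>

lemma gag_finite_test_function:
  fixes u :: "'a::euclidean_space \<Rightarrow> real"
  assumes p: "1 \<le> p" and \<alpha>: "0 < \<alpha>" "\<alpha> < 1" and u: "u \<in> test_functions \<Omega>"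
  shows "gag p \<alpha> u < \<infinity>"
proof -
  let ?n = "real DIM('a)"
  note [measurable] = test_functions_borel[OF u]
  obtain M where M: "0 < M" "\<And>x. \<bar>u x\<bar> \<le> M" using test_functions_bounded[OF u] by blast
  obtain R where R: "0 < R" "\<And>x. norm x > R \<Longrightarrow> u x = 0" using test_functions_support[OF u] by blast
  \<comment> \<open>Radius \<open>R + 1\<close>, because of two points at distance at most 1 only
    one is known to lie within radius \<open>R\<close>.\<close>
  obtain L where L: "0 < L" "\<And>x y. norm x \<le> R + 1 \<Longrightarrow> norm y \<le> R + 1 \<Longrightarrow> \<bar>u x - u y\<bar> \<le> L * norm (x - y)"
    using test_functions_lipschitz[OF u, of "R + 1"] R by auto
  define \<kappa> where "\<kappa> z = ennreal (L powr p) * (ennreal (norm z powr (p * (1 - \<alpha>) - ?n)) * indicator (cball 0 1) z)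
    + ennreal ((2 * M) powr p) * (ennreal (norm z powr (- (?n + p * \<alpha>))) * indicator (- cball 0 1) z)" for z :: 'a
  have [measurable]: "\<kappa> \<in> borel_measurable borel" unfolding \<kappa>_def by measurable
  have "(\<integral>\<^sup>+z. \<kappa> z \<partial>lborel) = ennreal (L powr p) * (\<integral>\<^sup>+z. ennreal (norm z powr (p * (1 - \<alpha>) - ?n)) * indicator (cball 0 1) z \<partial>(lborel::'a measure))
    + ennreal ((2 * M) powr p) * (\<integral>\<^sup>+z. ennreal (norm z powr (- (?n + p * \<alpha>))) * indicator (- cball 0 1) z \<partial>(lborel::'a measure))"
    unfolding \<kappa>_def by (simp add: nn_integral_add nn_integral_cmult)
  also have "\<dots> < \<infinity>"
    using nn_integral_norm_powr_near[of "p * (1 - \<alpha>)", where 'a='a] nn_integral_norm_powr_far[of "p * \<alpha>", where 'a='a] p \<alpha>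
    by (simp add: ennreal_mult_less_top)
  finally have \<kappa>: "(\<integral>\<^sup>+z. \<kappa> z \<partial>lborel) < \<infinity>" .
  have bound: "ennreal (\<bar>dq p \<alpha> u z\<bar> powr p)
      \<le> indicator (cball 0 R) (fst z) * \<kappa> (fst z - snd z) + indicator (cball 0 R) (snd z) * \<kappa> (fst z - snd z)" for z
  proof (cases "u (fst z) = u (snd z)")
    case True
    then show ?thesis using p by (simp add: dq_def)
  next
    case False
    define x y where "x = fst z" and "y = snd z"
    have in_ball: "norm x \<le> R \<or> norm y \<le> R" using False R by (metis not_le x_def y_def)
    have "ennreal (\<bar>dq p \<alpha> u z\<bar> powr p) \<le> \<kappa> (x - y)"
    proof (cases "norm (x - y) \<le> 1")
      case True
      have "norm x \<le> norm y + norm (x - y)" "norm y \<le> norm x + norm (x - y)"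
        using norm_triangle_sub[of x y] norm_triangle_sub[of y x] by (auto simp: norm_minus_commute)
      then have "norm x \<le> R + 1" "norm y \<le> R + 1" using True in_ball by linarith+
      then have "\<bar>u x - u y\<bar> powr p \<le> (L * norm (x - y)) powr p" using L p by (intro powr_mono2) auto
      also have "\<dots> = L powr p * norm (x - y) powr p" by (simp add: powr_mult)
      finally have "\<bar>dq p \<alpha> u z\<bar> powr p \<le> L powr p * norm (x - y) powr p / norm (x - y) powr (?n + p * \<alpha>)"
        using p by (simp add: abs_dq_powr x_def y_def divide_right_mono)
      also have "\<dots> = L powr p * norm (x - y) powr (p * (1 - \<alpha>) - ?n)"
        by (simp add: algebra_simps powr_diff powr_add)
      finally show ?thesis using True by (simp add: \<kappa>_def ennreal_leI flip: ennreal_mult)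
    next
      case False
      have "\<bar>u x - u y\<bar> \<le> 2 * M" using M(2)[of x] M(2)[of y] by linarith
      then have "\<bar>u x - u y\<bar> powr p \<le> (2 * M) powr p" using p by (intro powr_mono2) auto
      then have "\<bar>dq p \<alpha> u z\<bar> powr p \<le> (2 * M) powr p * norm (x - y) powr (- (?n + p * \<alpha>))"
        unfolding powr_minus using p by (simp add: abs_dq_powr x_def y_def divide_inverse mult_right_mono)
      then show ?thesis using False by (simp add: \<kappa>_def ennreal_leI flip: ennreal_mult)
    qed
    also have "\<kappa> (x - y) \<le> indicator (cball 0 R) x * \<kappa> (x - y) + indicator (cball 0 R) y * \<kappa> (x - y)"
      using in_ball by (auto simp: indicator_def)
    finally show ?thesis by (simp add: x_def y_def)
  qed
  have "gag p \<alpha> u \<le> (\<integral>\<^sup>+z. indicator (cball 0 R) (fst z) * \<kappa> (fst z - snd z) + indicator (cball 0 R) (snd z) * \<kappa> (fst z - snd z) \<partial>(lborel \<Otimes>\<^sub>M lborel))"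
    unfolding gag_def pint_def lborel_prod by (intro nn_integral_mono bound)
  also have "\<dots> = (\<integral>\<^sup>+z. indicator (cball 0 R) (fst z) * \<kappa> (fst z - snd z) \<partial>(lborel \<Otimes>\<^sub>M lborel))
    + (\<integral>\<^sup>+z. indicator (cball 0 R) (snd z) * \<kappa> (fst z - snd z) \<partial>(lborel \<Otimes>\<^sub>M lborel))"
    by (rule nn_integral_add) measurable
  also have "(\<integral>\<^sup>+z. indicator (cball 0 R) (fst z) * \<kappa> (fst z - snd z) \<partial>(lborel \<Otimes>\<^sub>M lborel))
    = (\<integral>\<^sup>+x. indicator (cball 0 R) x * (\<integral>\<^sup>+y. \<kappa> (x - y) \<partial>lborel) \<partial>lborel)"
    by (subst lborel.nn_integral_fst[symmetric]) (auto simp: nn_integral_cmult)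
  also have "(\<integral>\<^sup>+z. indicator (cball 0 R) (snd z) * \<kappa> (fst z - snd z) \<partial>(lborel \<Otimes>\<^sub>M lborel))
    = (\<integral>\<^sup>+y. indicator (cball 0 R) y * (\<integral>\<^sup>+x. \<kappa> (x - y) \<partial>lborel) \<partial>lborel)"
    by (subst lborel_pair.nn_integral_snd[symmetric]) (auto simp: nn_integral_cmult)
  also have "(\<lambda>x. \<integral>\<^sup>+y. \<kappa> (x - y) \<partial>lborel) = (\<lambda>x. \<integral>\<^sup>+z. \<kappa> z \<partial>lborel)"
  proof
    fix x
    have "\<kappa> (x - y) = \<kappa> (y + (- x))" for y by (simp add: \<kappa>_def norm_minus_commute indicator_def)
    then show "(\<integral>\<^sup>+y. \<kappa> (x - y) \<partial>lborel) = (\<integral>\<^sup>+z. \<kappa> z \<partial>lborel)"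
      using nn_integral_lborel_translate[of \<kappa> "- x"] by simp
  qed
  also have "(\<lambda>y. \<integral>\<^sup>+x. \<kappa> (x - y) \<partial>lborel) = (\<lambda>y. \<integral>\<^sup>+z. \<kappa> z \<partial>lborel)"
    using nn_integral_lborel_translate[of \<kappa> "- _"] by simp
  also have "(\<integral>\<^sup>+x. indicator (cball 0 R) x * (\<integral>\<^sup>+z. \<kappa> z \<partial>lborel) \<partial>(lborel :: 'a measure))
    + (\<integral>\<^sup>+y. indicator (cball 0 R) y * (\<integral>\<^sup>+z. \<kappa> z \<partial>lborel) \<partial>(lborel :: 'a measure)) < \<infinity>"
    using \<kappa> emeasure_lborel_cball_finite[of "0::'a" R] by (simp add: nn_integral_multc ennreal_mult_less_top)
  finally show ?thesis .
qed

section \<open>The fractional Sobolev inequality\<close>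

text \<open>Hoelder's inequality against a constant, up to a factor of 2 that avoids any convexity:
  integrate \<open>t \<le> A + A powr (1 - q) * t powr q\<close> for the best constant \<open>A\<close>.\<close>

lemma nn_integral_le_powr_mean:
  fixes f :: "'b \<Rightarrow> real" and q m I :: real
  assumes q: "1 \<le> q" and [measurable]: "f \<in> borel_measurable M" "E \<in> sets M" and f0: "\<And>x. 0 \<le> f x"
    and m: "0 < m" "emeasure M E = ennreal m"
    and I: "0 \<le> I" "(\<integral>\<^sup>+x. ennreal (f x powr q) * indicator E x \<partial>M) \<le> ennreal I"
  shows "(\<integral>\<^sup>+x. ennreal (f x) * indicator E x \<partial>M) \<le> ennreal (2 * m * (I / m) powr (1 / q))"
proof (cases "I = 0")
  case True
  then have "(\<integral>\<^sup>+x. ennreal (f x powr q) * indicator E x \<partial>M) = 0" using I by simp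
  then have "AE x in M. ennreal (f x powr q) * indicator E x = 0"
    by (subst (asm) nn_integral_0_iff_AE) auto
  then have "AE x in M. ennreal (f x) * indicator E x = 0"
    by eventually_elim (auto simp: indicator_def powr_def split: if_splits)
  then have "(\<integral>\<^sup>+x. ennreal (f x) * indicator E x \<partial>M) = 0"
    by (subst nn_integral_0_iff_AE) auto
  then show ?thesis by simp
next
  case False
  define A where "A = (I / m) powr (1 / q)"
  have A: "0 < A" using False I m by (simp add: A_def)
  have Aq: "A powr q = I / m" using q I m by (simp add: A_def powr_powr)
  have pw: "t \<le> A + A powr (1 - q) * t powr q" if "0 \<le> t" for t
  proof (cases "t \<le> A")
    case False
    have "t = t powr (1 - q) * t powr q" using False A that by (simp flip: powr_add)
    also have "\<dots> \<le> A powr (1 - q) * t powr q"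
      using False A q by (intro mult_right_mono powr_mono2') auto
    finally show ?thesis using A by simp
  qed (use A in \<open>simp add: add_increasing2\<close>)
  have "(\<integral>\<^sup>+x. ennreal (f x) * indicator E x \<partial>M)
      \<le> (\<integral>\<^sup>+x. ennreal A * indicator E x + ennreal (A powr (1 - q)) * (ennreal (f x powr q) * indicator E x) \<partial>M)"
    using pw f0 A by (intro nn_integral_mono) (auto simp: indicator_def simp flip: ennreal_mult ennreal_plus intro!: ennreal_leI)
  also have "\<dots> = ennreal A * ennreal m + ennreal (A powr (1 - q)) * (\<integral>\<^sup>+x. ennreal (f x powr q) * indicator E x \<partial>M)"
    using m by (simp add: nn_integral_add nn_integral_cmult nn_integral_cmult_indicator)
  also have "\<dots> \<le> ennreal A * ennreal m + ennreal (A powr (1 - q)) * ennreal I"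
    using I by (intro add_left_mono mult_left_mono) auto
  also have "\<dots> = ennreal (A * m + A powr (1 - q) * I)"
    using A m I by (simp add: ennreal_mult)
  also have "A powr (1 - q) * I = m * A"
  proof -
    have "A powr (1 - q) * I = m * (A powr (1 - q) * A powr q)" using Aq m by simp
    also have "\<dots> = m * A" using A by (simp flip: powr_add)
    finally show ?thesis .
  qed
  finally show ?thesis by (simp add: A_def algebra_simps)
qed

text \<open>Within distance \<open>r\<close> of \<open>x\<close> the kernel is at least
  \<open>r powr - (n + p * \<alpha>)\<close>.\<close>

lemma nn_integral_diff_le_energy_density:
  fixes u :: "'a::euclidean_space \<Rightarrow> real"
  assumes p: "1 \<le> p" and \<alpha>: "0 < \<alpha>" and [measurable]: "u \<in> borel_measurable borel"
    and E: "E \<subseteq> cball x r"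
  shows "(\<integral>\<^sup>+y. ennreal (\<bar>u x - u y\<bar> powr p) * indicator E y \<partial>lborel)
    \<le> ennreal (r powr (real DIM('a) + p * \<alpha>)) * energy_density p \<alpha> u x"
proof -
  let ?s = "real DIM('a) + p * \<alpha>"
  have "ennreal (\<bar>u x - u y\<bar> powr p) * indicator E y
      \<le> ennreal (r powr ?s) * ennreal (\<bar>u x - u y\<bar> powr p / norm (x - y) powr ?s)" for y
  proof (cases "y \<in> E \<and> x \<noteq> y")
    case True
    then have d: "0 < norm (x - y)" "norm (x - y) \<le> r" using E by (auto simp: dist_norm)
    have "norm (x - y) powr ?s \<le> r powr ?s" using d p \<alpha> by (intro powr_mono2) auto
    then have "\<bar>u x - u y\<bar> powr p * norm (x - y) powr ?s \<le> \<bar>u x - u y\<bar> powr p * r powr ?s"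
      by (intro mult_left_mono) auto
    then have "\<bar>u x - u y\<bar> powr p \<le> r powr ?s * (\<bar>u x - u y\<bar> powr p / norm (x - y) powr ?s)"
      using d by (simp add: field_simps)
    then show ?thesis using True by (simp add: ennreal_leI flip: ennreal_mult)
  qed (use p in \<open>auto simp: indicator_def\<close>)
  then have "(\<integral>\<^sup>+y. ennreal (\<bar>u x - u y\<bar> powr p) * indicator E y \<partial>lborel)
      \<le> (\<integral>\<^sup>+y. ennreal (r powr ?s) * ennreal (\<bar>u x - u y\<bar> powr p / norm (x - y) powr ?s) \<partial>lborel)"
    by (intro nn_integral_mono) auto
  also have "\<dots> = ennreal (r powr ?s) * energy_density p \<alpha> u x"
    unfolding energy_density_def by (intro nn_integral_cmult) measurable
  finally show ?thesis .
qed

lemma pint_finite_test_function: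
  fixes u :: "'a::euclidean_space \<Rightarrow> real"
  assumes q: "0 < q" and u: "u \<in> test_functions \<Omega>"
  shows "pint q lborel u < \<infinity>"
proof -
  obtain M where M: "0 < M" "\<And>x. \<bar>u x\<bar> \<le> M" using test_functions_bounded[OF u] by blast
  obtain R where R: "0 < R" "\<And>x. norm x > R \<Longrightarrow> u x = 0" using test_functions_support[OF u] by blast
  have "ennreal (\<bar>u x\<bar> powr q) \<le> ennreal (M powr q) * indicator (cball 0 R) x" for x
    using R(2)[of x] M(2)[of x] q by (cases "norm x > R") (auto intro!: ennreal_leI powr_mono2)
  then have "pint q lborel u \<le> (\<integral>\<^sup>+x. ennreal (M powr q) * indicator (cball (0::'a) R) x \<partial>lborel)"
    unfolding pint_def by (intro nn_integral_mono) auto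
  also have "\<dots> < \<infinity>"
    using emeasure_lborel_cball_finite[of "0::'a" R] by (simp add: nn_integral_cmult_indicator ennreal_mult_less_top)
  finally show ?thesis .
qed

text \<open>Averaging over balls bounds \<open>\<bar>u x\<bar> powr p\<close> by
  \<open>r powr (p * \<alpha>) * energy_density u x + r powr (p * \<alpha> - n) * N powr \<theta>\<close>, where \<open>N\<close> is the
  integral to be estimated; the best \<open>r\<close> makes \<open>N\<close> reappear to a power less than 1, so that it can
  be absorbed.\<close>

lemma fractional_sobolev:
  fixes p \<alpha> :: real
  defines "\<theta> \<equiv> 1 - p * \<alpha> / real DIM('a)"
  assumes p: "1 \<le> p" and \<alpha>: "0 < \<alpha>" "\<alpha> < 1" and n: "p * \<alpha> < real DIM('a::euclidean_space)"
  obtains C where "0 < C"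
    "\<And>(u :: 'a \<Rightarrow> real) \<Omega> K. u \<in> test_functions \<Omega> \<Longrightarrow> 0 \<le> K \<Longrightarrow> gag p \<alpha> u \<le> ennreal K \<Longrightarrow>
       pint (p / \<theta>) lborel u \<le> ennreal ((C * K) powr (1 / \<theta>))"
proof -
  let ?n = "real DIM('a)"
  \<comment> \<open>With this \<theta> the exponent \<open>p / \<theta>\<close> is the Sobolev
    exponent n p / (n - p \<alpha>).\<close>
  have \<theta>: "0 < \<theta>" "\<theta> < 1" using n p \<alpha> by (auto simp: \<theta>_def)
  have n\<theta>: "?n * \<theta> = ?n - p * \<alpha>" by (simp add: \<theta>_def field_simps)
  define v where "v = unit_ball_vol ?n"
  have v: "0 < v" by (simp add: v_def)
  define C0 where "C0 = 2 powr p * (1 / v + 2 * (1 / v) powr \<theta>)"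
  have C0: "0 < C0" unfolding C0_def using v by (intro mult_pos_pos add_pos_pos) auto
  define C where "C = (2 * C0) powr (1 / \<theta>)"
  show thesis
  proof
    show "0 < C" using C0 by (simp add: C_def)
    fix u :: "'a \<Rightarrow> real" and \<Omega> and K :: real
    assume u: "u \<in> test_functions \<Omega>" and K: "0 \<le> K" "gag p \<alpha> u \<le> ennreal K"
    note [measurable] = test_functions_borel[OF u]
    \<comment> \<open>Finite because \<open>u\<close> is a test function; this is what permits
      dividing by a power of \<open>N\<close> at the end.\<close>
    define N where "N = enn2real (pint (p / \<theta>) lborel u)"
    have N: "pint (p / \<theta>) lborel u = ennreal N" "0 \<le> N"
      using pint_finite_test_function[OF _ u, of "p / \<theta>"] p \<theta> by (auto simp: N_def)
    show "pint (p / \<theta>) lborel u \<le> ennreal ((C * K) powr (1 / \<theta>))"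
    proof (cases "N = 0")
      case False
      then have Npos: "0 < N" using N by simp
      have local: "\<bar>u x\<bar> powr p \<le> C0 * (r powr (p * \<alpha>) * g + N powr \<theta> * r powr (p * \<alpha> - ?n))"
        if r: "0 < r" and g: "energy_density p \<alpha> u x \<le> ennreal g" "0 \<le> g" for x r g
      proof -
        define m where "m = v * r ^ DIM('a)"
        have m: "0 < m" "emeasure lborel (cball x r) = ennreal m"
          using v r by (auto simp: m_def v_def emeasure_cball)
        have "(\<integral>\<^sup>+y. ennreal (\<bar>u y\<bar> powr p) * indicator (cball x r) y \<partial>lborel)
            \<le> ennreal (2 * m * (N / m) powr (1 / (1 / \<theta>)))"
        proof (rule nn_integral_le_powr_mean)
          show "1 \<le> 1 / \<theta>" using \<theta> by simp
          have "(\<integral>\<^sup>+y. ennreal ((\<bar>u y\<bar> powr p) powr (1 / \<theta>)) * indicator (cball x r) y \<partial>lborel)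
              \<le> pint (p / \<theta>) lborel u"
            unfolding pint_def by (intro nn_integral_mono) (auto simp: powr_powr indicator_def)
          then show "(\<integral>\<^sup>+y. ennreal ((\<bar>u y\<bar> powr p) powr (1 / \<theta>)) * indicator (cball x r) y \<partial>lborel) \<le> ennreal N"
            using N by simp
        qed (use m N in auto)
        then have I2: "(\<integral>\<^sup>+y. ennreal (\<bar>u y\<bar> powr p) * indicator (cball x r) y \<partial>lborel)
            \<le> ennreal (2 * m * (N / m) powr \<theta>)" by simp
        have "(\<integral>\<^sup>+y. ennreal (\<bar>u x - u y\<bar> powr p) * indicator (cball x r) y \<partial>lborel)
            \<le> ennreal (r powr (?n + p * \<alpha>)) * energy_density p \<alpha> u x"
          using p \<alpha> by (intro nn_integral_diff_le_energy_density) auto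
        also have "\<dots> \<le> ennreal (r powr (?n + p * \<alpha>)) * ennreal g" using g by (intro mult_left_mono) auto
        also have "\<dots> = ennreal (r powr (?n + p * \<alpha>) * g)" using g by (simp add: ennreal_mult)
        finally have I1: "(\<integral>\<^sup>+y. ennreal (\<bar>u x - u y\<bar> powr p) * indicator (cball x r) y \<partial>lborel)
            \<le> ennreal (r powr (?n + p * \<alpha>) * g)" .
        have "ennreal (\<bar>u x\<bar> powr p * m) = (\<integral>\<^sup>+y. ennreal (\<bar>u x\<bar> powr p) * indicator (cball x r) y \<partial>lborel)"
          using m by (simp add: nn_integral_cmult_indicator ennreal_mult)
        also have "\<dots> \<le> (\<integral>\<^sup>+y. ennreal (2 powr p) * (ennreal (\<bar>u x - u y\<bar> powr p) * indicator (cball x r) y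
            + ennreal (\<bar>u y\<bar> powr p) * indicator (cball x r) y) \<partial>lborel)"
          using powr_add_le_two[OF p, where a = "u x - u y" and b = "u y" for y, simplified]
          by (intro nn_integral_mono) (auto simp: indicator_def simp flip: ennreal_mult ennreal_plus intro!: ennreal_leI)
        also have "\<dots> = ennreal (2 powr p) * ((\<integral>\<^sup>+y. ennreal (\<bar>u x - u y\<bar> powr p) * indicator (cball x r) y \<partial>lborel)
            + (\<integral>\<^sup>+y. ennreal (\<bar>u y\<bar> powr p) * indicator (cball x r) y \<partial>lborel))"
          by (simp add: nn_integral_add nn_integral_cmult)
        also have "\<dots> \<le> ennreal (2 powr p) * (ennreal (r powr (?n + p * \<alpha>) * g) + ennreal (2 * m * (N / m) powr \<theta>))"
          by (intro mult_left_mono add_mono I1 I2) auto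
        also have "\<dots> = ennreal (2 powr p * (r powr (?n + p * \<alpha>) * g + 2 * m * (N / m) powr \<theta>))"
          using g m by (simp add: ennreal_mult)
        finally have "\<bar>u x\<bar> powr p * m \<le> 2 powr p * (r powr (?n + p * \<alpha>) * g + 2 * m * (N / m) powr \<theta>)"
          using g m by (subst (asm) ennreal_le_iff) auto
        then have "\<bar>u x\<bar> powr p \<le> 2 powr p * (r powr (?n + p * \<alpha>) * g / m + 2 * (N / m) powr \<theta>)"
          using m by (simp add: field_simps)
        also have "r powr (?n + p * \<alpha>) * g / m = 1 / v * (r powr (p * \<alpha>) * g)"
          using r by (simp add: m_def powr_add powr_realpow)
        also have "(N / m) powr \<theta> = (1 / v) powr \<theta> * (N powr \<theta> * r powr (p * \<alpha> - ?n))"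
        proof -
          have "(r ^ DIM('a)) powr \<theta> = r powr (?n - p * \<alpha>)"
            using r by (simp add: powr_powr n\<theta> flip: powr_realpow)
          then show ?thesis by (simp add: m_def powr_divide powr_mult powr_diff)
        qed
        also have "2 powr p * (1 / v * (r powr (p * \<alpha>) * g) + 2 * ((1 / v) powr \<theta> * (N powr \<theta> * r powr (p * \<alpha> - ?n))))
          \<le> C0 * (r powr (p * \<alpha>) * g + N powr \<theta> * r powr (p * \<alpha> - ?n))"
        proof -
          have "1 / v * a + 2 * ((1 / v) powr \<theta> * b) \<le> (1 / v + 2 * (1 / v) powr \<theta>) * (a + b)"
            if "0 \<le> a" "0 \<le> b" for a b :: real
          proof -
            have "0 \<le> 1 / v * b" "0 \<le> 2 * (1 / v) powr \<theta> * a" using that v by auto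
            then show ?thesis by (simp add: algebra_simps add_divide_distrib)
          qed
          from this[of "r powr (p * \<alpha>) * g" "N powr \<theta> * r powr (p * \<alpha> - ?n)"] show ?thesis
            unfolding C0_def mult.assoc using g by (intro mult_left_mono) auto
        qed
        finally show ?thesis .
      qed
      have opt: "\<bar>u x\<bar> powr (p / \<theta>) \<le> C * N powr (1 - \<theta>) * g"
        if g: "energy_density p \<alpha> u x \<le> ennreal g" "0 < g" for x g
      proof -
        \<comment> \<open>This radius makes the two terms in \<open>local\<close> equal.\<close>
        define r where "r = (N powr \<theta> / g) powr (1 / ?n)"
        have r: "0 < r" using Npos g by (simp add: r_def)
        have rn: "r powr ?n = N powr \<theta> / g" using Npos g by (simp add: r_def powr_powr)
        have rpa: "r powr (p * \<alpha>) = (N powr \<theta> / g) powr (1 - \<theta>)"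
          by (simp add: r_def powr_powr \<theta>_def)
        have "N powr \<theta> * r powr (p * \<alpha> - ?n) = r powr (p * \<alpha>) * g"
          using rn Npos g by (simp add: powr_diff)
        then have "\<bar>u x\<bar> powr p \<le> 2 * C0 * (r powr (p * \<alpha>) * g)"
          using local[OF r g(1)] g by (simp add: mult_ac)
        also have "r powr (p * \<alpha>) * g = (N powr (1 - \<theta>) * g) powr \<theta>"
        proof -
          have "g = g powr (1 - \<theta>) * g powr \<theta>" using g by (simp flip: powr_add)
          then have "r powr (p * \<alpha>) * g = (N powr \<theta> / g) powr (1 - \<theta>) * (g powr (1 - \<theta>) * g powr \<theta>)"
            using rpa by metis
          also have "\<dots> = N powr (\<theta> * (1 - \<theta>)) * g powr \<theta>" using g by (simp add: powr_divide powr_powr)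
          also have "\<dots> = (N powr (1 - \<theta>) * g) powr \<theta>" by (simp add: powr_mult powr_powr mult.commute)
          finally show ?thesis .
        qed
        finally have "(\<bar>u x\<bar> powr p) powr (1 / \<theta>) \<le> (2 * C0 * (N powr (1 - \<theta>) * g) powr \<theta>) powr (1 / \<theta>)"
          using \<theta> by (intro powr_mono2) auto
        also have "\<dots> = C * (N powr (1 - \<theta>) * g)"
          using \<theta> g Npos C0 by (simp add: C_def powr_mult powr_powr)
        finally show ?thesis by (simp add: powr_powr)
      qed
      have pw: "ennreal (\<bar>u x\<bar> powr (p / \<theta>)) \<le> ennreal (C * N powr (1 - \<theta>)) * energy_density p \<alpha> u x" for x
      proof (cases "energy_density p \<alpha> u x")
        case (real g)
        have D: "0 < C * N powr (1 - \<theta>)" using Npos C0 by (simp add: C_def)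
        \<comment> \<open>The best radius exists only for a positive value of the density; the value
          0 is reached by adding an arbitrarily small amount.\<close>
        have "\<bar>u x\<bar> powr (p / \<theta>) \<le> C * N powr (1 - \<theta>) * g"
        proof (rule field_le_epsilon)
          fix e :: real assume e: "0 < e"
          have "\<bar>u x\<bar> powr (p / \<theta>) \<le> C * N powr (1 - \<theta>) * (g + e / (C * N powr (1 - \<theta>)))"
            using real e D by (intro opt) (auto intro!: ennreal_leI add_nonneg_pos)
          also have "\<dots> = C * N powr (1 - \<theta>) * g + e"
            using less_imp_neq[OF D] by (metis distrib_left nonzero_mult_div_cancel_left times_divide_eq_right)
          finally show "\<bar>u x\<bar> powr (p / \<theta>) \<le> C * N powr (1 - \<theta>) * g + e" .
        qed
        then show ?thesis using real D by (simp add: ennreal_leI flip: ennreal_mult)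
      next
        case top
        then show ?thesis using Npos C0 by (simp add: C_def ennreal_mult_top)
      qed
      have "ennreal N = pint (p / \<theta>) lborel u" using N by simp
      also have "\<dots> \<le> (\<integral>\<^sup>+x. ennreal (C * N powr (1 - \<theta>)) * energy_density p \<alpha> u x \<partial>lborel)"
        unfolding pint_def by (intro nn_integral_mono pw)
      also have "\<dots> = ennreal (C * N powr (1 - \<theta>)) * gag p \<alpha> u"
        using p by (simp add: nn_integral_cmult gag_eq_energy)
      also have "\<dots> \<le> ennreal (C * N powr (1 - \<theta>)) * ennreal K" using K by (intro mult_left_mono) auto
      also have "\<dots> = ennreal (C * N powr (1 - \<theta>) * K)" using K C0 by (simp add: C_def ennreal_mult)
      finally have "N \<le> C * N powr (1 - \<theta>) * K" using K C0 by (subst (asm) ennreal_le_iff) (auto simp: C_def)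
      \<comment> \<open>Absorption: division by \<open>N powr (1 - \<theta>)\<close>, which is
        positive and finite.\<close>
      then have "N powr \<theta> \<le> C * K"
        using Npos by (simp add: powr_diff field_simps)
      then have "(N powr \<theta>) powr (1 / \<theta>) \<le> (C * K) powr (1 / \<theta>)" using \<theta> by (intro powr_mono2) auto
      then show ?thesis using N \<theta> by (simp add: powr_powr ennreal_leI)
    qed (use N in simp)
  qed
qed

section \<open>Local compactness\<close>

text \<open>A cubic mesh is used instead of balls so that the local averages take only countably many
  values.\<close>

definition cell :: "real \<Rightarrow> 'a::euclidean_space \<Rightarrow> 'a set" where
  "cell h x = {y. \<forall>b\<in>Basis. \<lfloor>y \<bullet> b / h\<rfloor> = \<lfloor>x \<bullet> b / h\<rfloor>}"

definition cell_avg :: "real \<Rightarrow> ('a::euclidean_space \<Rightarrow> real) \<Rightarrow> 'a \<Rightarrow> real" where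
  "cell_avg h u x = (LINT y:cell h x|lborel. u y) / h ^ DIM('a)"

lemma cell_eq: "y \<in> cell h x \<Longrightarrow> cell h y = cell h x"
  by (auto simp: cell_def)

lemma cell_borel [measurable]: "cell h x \<in> sets borel"
  unfolding cell_def by measurable

lemma cell_subset_cball:
  fixes x :: "'a::euclidean_space"
  assumes h: "0 < h"
  shows "cell h x \<subseteq> cball x (h * real DIM('a))"
proof
  fix y assume y: "y \<in> cell h x"
  have "\<bar>(x - y) \<bullet> b\<bar> \<le> h" if "b \<in> Basis" for b
  proof -
    have fl: "\<lfloor>y \<bullet> b / h\<rfloor> = \<lfloor>x \<bullet> b / h\<rfloor>" using y that by (auto simp: cell_def)
    have "\<bar>x \<bullet> b / h - y \<bullet> b / h\<bar> \<le> 1"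
      using floor_correct[of "x \<bullet> b / h"] floor_correct[of "y \<bullet> b / h"] unfolding fl by linarith
    then have "h * \<bar>x \<bullet> b / h - y \<bullet> b / h\<bar> \<le> h * 1" using h by (intro mult_left_mono) auto
    moreover have "(x - y) \<bullet> b = h * (x \<bullet> b / h - y \<bullet> b / h)"
      using h by (simp add: inner_diff_left right_diff_distrib)
    ultimately show ?thesis using h by (simp add: abs_mult)
  qed
  then have "norm (x - y) \<le> (\<Sum>b\<in>(Basis::'a set). h)"
    by (intro order_trans[OF norm_le_l1] sum_mono)
  then show "y \<in> cball x (h * real DIM('a))" by (simp add: dist_norm mult.commute)
qed

text \<open>A half-open cube is squeezed between an open and a closed box of equal volume, which
  gives its measure; the open box also puts a point of a countable dense set into every cell, so
  there are only countably many cells.\<close>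

lemma cell_box:
  fixes x :: "'a::euclidean_space"
  assumes h: "0 < h"
  defines "a \<equiv> \<Sum>b\<in>Basis. (h * of_int \<lfloor>x \<bullet> b / h\<rfloor>) *\<^sub>R b"
  shows "box a (a + h *\<^sub>R One) \<subseteq> cell h x" "cell h x \<subseteq> cbox a (a + h *\<^sub>R One)"
proof -
  have ab: "a \<bullet> b = h * of_int \<lfloor>x \<bullet> b / h\<rfloor>" "(a + h *\<^sub>R One) \<bullet> b = h * of_int \<lfloor>x \<bullet> b / h\<rfloor> + h" if "b \<in> Basis" for b
    using that by (simp_all add: a_def inner_add_left)
  show "box a (a + h *\<^sub>R One) \<subseteq> cell h x"
  proof
    fix y assume y: "y \<in> box a (a + h *\<^sub>R One)"
    show "y \<in> cell h x" unfolding cell_def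
    proof (intro CollectI ballI)
      fix b :: 'a assume b: "b \<in> Basis"
      have "h * of_int \<lfloor>x \<bullet> b / h\<rfloor> < y \<bullet> b" "y \<bullet> b < h * of_int \<lfloor>x \<bullet> b / h\<rfloor> + h"
        using y b ab[OF b] by (auto simp: mem_box)
      then show "\<lfloor>y \<bullet> b / h\<rfloor> = \<lfloor>x \<bullet> b / h\<rfloor>" using h by (intro floor_unique) (auto simp: field_simps)
    qed
  qed
  show "cell h x \<subseteq> cbox a (a + h *\<^sub>R One)"
  proof
    fix y assume y: "y \<in> cell h x"
    show "y \<in> cbox a (a + h *\<^sub>R One)" unfolding mem_box
    proof (intro ballI)
      fix b :: 'a assume b: "b \<in> Basis"
      have "of_int \<lfloor>x \<bullet> b / h\<rfloor> \<le> y \<bullet> b / h" "y \<bullet> b / h < of_int \<lfloor>x \<bullet> b / h\<rfloor> + 1"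
        using y b floor_correct[of "y \<bullet> b / h"] by (auto simp: cell_def)
      then show "a \<bullet> b \<le> y \<bullet> b \<and> y \<bullet> b \<le> (a + h *\<^sub>R One) \<bullet> b"
        using h unfolding ab[OF b] by (simp add: field_simps)
    qed
  qed
qed

lemma emeasure_cell:
  fixes x :: "'a::euclidean_space"
  assumes h: "0 < h"
  shows "emeasure lborel (cell h x) = ennreal (h ^ DIM('a))"
proof -
  define a where "a = (\<Sum>b\<in>Basis. (h * of_int \<lfloor>x \<bullet> b / h\<rfloor>) *\<^sub>R (b::'a))"
  note box = cell_box[OF h, of x, folded a_def]
  have "emeasure lborel (box a (a + h *\<^sub>R One)) = ennreal (h ^ DIM('a))"
    "emeasure lborel (cbox a (a + h *\<^sub>R One)) = ennreal (h ^ DIM('a))"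
    using h by (auto simp: emeasure_lborel_box_eq emeasure_lborel_cbox_eq inner_add_left)
  moreover have "emeasure lborel (box a (a + h *\<^sub>R One)) \<le> emeasure lborel (cell h x)"
    by (intro emeasure_mono box) auto
  moreover have "emeasure lborel (cell h x) \<le> emeasure lborel (cbox a (a + h *\<^sub>R One))"
    by (intro emeasure_mono box) auto
  ultimately show ?thesis by (metis order_antisym)
qed

lemma countable_cells:
  fixes h :: "nat \<Rightarrow> real"
  assumes h: "\<And>m. 0 < h m"
  shows "countable (\<Union>m. range (cell (h m) :: 'a::euclidean_space \<Rightarrow> 'a set))"
proof -
  obtain D :: "'a set" where D: "countable D" "\<And>X. open X \<Longrightarrow> X \<noteq> {} \<Longrightarrow> \<exists>d\<in>D. d \<in> X"
    using countable_dense_setE by blast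
  have "range (cell (h m)) \<subseteq> cell (h m) ` D" for m
  proof
    fix E assume "E \<in> range (cell (h m) :: 'a \<Rightarrow> 'a set)"
    then obtain x where E: "E = cell (h m) x" by blast
    define a where "a = (\<Sum>b\<in>Basis. (h m * of_int \<lfloor>x \<bullet> b / h m\<rfloor>) *\<^sub>R (b::'a))"
    have "box a (a + h m *\<^sub>R One) \<noteq> {}" using h[of m] by (auto simp: box_ne_empty inner_add_left)
    then obtain d where "d \<in> D" "d \<in> cell (h m) x"
      using D(2)[OF open_box] cell_box(1)[OF h[of m], of x, folded a_def] by blast
    then show "E \<in> cell (h m) ` D" using E cell_eq by blast
  qed
  then have "(\<Union>m. range (cell (h m) :: 'a \<Rightarrow> 'a set)) \<subseteq> (\<Union>m. cell (h m) ` D)" by (intro UN_mono) auto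
  moreover have "countable (\<Union>m. cell (h m) ` D)" using D(1) by auto
  ultimately show ?thesis by (rule countable_subset)
qed

text \<open>The relation \<open>y \<in> cell h x\<close> is measurable in the pair of points, so the
  average is a measurable parameter integral.\<close>

lemma cell_avg_measurable [measurable (raw)]:
  fixes u :: "'a::euclidean_space \<Rightarrow> real"
  assumes [measurable]: "u \<in> borel_measurable borel"
  shows "cell_avg h u \<in> borel_measurable borel"
proof -
  have "(\<lambda>x. LINT y|lborel. indicator {z. \<forall>b\<in>Basis. \<lfloor>snd z \<bullet> b / h\<rfloor> = \<lfloor>fst z \<bullet> b / h\<rfloor>} (x, y) * u y) \<in> borel_measurable borel"
    by measurable
  then show ?thesis
    unfolding cell_avg_def set_lebesgue_integral_def cell_def
    by (simp add: indicator_def cong: if_cong)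
qed

text \<open>On the ball the Hardy weight is at least \<open>R powr - (p * \<alpha>)\<close>; this is
  the source of all local L^p bounds.\<close>

lemma pint_indicator_le_hardy:
  fixes u :: "'a::euclidean_space \<Rightarrow> real"
  assumes p: "1 \<le> p" and \<alpha>: "0 < \<alpha>" and R: "0 \<le> R" and [measurable]: "u \<in> borel_measurable borel"
  shows "pint p lborel (\<lambda>x. indicat_real (cball 0 R) x * u x) \<le> ennreal (R powr (p * \<alpha>)) * hardy p \<alpha> 0 u"
proof -
  \<comment> \<open>At the origin the Hardy quotient is 0 by the convention on division by zero, so
    the pointwise bound is claimed only elsewhere.\<close>
  have "AE x in lborel. x \<noteq> (0::'a)" by (rule AE_lborel_singleton)
  then have "AE x in lborel. ennreal (\<bar>indicat_real (cball 0 R) x * u x\<bar> powr p)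
      \<le> ennreal (R powr (p * \<alpha>)) * ennreal (\<bar>hq \<alpha> (0::'a) u x\<bar> powr p)"
  proof eventually_elim
    case (elim x)
    show ?case
    proof (cases "norm x \<le> R")
      case True
      have "norm x powr (p * \<alpha>) \<le> R powr (p * \<alpha>)" using True p \<alpha> by (intro powr_mono2) auto
      then have "\<bar>u x\<bar> powr p * norm x powr (p * \<alpha>) \<le> \<bar>u x\<bar> powr p * R powr (p * \<alpha>)" by (intro mult_left_mono) auto
      then have "\<bar>u x\<bar> powr p \<le> R powr (p * \<alpha>) * (\<bar>u x\<bar> powr p / norm x powr (p * \<alpha>))"
        using elim by (simp add: field_simps)
      then show ?thesis using True by (simp add: abs_hq_powr ennreal_leI flip: ennreal_mult)
    qed (use p in simp)
  qed
  then have "pint p lborel (\<lambda>x. indicat_real (cball 0 R) x * u x)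
      \<le> (\<integral>\<^sup>+x. ennreal (R powr (p * \<alpha>)) * ennreal (\<bar>hq \<alpha> (0::'a) u x\<bar> powr p) \<partial>lborel)"
    unfolding pint_def by (rule nn_integral_mono_AE)
  also have "\<dots> = ennreal (R powr (p * \<alpha>)) * hardy p \<alpha> 0 u"
    unfolding hardy_def pint_def by (rule nn_integral_cmult) measurable
  finally show ?thesis .
qed

lemma set_integral_bound_pint:
  fixes u :: "'a::euclidean_space \<Rightarrow> real"
  assumes p: "1 \<le> p" and [measurable]: "u \<in> borel_measurable borel" "E \<in> sets borel"
    and m: "0 < m" "emeasure lborel E = ennreal m"
    and I: "0 \<le> I" "(\<integral>\<^sup>+x. ennreal (\<bar>u x\<bar> powr p) * indicator E x \<partial>lborel) \<le> ennreal I"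
  shows "set_integrable lborel E u" "\<bar>LINT x:E|lborel. u x\<bar> \<le> 2 * m * (I / m) powr (1 / p)"
proof -
  have le: "(\<integral>\<^sup>+x. ennreal \<bar>u x\<bar> * indicator E x \<partial>lborel) \<le> ennreal (2 * m * (I / m) powr (1 / p))"
    using I m by (intro nn_integral_le_powr_mean[OF p]) auto
  have eq: "(\<integral>\<^sup>+x. ennreal (norm (indicator E x *\<^sub>R u x)) \<partial>lborel) = (\<integral>\<^sup>+x. ennreal \<bar>u x\<bar> * indicator E x \<partial>lborel)"
    by (intro nn_integral_cong) (auto simp: indicator_def)
  show int: "set_integrable lborel E u"
    unfolding set_integrable_def
  proof (rule integrableI_bounded)
    show "(\<integral>\<^sup>+x. ennreal (norm (indicator E x *\<^sub>R u x)) \<partial>lborel) < \<infinity>"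
      unfolding eq using le ennreal_less_top le_less_trans by fastforce
  qed measurable
  have "ennreal \<bar>LINT x:E|lborel. u x\<bar> \<le> (\<integral>\<^sup>+x. ennreal (norm (indicator E x *\<^sub>R u x)) \<partial>lborel)"
    using integral_norm_bound_ennreal[OF int[unfolded set_integrable_def]] by (simp add: set_lebesgue_integral_def)
  also have "\<dots> \<le> ennreal (2 * m * (I / m) powr (1 / p))" unfolding eq by (rule le)
  finally show "\<bar>LINT x:E|lborel. u x\<bar> \<le> 2 * m * (I / m) powr (1 / p)"
    using m by (subst (asm) ennreal_le_iff) auto
qed


text \<open>\<open>u x\<close> minus its cell average is the average of \<open>u x - u y\<close>
  over a set of diameter comparable to \<open>h\<close>. After division by the cell volume a factor
  \<open>h powr (p * \<alpha>)\<close> remains, so the error is small uniformly over functions of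
  bounded energy. The factor \<open>2 powr p\<close> comes from the constant 2 in
  \<open>nn_integral_le_powr_mean\<close>.\<close>

lemma pint_minus_cell_avg_le:
  fixes u :: "'a::euclidean_space \<Rightarrow> real"
  assumes p: "1 \<le> p" and \<alpha>: "0 < \<alpha>" and h: "0 < h" and [measurable]: "u \<in> borel_measurable borel"
    and loc: "\<And>x. set_integrable lborel (cell h x) u"
  shows "pint p lborel (\<lambda>x. u x - cell_avg h u x)
    \<le> ennreal (2 powr p * real DIM('a) powr (real DIM('a) + p * \<alpha>) * h powr (p * \<alpha>)) * gag p \<alpha> u"
proof -
  let ?n = "real DIM('a)"
  let ?c = "2 powr p * ?n powr (?n + p * \<alpha>) * h powr (p * \<alpha>)"
  define m where "m = h ^ DIM('a)"
  have m: "0 < m" using h by (simp add: m_def)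
  have em: "emeasure lborel (cell h x) = ennreal m" for x :: 'a
    unfolding m_def by (rule emeasure_cell[OF h])
  have pw: "ennreal (\<bar>u x - cell_avg h u x\<bar> powr p) \<le> ennreal ?c * energy_density p \<alpha> u x" for x
  proof (cases "energy_density p \<alpha> u x")
    case (real g)
    have "(\<integral>\<^sup>+y. ennreal (\<bar>u x - u y\<bar> powr p) * indicator (cell h x) y \<partial>lborel)
        \<le> ennreal ((h * ?n) powr (?n + p * \<alpha>)) * energy_density p \<alpha> u x"
      using p \<alpha> h by (intro nn_integral_diff_le_energy_density cell_subset_cball) auto
    also have "\<dots> = ennreal ((h * ?n) powr (?n + p * \<alpha>) * g)"
      using real by (simp add: ennreal_mult)
    finally have I: "(\<integral>\<^sup>+y. ennreal (\<bar>u x - u y\<bar> powr p) * indicator (cell h x) y \<partial>lborel)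
        \<le> ennreal ((h * ?n) powr (?n + p * \<alpha>) * g)" .
    have J: "\<bar>LINT y:cell h x|lborel. u x - u y\<bar> \<le> 2 * m * ((h * ?n) powr (?n + p * \<alpha>) * g / m) powr (1 / p)"
      using p m em real I by (intro set_integral_bound_pint(2)) auto
    have "set_integrable lborel (cell h x) (\<lambda>y. u x)"
      using em by (simp add: set_integrable_def integrable_indicator_iff)
    then have "(LINT y:cell h x|lborel. u x - u y) = m * u x - (LINT y:cell h x|lborel. u y)"
      using loc em m by (subst set_integral_diff) (auto simp: set_integral_const measure_def)
    also have "\<dots> = m * (u x - cell_avg h u x)" using m h by (simp add: cell_avg_def m_def algebra_simps)
    finally have "m * \<bar>u x - cell_avg h u x\<bar> \<le> m * (2 * ((h * ?n) powr (?n + p * \<alpha>) * g / m) powr (1 / p))"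
      using J m by (simp add: abs_mult mult_ac)
    then have "\<bar>u x - cell_avg h u x\<bar> \<le> 2 * ((h * ?n) powr (?n + p * \<alpha>) * g / m) powr (1 / p)"
      using m by simp
    then have "\<bar>u x - cell_avg h u x\<bar> powr p \<le> (2 * ((h * ?n) powr (?n + p * \<alpha>) * g / m) powr (1 / p)) powr p"
      using p by (intro powr_mono2) auto
    also have "\<dots> = 2 powr p * ((h * ?n) powr (?n + p * \<alpha>) * g / m)"
      using p real m by (simp add: powr_mult powr_powr)
    also have "\<dots> = ?c * g"
      using h m by (simp add: powr_mult powr_add m_def powr_realpow)
    finally show ?thesis using real by (simp add: ennreal_leI flip: ennreal_mult)
  next
    case top
    then show ?thesis using h by (simp add: ennreal_mult_top)
  qed
  have "pint p lborel (\<lambda>x. u x - cell_avg h u x) \<le> (\<integral>\<^sup>+x. ennreal ?c * energy_density p \<alpha> u x \<partial>lborel)"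
    unfolding pint_def by (intro nn_integral_mono pw)
  also have "\<dots> = ennreal ?c * gag p \<alpha> u"
    using p by (simp add: nn_integral_cmult gag_eq_energy)
  finally show ?thesis .
qed

lemma pint_mono:
  assumes "1 \<le> p" "\<And>x. \<bar>f x\<bar> \<le> \<bar>g x\<bar>"
  shows "pint p M f \<le> pint p M g"
  unfolding pint_def using assms by (intro nn_integral_mono ennreal_leI powr_mono2) auto

lemma exists_strict_mono_ge:
  fixes N :: "nat \<Rightarrow> nat"
  obtains s where "strict_mono s" "\<And>i. N i \<le> s i"
proof
  let ?s = "\<lambda>i. i + (\<Sum>j\<le>i. N j)"
  show "strict_mono ?s" by (rule strict_mono_Suc_iff[THEN iffD2]) auto
  show "N i \<le> ?s i" for i
    using member_le_sum[of i "{..i}" N] by auto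
qed

text \<open>There are countably many cells over all mesh widths, and the integrals over each are
  bounded, so one diagonal subsequence makes all averages converge. As averages approximate the
  functions uniformly in the energy, that subsequence is Cauchy in L^p of every ball; a second
  extraction gives convergence almost everywhere.\<close>

lemma local_compactness:
  fixes u :: "nat \<Rightarrow> 'a::euclidean_space \<Rightarrow> real"
  assumes p: "1 \<le> p" and \<alpha>: "0 < \<alpha>" and [measurable]: "\<And>k. u k \<in> borel_measurable borel"
    and G: "\<And>k. gag p \<alpha> (u k) \<le> ennreal K" and H: "\<And>k. hardy p \<alpha> 0 (u k) \<le> ennreal K"
  obtains r w where "strict_mono r" "w \<in> borel_measurable borel"
    "AE x in lborel. (\<lambda>k. u (r k) x) \<longlonglongrightarrow> w x"
    "\<And>R. (\<lambda>k. pint p lborel (\<lambda>x. indicat_real (cball 0 R) x * (u (r k) x - w x))) \<longlonglongrightarrow> 0"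
proof -
  let ?n = "real DIM('a)"
  define K' where "K' = max K 0"
  have K': "0 \<le> K'" "ennreal K = ennreal K'" by (auto simp: K'_def max_def ennreal_neg)
  note G = G[unfolded K'] and H = H[unfolded K']
  define h where "h m = (1/2::real) ^ m" for m :: nat
  have h: "0 < h m" "h m \<le> 1" for m by (auto simp: h_def power_le_one)
  have ball: "pint p lborel (\<lambda>x. indicat_real (cball 0 R) x * u k x) \<le> ennreal (R powr (p * \<alpha>) * K')"
    if R: "0 \<le> R" for R k
  proof -
    have "pint p lborel (\<lambda>x. indicat_real (cball 0 R) x * u k x) \<le> ennreal (R powr (p * \<alpha>)) * hardy p \<alpha> 0 (u k)"
      using p \<alpha> R by (intro pint_indicator_le_hardy) auto
    also have "\<dots> \<le> ennreal (R powr (p * \<alpha>)) * ennreal K'" by (intro mult_left_mono H) auto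
    finally show ?thesis using K' by (simp add: ennreal_mult)
  qed
  have cellI: "(\<integral>\<^sup>+y. ennreal (\<bar>u k y\<bar> powr p) * indicator (cell (h m) x) y \<partial>lborel)
      \<le> ennreal ((R + ?n) powr (p * \<alpha>) * K')" if x: "norm x \<le> R" for k m x R
  proof -
    have sub: "cell (h m) x \<subseteq> cball 0 (R + ?n)"
    proof
      fix y assume "y \<in> cell (h m) x"
      then have "dist x y \<le> h m * ?n" using cell_subset_cball[OF h(1), of m x] by auto
      also have "\<dots> \<le> 1 * ?n" using h by (intro mult_right_mono) auto
      finally have "norm (x - y) \<le> ?n" by (simp add: dist_norm)
      then show "y \<in> cball 0 (R + ?n)" using x norm_triangle_sub[of y x] by (simp add: norm_minus_commute)
    qed
    have "(\<integral>\<^sup>+y. ennreal (\<bar>u k y\<bar> powr p) * indicator (cell (h m) x) y \<partial>lborel)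
        \<le> pint p lborel (\<lambda>x. indicat_real (cball 0 (R + ?n)) x * u k x)"
      unfolding pint_def using sub by (intro nn_integral_mono) (auto simp: indicator_def)
    also have "\<dots> \<le> ennreal ((R + ?n) powr (p * \<alpha>) * K')" using norm_ge_zero[of x] x by (intro ball) linarith
    finally show ?thesis .
  qed
  define bd where "bd m R = 2 * (h m ^ DIM('a)) * (((R + ?n) powr (p * \<alpha>) * K') / (h m ^ DIM('a))) powr (1 / p)" for m R
  have cell_int: "set_integrable lborel (cell (h m) x) (u k)" for m x k
    using p h K' emeasure_cell[OF h(1)] cellI[of x "norm x"]
    by (intro set_integral_bound_pint(1)[where m = "h m ^ DIM('a)" and I = "(norm x + ?n) powr (p * \<alpha>) * K'"]) auto
  have cell_bd: "\<bar>LINT y:cell (h m) x|lborel. u k y\<bar> \<le> bd m R" if "norm x \<le> R" for m x k R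
    unfolding bd_def using p h K' emeasure_cell[OF h(1)] cellI[OF that]
    by (intro set_integral_bound_pint(2)) auto
  define S where "S = (\<Union>m. range (cell (h m) :: 'a \<Rightarrow> 'a set))"
  have "countable S" unfolding S_def by (rule countable_cells[OF h(1)])
  have "\<exists>b>0. \<forall>k. \<bar>LINT y:E|lborel. u k y\<bar> \<le> b" if E: "E \<in> S" for E
  proof -
    obtain m x where "E = cell (h m) x" using E by (auto simp: S_def)
    then have "\<forall>k. \<bar>LINT y:E|lborel. u k y\<bar> \<le> max 1 (bd m (norm x))" using cell_bd[of x "norm x" m] by (auto simp: le_max_iff_disj)
    then show ?thesis by (intro exI[of _ "max 1 (bd m (norm x))"]) auto
  qed
  then obtain b where b: "\<And>E. E \<in> S \<Longrightarrow> 0 < b E" "\<And>E k. E \<in> S \<Longrightarrow> \<bar>LINT y:E|lborel. u k y\<bar> \<le> b E"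
    by metis
  \<comment> \<open>The extraction principle asks for one bound for all cells, hence the division by
    \<open>b E\<close>, undone in \<open>conv\<close>.\<close>
  have "norm ((LINT y:E|lborel. u k y) / b E) \<le> 1" if "E \<in> S" for k E
    using b[OF that] by (simp add: abs_div divide_le_eq)
  then obtain r where r: "strict_mono r" "\<And>E. E \<in> S \<Longrightarrow> \<exists>l. (\<lambda>k. (LINT y:E|lborel. u (r k) y) / b E) \<longlonglongrightarrow> l"
    using function_convergent_subsequence[OF \<open>countable S\<close>, of "\<lambda>k E. (LINT y:E|lborel. u k y) / b E" 1] by blast
  define v where "v k = u (r k)" for k
  have [measurable]: "v k \<in> borel_measurable borel" for k by (simp add: v_def)
  have conv: "convergent (\<lambda>k. cell_avg (h m) (v k) x)" for m x
  proof -
    have E: "cell (h m) x \<in> S" by (auto simp: S_def)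
    obtain l where "(\<lambda>k. (LINT y:cell (h m) x|lborel. v k y) / b (cell (h m) x)) \<longlonglongrightarrow> l"
      using r(2)[OF E] unfolding v_def by blast
    then have "(\<lambda>k. (LINT y:cell (h m) x|lborel. v k y) / b (cell (h m) x) * (b (cell (h m) x) / h m ^ DIM('a)))
      \<longlonglongrightarrow> l * (b (cell (h m) x) / h m ^ DIM('a))" by (intro tendsto_intros)
    then show ?thesis using b(1)[OF E] by (auto simp: cell_avg_def convergent_def)
  qed
  define av where "av m x = lim (\<lambda>k. cell_avg (h m) (v k) x)" for m x
  have [measurable]: "av m \<in> borel_measurable borel" for m
    unfolding av_def by (intro borel_measurable_lim_metric) measurable
  have av: "(\<lambda>k. cell_avg (h m) (v k) x) \<longlonglongrightarrow> av m x" for m x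
    unfolding av_def using conv convergent_LIMSEQ_iff by blast
  define B where "B R = (\<lambda>x::'a. indicat_real (cball 0 R) x)" for R
  have [measurable]: "B R \<in> borel_measurable borel" for R unfolding B_def by measurable
  have B1: "\<bar>B R x\<bar> \<le> 1" for R x by (simp add: B_def indicator_def)
  \<comment> \<open>For a fixed width the averages are bounded on a ball independently of
    \<open>k\<close>, so their pointwise convergence is dominated.\<close>
  have avg_conv: "(\<lambda>k. pint p lborel (\<lambda>x. B R x * (cell_avg (h m) (v k) x - av m x))) \<longlonglongrightarrow> 0" for R m
  proof -
    define M where "M = 2 * \<bar>bd m R / h m ^ DIM('a)\<bar>"
    have M: "\<bar>cell_avg (h m) (v k) x - av m x\<bar> \<le> M" if x: "norm x \<le> R" for k x
    proof -
      have a: "\<bar>cell_avg (h m) (v k) x\<bar> \<le> \<bar>bd m R / h m ^ DIM('a)\<bar>" for k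
        using cell_bd[OF x, of m "r k"] h[of m]
        by (simp add: cell_avg_def v_def abs_div divide_right_mono order_trans[OF _ abs_ge_self])
      have "\<bar>av m x\<bar> \<le> \<bar>bd m R / h m ^ DIM('a)\<bar>"
        by (rule LIMSEQ_le_const2[OF tendsto_rabs[OF av]]) (use a in auto)
      then show ?thesis using a[of k] unfolding M_def by linarith
    qed
    have "(\<lambda>k. \<integral>\<^sup>+x. ennreal (\<bar>B R x * (cell_avg (h m) (v k) x - av m x)\<bar> powr p) \<partial>lborel) \<longlonglongrightarrow> (\<integral>\<^sup>+x. 0 \<partial>(lborel::'a measure))"
    proof (rule nn_integral_dominated_convergence[where w = "\<lambda>x. ennreal (M powr p) * indicator (cball 0 R) x"])
      show "AE x in lborel. ennreal (\<bar>B R x * (cell_avg (h m) (v k) x - av m x)\<bar> powr p)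
          \<le> ennreal (M powr p) * indicator (cball 0 R) x" for k
        using M p by (intro AE_I2) (auto simp: B_def indicator_def intro!: ennreal_leI powr_mono2)
      show "(\<integral>\<^sup>+x. ennreal (M powr p) * indicator (cball (0::'a) R) x \<partial>lborel) < \<infinity>"
        using emeasure_lborel_cball_finite[of "0::'a" R] by (simp add: nn_integral_cmult_indicator ennreal_mult_less_top)
      show "AE x in lborel. (\<lambda>k. ennreal (\<bar>B R x * (cell_avg (h m) (v k) x - av m x)\<bar> powr p)) \<longlonglongrightarrow> 0"
      proof (intro AE_I2)
        fix x
        have "(\<lambda>k. B R x * (cell_avg (h m) (v k) x - av m x)) \<longlonglongrightarrow> B R x * (av m x - av m x)"
          by (intro tendsto_intros av)
        then have "(\<lambda>k. ennreal (\<bar>B R x * (cell_avg (h m) (v k) x - av m x)\<bar> powr p)) \<longlonglongrightarrow> ennreal (\<bar>B R x * (av m x - av m x)\<bar> powr p)"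
          using p by (intro tendsto_ennrealI tendsto_abs_powr) auto
        then show "(\<lambda>k. ennreal (\<bar>B R x * (cell_avg (h m) (v k) x - av m x)\<bar> powr p)) \<longlonglongrightarrow> 0" by simp
      qed
    qed measurable
    then show ?thesis by (simp add: pint_def)
  qed
  define c where "c m = 2 powr p * ?n powr (?n + p * \<alpha>) * h m powr (p * \<alpha>) * K'" for m
  have c0: "0 \<le> c m" for m using K' by (simp add: c_def)
  have c_lim: "c \<longlonglongrightarrow> 0"
  proof -
    have "h \<longlonglongrightarrow> 0" unfolding h_def by (rule LIMSEQ_power_zero) simp
    then have "(\<lambda>m. h m powr (p * \<alpha>)) \<longlonglongrightarrow> 0 powr (p * \<alpha>)"
      using p \<alpha> h by (intro tendsto_powr2 tendsto_intros) (auto simp: less_imp_le)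
    then have "(\<lambda>m. 2 powr p * ?n powr (?n + p * \<alpha>) * h m powr (p * \<alpha>) * K') \<longlonglongrightarrow> 2 powr p * ?n powr (?n + p * \<alpha>) * 0 * K'"
      by (intro tendsto_intros) simp
    then show ?thesis by (simp add: c_def[abs_def])
  qed
  have near: "pint p lborel (\<lambda>x. B R x * (v k x - cell_avg (h m) (v k) x)) \<le> ennreal (c m)" for R k m
  proof -
    have "pint p lborel (\<lambda>x. B R x * (v k x - cell_avg (h m) (v k) x)) \<le> pint p lborel (\<lambda>x. v k x - cell_avg (h m) (v k) x)"
      using p by (intro pint_mono) (auto simp: abs_mult B1 mult_left_le_one_le)
    also have "\<dots> \<le> ennreal (2 powr p * ?n powr (?n + p * \<alpha>) * h m powr (p * \<alpha>)) * gag p \<alpha> (v k)"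
      using p \<alpha> h cell_int by (intro pint_minus_cell_avg_le) (auto simp: v_def)
    also have "\<dots> \<le> ennreal (2 powr p * ?n powr (?n + p * \<alpha>) * h m powr (p * \<alpha>)) * ennreal K'"
      unfolding v_def by (intro mult_left_mono G) auto
    finally show ?thesis using K' by (simp add: c_def ennreal_mult)
  qed
  have cauchy: "\<exists>N. \<forall>j\<ge>N. \<forall>k\<ge>N. pint p lborel (\<lambda>x. B R x * (v j x - v k x)) \<le> ennreal \<epsilon>" if \<epsilon>: "0 < \<epsilon>" for R \<epsilon>
  proof -
    \<comment> \<open>One factor \<open>2 powr p\<close> is lost in comparing \<open>v k\<close>
      with the limit average, another in comparing \<open>v j\<close> with
      \<open>v k\<close>.\<close>
    define D where "D = 2 powr p * 2 powr p"
    have D: "0 < D" by (simp add: D_def)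
    have "\<forall>\<^sub>F m in sequentially. c m < \<epsilon> / (4 * D)" using \<epsilon> D by (intro order_tendstoD(2)[OF c_lim]) auto
    then obtain m where m: "c m < \<epsilon> / (4 * D)" by (auto dest: eventually_happens)
    have "\<forall>\<^sub>F k in sequentially. pint p lborel (\<lambda>x. B R x * (cell_avg (h m) (v k) x - av m x)) < ennreal (\<epsilon> / (4 * D))"
      using \<epsilon> D by (intro order_tendstoD(2)[OF avg_conv]) auto
    then obtain N where N: "\<And>k. k \<ge> N \<Longrightarrow> pint p lborel (\<lambda>x. B R x * (cell_avg (h m) (v k) x - av m x)) \<le> ennreal (\<epsilon> / (4 * D))"
      by (auto simp: eventually_sequentially intro: less_imp_le)
    have half: "pint p lborel (\<lambda>x. B R x * (v k x - av m x)) \<le> ennreal (2 powr p) * ennreal (\<epsilon> / (2 * D))" if "k \<ge> N" for k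
    proof -
      have "pint p lborel (\<lambda>x. B R x * (v k x - av m x))
        = pint p lborel (\<lambda>x. B R x * (v k x - cell_avg (h m) (v k) x) + B R x * (cell_avg (h m) (v k) x - av m x))"
        by (simp add: algebra_simps)
      also have "\<dots> \<le> ennreal (2 powr p) * (pint p lborel (\<lambda>x. B R x * (v k x - cell_avg (h m) (v k) x))
          + pint p lborel (\<lambda>x. B R x * (cell_avg (h m) (v k) x - av m x)))"
        using p by (intro pint_add_le) auto
      also have "\<dots> \<le> ennreal (2 powr p) * (ennreal (\<epsilon> / (4 * D)) + ennreal (\<epsilon> / (4 * D)))"
        using m by (intro mult_left_mono add_mono N[OF that] order_trans[OF near] ennreal_leI) auto
      also have "ennreal (\<epsilon> / (4 * D)) + ennreal (\<epsilon> / (4 * D)) = ennreal (\<epsilon> / (2 * D))"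
        using \<epsilon> D by (subst ennreal_plus[symmetric]) (auto simp: field_simps)
      finally show ?thesis .
    qed
    have "pint p lborel (\<lambda>x. B R x * (v j x - v k x)) \<le> ennreal \<epsilon>" if jk: "j \<ge> N" "k \<ge> N" for j k
    proof -
      have "pint p lborel (\<lambda>x. B R x * (v j x - v k x)) = pint p lborel (\<lambda>x. B R x * (v j x - av m x) - B R x * (v k x - av m x))"
        by (simp add: algebra_simps)
      also have "\<dots> \<le> ennreal (2 powr p) * (pint p lborel (\<lambda>x. B R x * (v j x - av m x)) + pint p lborel (\<lambda>x. B R x * (v k x - av m x)))"
        using p by (intro pint_diff_le) auto
      also have "\<dots> \<le> ennreal (2 powr p) * (ennreal (2 powr p) * ennreal (\<epsilon> / (2 * D)) + ennreal (2 powr p) * ennreal (\<epsilon> / (2 * D)))"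
        using jk by (intro mult_left_mono add_mono half) auto
      also have "\<dots> = ennreal (2 powr p * (2 powr p * (\<epsilon> / (2 * D)) + 2 powr p * (\<epsilon> / (2 * D))))"
        using \<epsilon> D by (simp only: ennreal_mult ennreal_plus powr_ge_zero mult_nonneg_nonneg add_nonneg_nonneg divide_nonneg_pos less_imp_le mult_pos_pos zero_less_numeral)
      also have "2 powr p * (2 powr p * (\<epsilon> / (2 * D)) + 2 powr p * (\<epsilon> / (2 * D))) = \<epsilon>"
        using D by (simp add: D_def field_simps)
      finally show ?thesis .
    qed
    then show ?thesis by blast
  qed
  have "\<exists>N. \<forall>j\<ge>N. \<forall>k\<ge>N. pint p lborel (\<lambda>x. B (real i) x * (v j x - v k x)) \<le> ennreal ((1/4) ^ i)" for i
    by (rule cauchy) simp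
  then obtain N where N: "\<And>i j k. N i \<le> j \<Longrightarrow> N i \<le> k \<Longrightarrow> pint p lborel (\<lambda>x. B (real i) x * (v j x - v k x)) \<le> ennreal ((1/4) ^ i)"
    by metis
  \<comment> \<open>With \<open>s i\<close> beyond \<open>N i\<close>, consecutive functions are
    close to order \<open>(1/4) ^ i\<close> on the ball of radius \<open>i\<close>, hence on a fixed
    ball of radius \<open>R\<close> from \<open>i = R\<close> on.\<close>
  obtain s where s: "strict_mono s" "\<And>i. N i \<le> s i" using exists_strict_mono_ge by blast
  have "AE x in lborel. convergent (\<lambda>i. B (real R) x * v (s i) x)" for R
  proof (rule summable_pint_imp_AE_convergent[where ?k0.0 = R])
    fix i assume i: "R \<le> i"
    have "pint p lborel (\<lambda>x. B (real R) x * v (s (Suc i)) x - B (real R) x * v (s i) x)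
        \<le> pint p lborel (\<lambda>x. B (real i) x * (v (s (Suc i)) x - v (s i) x))"
      using p i by (intro pint_mono) (auto simp: B_def indicator_def)
    also have "\<dots> \<le> ennreal ((1/4) ^ i)"
      using s(2)[of i] strict_mono_less_eq[OF s(1), of i "Suc i"] by (intro N) auto
    finally show "pint p lborel (\<lambda>x. B (real R) x * v (s (Suc i)) x - B (real R) x * v (s i) x) \<le> ennreal ((1/4) ^ i)" .
  qed (use p in auto)
  then have "AE x in lborel. \<forall>R. convergent (\<lambda>i. B (real R) x * v (s i) x)" by (subst AE_all_countable) auto
  then have ae: "AE x in lborel. convergent (\<lambda>i. v (s i) x)"
  proof eventually_elim
    case (elim x)
    obtain R :: nat where "norm x \<le> real R" using real_arch_simple by blast
    then have "B (real R) x = 1" by (simp add: B_def)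
    with elim[rule_format, of R] show ?case by simp
  qed
  define w where "w x = lim (\<lambda>i. v (s i) x)" for x
  have w[measurable]: "w \<in> borel_measurable borel"
    unfolding w_def by (intro borel_measurable_lim_metric) measurable
  have ae': "AE x in lborel. (\<lambda>i. v (s i) x) \<longlonglongrightarrow> w x"
    using ae unfolding w_def by eventually_elim (simp add: convergent_LIMSEQ_iff)
  have fin: "(\<lambda>i. pint p lborel (\<lambda>x. B R x * (v (s i) x - w x))) \<longlonglongrightarrow> 0" for R
  proof (rule order_tendstoI)
    fix a :: ennreal assume a: "0 < a"
    obtain \<epsilon> where \<epsilon>: "0 < \<epsilon>" "ennreal \<epsilon> < a"
    proof (cases a)
      case (real t)
      then show thesis using a that[of "t / 2"] by (simp add: ennreal_less_iff)
    next
      case top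
      then show thesis using that[of 1] by simp
    qed
    obtain N where N: "\<And>j k. j \<ge> N \<Longrightarrow> k \<ge> N \<Longrightarrow> pint p lborel (\<lambda>x. B R x * (v j x - v k x)) \<le> ennreal \<epsilon>"
      using cauchy[OF \<epsilon>(1)] by blast
    \<comment> \<open>Fatou's lemma in the second index turns the Cauchy estimate into one for the
      distance to \<open>w\<close>.\<close>
    have "pint p lborel (\<lambda>x. B R x * (v (s i) x - w x)) \<le> ennreal \<epsilon>" if i: "i \<ge> N" for i
    proof (rule pint_fatou_bound)
      show "AE x in lborel. (\<lambda>k. B R x * (v (s i) x - v (s k) x)) \<longlonglongrightarrow> B R x * (v (s i) x - w x)"
        using ae' by eventually_elim (intro tendsto_intros)
      have "pint p lborel (\<lambda>x. B R x * (v (s i) x - v (s k) x)) \<le> ennreal \<epsilon>" if "k \<ge> N" for k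
        using i that seq_suble[OF s(1)] by (intro N) (meson order_trans)+
      then show "\<forall>\<^sub>F k in sequentially. pint p lborel (\<lambda>x. B R x * (v (s i) x - v (s k) x)) \<le> ennreal \<epsilon>"
        by (auto simp: eventually_sequentially)
    qed (use p in auto)
    then show "\<forall>\<^sub>F i in sequentially. pint p lborel (\<lambda>x. B R x * (v (s i) x - w x)) < a"
      using \<epsilon> by (auto simp: eventually_sequentially intro: le_less_trans)
  qed auto
  show thesis
  proof
    show "strict_mono (r \<circ> s)" using r(1) s(1) by (rule strict_mono_o)
    show "w \<in> borel_measurable borel" by (rule w)
    show "AE x in lborel. (\<lambda>k. u ((r \<circ> s) k) x) \<longlonglongrightarrow> w x" using ae' by (simp add: v_def)
    show "(\<lambda>k. pint p lborel (\<lambda>x. indicat_real (cball 0 R) x * (u ((r \<circ> s) k) x - w x))) \<longlonglongrightarrow> 0" for R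
      using fin[of R] by (simp add: v_def B_def)
  qed
qed

section \<open>The completion\<close>

text \<open>The preimages of a null set under the two projections are null in the product.\<close>

lemma AE_lborel_fst_snd:
  assumes "AE x in (lborel :: 'a::euclidean_space measure). P x"
  shows "AE z in (lborel :: ('a \<times> 'a) measure). P (fst z) \<and> P (snd z)"
proof -
  obtain N where N': "\<And>x. x \<in> space lborel - N \<Longrightarrow> P x" "N \<in> null_sets (lborel :: 'a measure)"
    using AE_E3[OF assms] by blast
  then have N: "\<And>x. x \<notin> N \<Longrightarrow> P x" "N \<in> null_sets (lborel :: 'a measure)" by auto
  have [measurable]: "N \<in> sets borel" using N by auto
  have "AE x in (lborel :: 'a measure). x \<notin> N" using N by (intro AE_not_in)
  then have "AE z in (lborel \<Otimes>\<^sub>M lborel :: ('a \<times> 'a) measure). fst z \<notin> N \<and> snd z \<notin> N"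
  proof (intro lborel_pair.AE_pair_measure)
    show "{z \<in> space (lborel \<Otimes>\<^sub>M lborel). fst z \<notin> N \<and> snd z \<notin> N} \<in> sets (lborel \<Otimes>\<^sub>M lborel :: ('a \<times> 'a) measure)"
      by measurable
  qed (auto elim!: eventually_mono)
  then show ?thesis unfolding lborel_prod by eventually_elim (use N in auto)
qed

section \<open>Algebra, translations and limits of the seminorm and the Hardy integral\<close>

lemma gag_diff_le:
  fixes u :: "'a::euclidean_space \<Rightarrow> real"
  assumes "1 \<le> p" "u \<in> borel_measurable borel" "v \<in> borel_measurable borel"
  shows "gag p \<alpha> (\<lambda>x. u x - v x) \<le> ennreal (2 powr p) * (gag p \<alpha> u + gag p \<alpha> v)"
  using assms unfolding gag_def dq_diff by (intro pint_diff_le) auto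

lemma gag_add_le:
  fixes u :: "'a::euclidean_space \<Rightarrow> real"
  assumes "1 \<le> p" "u \<in> borel_measurable borel" "v \<in> borel_measurable borel"
  shows "gag p \<alpha> (\<lambda>x. u x + v x) \<le> ennreal (2 powr p) * (gag p \<alpha> u + gag p \<alpha> v)"
  using assms unfolding gag_def dq_add by (intro pint_add_le) auto

lemma gag_cmult:
  fixes u :: "'a::euclidean_space \<Rightarrow> real"
  assumes "u \<in> borel_measurable borel"
  shows "gag p \<alpha> (\<lambda>x. c * u x) = ennreal (\<bar>c\<bar> powr p) * gag p \<alpha> u"
  using assms unfolding gag_def dq_cmult by (intro pint_cmult) auto

lemma gag_zero [simp]: "gag p \<alpha> (\<lambda>x::'a::euclidean_space. 0) = 0"
proof -
  have "dq p \<alpha> (\<lambda>x::'a. 0) = (\<lambda>z. 0)" by (simp add: dq_def fun_eq_iff)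
  then show ?thesis by (simp add: gag_def)
qed

lemma hardy_cmult:
  assumes "u \<in> borel_measurable borel"
  shows "hardy p \<alpha> c (\<lambda>x. k * u x) = ennreal (\<bar>k\<bar> powr p) * hardy p \<alpha> c u"
  using assms unfolding hardy_def hq_cmult by (intro pint_cmult) auto

lemma gag_translate:
  fixes u :: "'a::euclidean_space \<Rightarrow> real"
  assumes p: "p \<noteq> 0" and [measurable]: "u \<in> borel_measurable borel"
  shows "gag p \<alpha> (\<lambda>x. u (x + c)) = gag p \<alpha> u"
proof -
  have e: "energy_density p \<alpha> (\<lambda>x. u (x + c)) x = energy_density p \<alpha> u (x + c)" for x
    unfolding energy_density_def
    by (subst (2) nn_integral_lborel_translate[symmetric, where c = c]) (auto simp: algebra_simps)
  have "gag p \<alpha> (\<lambda>x. u (x + c)) = (\<integral>\<^sup>+x. energy_density p \<alpha> u (x + c) \<partial>lborel)"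
    using p by (simp add: gag_eq_energy e)
  also have "\<dots> = gag p \<alpha> u"
    using p by (simp add: gag_eq_energy nn_integral_lborel_translate)
  finally show ?thesis .
qed

lemma hardy_translate:
  fixes u :: "'a::euclidean_space \<Rightarrow> real"
  assumes [measurable]: "u \<in> borel_measurable borel"
  shows "hardy p \<alpha> 0 (\<lambda>x. u (x + c)) = hardy p \<alpha> c u"
proof -
  have "hardy p \<alpha> 0 (\<lambda>x. u (x + c)) = (\<integral>\<^sup>+x. ennreal (\<bar>hq \<alpha> c u (x + c)\<bar> powr p) \<partial>lborel)"
    unfolding hardy_def pint_def by (simp add: hq_def)
  also have "\<dots> = hardy p \<alpha> c u"
    unfolding hardy_def pint_def by (rule nn_integral_lborel_translate) measurable
  finally show ?thesis .
qed

lemma tendsto_hq: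
  "(\<lambda>k. f k x) \<longlonglongrightarrow> u x \<Longrightarrow> (\<lambda>k. hq \<alpha> c (f k) x) \<longlonglongrightarrow> hq \<alpha> c u x"
  unfolding hq_def divide_inverse by (intro tendsto_intros)

lemma AE_tendsto_dq:
  fixes f :: "nat \<Rightarrow> 'a::euclidean_space \<Rightarrow> real"
  assumes "AE x in lborel. (\<lambda>k. f k x) \<longlonglongrightarrow> u x"
  shows "AE z in lborel. (\<lambda>k. dq p \<alpha> (f k) z) \<longlonglongrightarrow> dq p \<alpha> u z"
  using AE_lborel_fst_snd[OF assms]
  by eventually_elim (auto simp: dq_def divide_inverse intro!: tendsto_intros)

text \<open>\<open>C\<close> is any constant for which Hardy's inequality at 0 holds on test
  functions of the whole space. The theorem instantiates it with an admissible number above \<mu>,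
  so the supremum in \<open>hardy_const\<close> never has to be attained.\<close>

locale frac_hardy =
  fixes p \<alpha> C :: real and \<Omega> :: "'a::euclidean_space set"
  assumes p: "2 \<le> p" and \<alpha>: "0 < \<alpha>" "\<alpha> < 1" and n: "p * \<alpha> < real DIM('a)" and C: "0 < C"
    and hardy_test: "\<And>u :: 'a \<Rightarrow> real. u \<in> test_functions UNIV \<Longrightarrow> ennreal C * hardy p \<alpha> 0 u \<le> gag p \<alpha> u"
begin

lemma p1: "1 \<le> p" "0 < p" "p \<noteq> 0"
  using p by auto

lemma C_cancel: "ennreal (1 / C) * (ennreal C * a) = a" "ennreal C * (ennreal (1 / C) * a) = a"
proof -
  have "ennreal (1 / C) * ennreal C = ennreal (1 / C * C)" by (rule ennreal_mult[symmetric]) (use C in auto)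
  then have "ennreal (1 / C) * ennreal C = 1" using C by simp
  then show "ennreal (1 / C) * (ennreal C * a) = a" "ennreal C * (ennreal (1 / C) * a) = a"
    by (metis mult.assoc mult.commute mult_1)+
qed

text \<open>The Borel representatives of \<open>X0\<close>, with the seminorm taken over the whole
  product instead of over \<open>Q\<close>. \<open>X0_iff\<close> shows that the two notions agree
  up to null sets, because the elements vanish a.e. outside \<Omega>.\<close>

definition X :: "('a \<Rightarrow> real) set" where
  "X = {u \<in> borel_measurable borel. \<exists>\<phi>. (\<forall>k. \<phi> k \<in> test_functions \<Omega>) \<and>
          (\<lambda>k. gag p \<alpha> (\<lambda>x. \<phi> k x - u x)) \<longlonglongrightarrow> 0 \<and>
          (AE x in lborel. (\<lambda>k. \<phi> k x) \<longlonglongrightarrow> u x)}"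

lemma X_borel [measurable_dest]: "u \<in> X \<Longrightarrow> u \<in> borel_measurable borel"
  by (simp add: X_def)

lemma X_gag_finite:
  assumes u: "u \<in> X"
  shows "gag p \<alpha> u < \<infinity>"
proof -
  note [measurable] = X_borel[OF u]
  obtain \<phi> where \<phi>: "\<And>k. \<phi> k \<in> test_functions \<Omega>" "(\<lambda>k. gag p \<alpha> (\<lambda>x. \<phi> k x - u x)) \<longlonglongrightarrow> 0"
    using u by (auto simp: X_def)
  note [measurable] = test_functions_borel[OF \<phi>(1)]
  have "\<forall>\<^sub>F k in sequentially. gag p \<alpha> (\<lambda>x. \<phi> k x - u x) < 1" using \<phi>(2) by (intro order_tendstoD) auto
  then obtain k where k: "gag p \<alpha> (\<lambda>x. \<phi> k x - u x) < 1" by (auto dest: eventually_happens)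
  have "gag p \<alpha> (\<lambda>x. \<phi> k x - (\<phi> k x - u x)) \<le> ennreal (2 powr p) * (gag p \<alpha> (\<phi> k) + gag p \<alpha> (\<lambda>x. \<phi> k x - u x))"
    using p1 by (intro gag_diff_le) auto
  also have "\<dots> < \<infinity>"
    using k gag_finite_test_function[OF p1(1) \<alpha> \<phi>(1)[of k]] ennreal_one_less_top
    by (auto simp: ennreal_mult_less_top intro: less_trans)
  finally show ?thesis by simp
qed

lemma X_approx:
  assumes u: "u \<in> X"
  obtains \<phi> where "\<And>k. \<phi> k \<in> test_functions \<Omega>" "(\<lambda>k. gag p \<alpha> (\<lambda>x. \<phi> k x - u x)) \<longlonglongrightarrow> 0"
    "AE x in lborel. (\<lambda>k. \<phi> k x) \<longlonglongrightarrow> u x"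
    "\<forall>\<epsilon>>0. \<forall>\<^sub>F k in sequentially. gag p \<alpha> (\<phi> k) \<le> gag p \<alpha> u + ennreal \<epsilon>"
proof -
  note [measurable] = X_borel[OF u]
  obtain \<phi> where \<phi>: "\<And>k. \<phi> k \<in> test_functions \<Omega>" "(\<lambda>k. gag p \<alpha> (\<lambda>x. \<phi> k x - u x)) \<longlonglongrightarrow> 0"
    "AE x in lborel. (\<lambda>k. \<phi> k x) \<longlonglongrightarrow> u x"
    using u by (auto simp: X_def)
  note [measurable] = test_functions_borel[OF \<phi>(1)]
  have "\<forall>\<^sub>F k in sequentially. gag p \<alpha> (\<phi> k) \<le> gag p \<alpha> u + ennreal \<epsilon>" if "0 < \<epsilon>" for \<epsilon>
    using X_gag_finite[OF u] \<phi>(2) that p1 unfolding gag_def dq_diff by (intro pint_limsup) auto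
  then show thesis using that[OF \<phi>] by blast
qed

text \<open>The energies of the approximants are eventually close to or below that of
  \<open>u\<close>, while Fatou's lemma bounds the Hardy integral of \<open>u\<close> by theirs. Any
  centre is allowed because the seminorm is translation invariant; the singular points of the
  potential will be such centres.\<close>

lemma hardy_X:
  assumes u: "u \<in> X"
  shows "ennreal C * hardy p \<alpha> c u \<le> gag p \<alpha> u"
proof (rule ennreal_le_epsilon)
  fix \<epsilon> :: real assume \<epsilon>: "0 < \<epsilon>"
  note [measurable] = X_borel[OF u]
  obtain \<phi> where \<phi>full: "\<And>k. \<phi> k \<in> test_functions \<Omega>" "(\<lambda>k. gag p \<alpha> (\<lambda>x. \<phi> k x - u x)) \<longlonglongrightarrow> 0"
    "AE x in lborel. (\<lambda>k. \<phi> k x) \<longlonglongrightarrow> u x"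
    "\<forall>\<epsilon>>0. \<forall>\<^sub>F k in sequentially. gag p \<alpha> (\<phi> k) \<le> gag p \<alpha> u + ennreal \<epsilon>"
    using X_approx[OF u] by blast
  note \<phi> = \<phi>full(1,3) \<phi>full(4)[rule_format, OF \<epsilon>]
  note [measurable] = test_functions_borel[OF \<phi>(1)]
  note inv = C_cancel
  have le: "hardy p \<alpha> c (\<phi> k) \<le> ennreal (1 / C) * gag p \<alpha> (\<phi> k)" for k
  proof -
    have "\<phi> k \<in> test_functions UNIV" using test_functions_mono[OF \<phi>(1)] by simp
    from hardy_test[OF test_functions_translate[OF this, of c]]
    have "ennreal C * hardy p \<alpha> c (\<phi> k) \<le> gag p \<alpha> (\<phi> k)"
      using p1 by (simp add: hardy_translate gag_translate)
    then have "ennreal (1 / C) * (ennreal C * hardy p \<alpha> c (\<phi> k)) \<le> ennreal (1 / C) * gag p \<alpha> (\<phi> k)"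
      by (intro mult_left_mono) auto
    then show ?thesis by (simp only: inv)
  qed
  have "hardy p \<alpha> c u \<le> ennreal (1 / C) * (gag p \<alpha> u + ennreal \<epsilon>)"
    unfolding hardy_def
  proof (rule pint_fatou_bound)
    show "AE x in lborel. (\<lambda>k. hq \<alpha> c (\<phi> k) x) \<longlonglongrightarrow> hq \<alpha> c u x"
      using \<phi>(2) by eventually_elim (rule tendsto_hq)
    show "\<forall>\<^sub>F k in sequentially. pint p lborel (hq \<alpha> c (\<phi> k)) \<le> ennreal (1 / C) * (gag p \<alpha> u + ennreal \<epsilon>)"
      using \<phi>(3) by eventually_elim (rule order_trans[OF le[unfolded hardy_def]], auto intro: mult_left_mono)
  qed (use p1 in auto)
  then have "ennreal C * hardy p \<alpha> c u \<le> ennreal C * (ennreal (1 / C) * (gag p \<alpha> u + ennreal \<epsilon>))"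
    by (intro mult_left_mono) auto
  then show "ennreal C * hardy p \<alpha> c u \<le> gag p \<alpha> u + ennreal \<epsilon>" by (simp only: inv)
qed

lemma hardy_X_le:
  assumes "u \<in> X" "gag p \<alpha> u \<le> ennreal K"
  shows "hardy p \<alpha> c u \<le> ennreal (K / C)"
proof -
  have "ennreal C * hardy p \<alpha> c u \<le> ennreal K" using hardy_X[OF assms(1)] assms(2) order_trans by blast
  then have "ennreal (1 / C) * (ennreal C * hardy p \<alpha> c u) \<le> ennreal (1 / C) * ennreal K"
    by (intro mult_left_mono) auto
  also have "ennreal (1 / C) * (ennreal C * hardy p \<alpha> c u) = hardy p \<alpha> c u"
    by (rule C_cancel)
  also have "ennreal (1 / C) * ennreal K = ennreal (K / C)"
    using C by (simp flip: ennreal_mult')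
  finally show ?thesis .
qed

text \<open>The slack in \<open>K + 1\<close> is there because approximating test functions have
  energy at most \<open>gag p \<alpha> u + 1\<close> from some index on; the exact constant is
  immaterial.\<close>

lemma sobolev_X:
  obtains S where "0 < S"
    "\<And>u K. u \<in> X \<Longrightarrow> 0 \<le> K \<Longrightarrow> gag p \<alpha> u \<le> ennreal K \<Longrightarrow>
       pint (p / (1 - p * \<alpha> / real DIM('a))) lborel u \<le> ennreal ((S * (K + 1)) powr (1 / (1 - p * \<alpha> / real DIM('a))))"
proof -
  define \<theta> where "\<theta> = 1 - p * \<alpha> / real DIM('a)"
  have \<theta>: "0 < \<theta>" using n by (simp add: \<theta>_def)
  obtain S where S: "0 < S" "\<And>(u :: 'a \<Rightarrow> real) \<Omega> K. u \<in> test_functions \<Omega> \<Longrightarrow> 0 \<le> K \<Longrightarrow> gag p \<alpha> u \<le> ennreal K \<Longrightarrow>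
       pint (p / \<theta>) lborel u \<le> ennreal ((S * K) powr (1 / \<theta>))"
    using fractional_sobolev[OF p1(1) \<alpha> n] unfolding \<theta>_def by metis
  have "pint (p / \<theta>) lborel u \<le> ennreal ((S * (K + 1)) powr (1 / \<theta>))"
    if u: "u \<in> X" and K: "0 \<le> K" "gag p \<alpha> u \<le> ennreal K" for u K
  proof -
    note [measurable] = X_borel[OF u]
  obtain \<phi> where \<phi>full: "\<And>k. \<phi> k \<in> test_functions \<Omega>" "(\<lambda>k. gag p \<alpha> (\<lambda>x. \<phi> k x - u x)) \<longlonglongrightarrow> 0"
    "AE x in lborel. (\<lambda>k. \<phi> k x) \<longlonglongrightarrow> u x"
    "\<forall>\<epsilon>>0. \<forall>\<^sub>F k in sequentially. gag p \<alpha> (\<phi> k) \<le> gag p \<alpha> u + ennreal \<epsilon>"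
    using X_approx[OF u] by blast
    note \<phi> = \<phi>full(1,3) \<phi>full(4)[rule_format, OF zero_less_one]
    note [measurable] = test_functions_borel[OF \<phi>(1)]
    show ?thesis
    proof (rule pint_fatou_bound)
      show "\<forall>\<^sub>F k in sequentially. pint (p / \<theta>) lborel (\<phi> k) \<le> ennreal ((S * (K + 1)) powr (1 / \<theta>))"
        using \<phi>(3)
      proof eventually_elim
        case (elim k)
        also have "gag p \<alpha> u + ennreal 1 \<le> ennreal K + ennreal 1" using K by (intro add_right_mono)
        also have "\<dots> = ennreal (K + 1)" using K by simp
        finally show ?case using K by (intro S(2)[OF \<phi>(1)]) auto
      qed
    qed (use \<phi>(2) p1 \<theta> in auto)
  qed
  then show thesis using S(1) that unfolding \<theta>_def by blast
qed

lemma test_functions_X: "u \<in> test_functions \<Omega> \<Longrightarrow> u \<in> X"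
  by (auto simp: X_def test_functions_borel intro!: exI[of _ "\<lambda>k. u"])

lemma X_cmult:
  assumes u: "u \<in> X"
  shows "(\<lambda>x. c * u x) \<in> X"
proof -
  note [measurable] = X_borel[OF u]
  obtain \<phi> where \<phi>: "\<And>k. \<phi> k \<in> test_functions \<Omega>" "(\<lambda>k. gag p \<alpha> (\<lambda>x. \<phi> k x - u x)) \<longlonglongrightarrow> 0"
    "AE x in lborel. (\<lambda>k. \<phi> k x) \<longlonglongrightarrow> u x"
    using u by (auto simp: X_def)
  note [measurable] = test_functions_borel[OF \<phi>(1)]
  have eq: "gag p \<alpha> (\<lambda>x. c * \<phi> k x - c * u x) = ennreal (\<bar>c\<bar> powr p) * gag p \<alpha> (\<lambda>x. \<phi> k x - u x)" for k
    by (subst gag_cmult[symmetric]) (auto simp: algebra_simps)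
  have "(\<lambda>k. ennreal (\<bar>c\<bar> powr p) * gag p \<alpha> (\<lambda>x. \<phi> k x - u x)) \<longlonglongrightarrow> ennreal (\<bar>c\<bar> powr p) * 0"
    using \<phi>(2) by (intro ennreal_tendsto_cmult) auto
  then have "(\<lambda>k. gag p \<alpha> (\<lambda>x. c * \<phi> k x - c * u x)) \<longlonglongrightarrow> 0" by (simp add: eq)
  moreover have "AE x in lborel. (\<lambda>k. c * \<phi> k x) \<longlonglongrightarrow> c * u x"
    using \<phi>(3) by eventually_elim (intro tendsto_intros)
  ultimately show ?thesis using \<phi>(1)
    by (auto simp: X_def intro!: exI[of _ "\<lambda>k x. c * \<phi> k x"] test_functions_cmult)
qed

lemma X_diff:
  assumes u: "u \<in> X" and v: "v \<in> X"
  shows "(\<lambda>x. u x - v x) \<in> X"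
proof -
  note [measurable] = X_borel[OF u] X_borel[OF v]
  obtain \<phi> where \<phi>: "\<And>k. \<phi> k \<in> test_functions \<Omega>" "(\<lambda>k. gag p \<alpha> (\<lambda>x. \<phi> k x - u x)) \<longlonglongrightarrow> 0"
    "AE x in lborel. (\<lambda>k. \<phi> k x) \<longlonglongrightarrow> u x"
    using u by (auto simp: X_def)
  obtain \<psi> where \<psi>: "\<And>k. \<psi> k \<in> test_functions \<Omega>" "(\<lambda>k. gag p \<alpha> (\<lambda>x. \<psi> k x - v x)) \<longlonglongrightarrow> 0"
    "AE x in lborel. (\<lambda>k. \<psi> k x) \<longlonglongrightarrow> v x"
    using v by (auto simp: X_def)
  note [measurable] = test_functions_borel[OF \<phi>(1)] test_functions_borel[OF \<psi>(1)]
  have le: "gag p \<alpha> (\<lambda>x. (\<phi> k x - \<psi> k x) - (u x - v x))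
      \<le> ennreal (2 powr p) * (gag p \<alpha> (\<lambda>x. \<phi> k x - u x) + gag p \<alpha> (\<lambda>x. \<psi> k x - v x))" for k
  proof -
    have "gag p \<alpha> (\<lambda>x. (\<phi> k x - u x) - (\<psi> k x - v x))
      \<le> ennreal (2 powr p) * (gag p \<alpha> (\<lambda>x. \<phi> k x - u x) + gag p \<alpha> (\<lambda>x. \<psi> k x - v x))"
      using p1 by (intro gag_diff_le) auto
    then show ?thesis by (simp add: algebra_simps)
  qed
  have "(\<lambda>k. ennreal (2 powr p) * (gag p \<alpha> (\<lambda>x. \<phi> k x - u x) + gag p \<alpha> (\<lambda>x. \<psi> k x - v x)))
      \<longlonglongrightarrow> ennreal (2 powr p) * (0 + 0)"
    using \<phi>(2) \<psi>(2) by (intro ennreal_tendsto_cmult tendsto_add) auto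
  then have upper: "(\<lambda>k. ennreal (2 powr p) * (gag p \<alpha> (\<lambda>x. \<phi> k x - u x) + gag p \<alpha> (\<lambda>x. \<psi> k x - v x)))
      \<longlonglongrightarrow> 0" by simp
  have "(\<lambda>k. gag p \<alpha> (\<lambda>x. (\<phi> k x - \<psi> k x) - (u x - v x))) \<longlonglongrightarrow> 0"
    by (rule tendsto_sandwich[OF _ _ tendsto_const upper]) (auto intro!: always_eventually le)
  moreover have "AE x in lborel. (\<lambda>k. \<phi> k x - \<psi> k x) \<longlonglongrightarrow> u x - v x"
    using \<phi>(3) \<psi>(3) by eventually_elim (intro tendsto_intros)
  ultimately show ?thesis using \<phi>(1) \<psi>(1)
    by (auto simp: X_def intro!: exI[of _ "\<lambda>k x. \<phi> k x - \<psi> k x"] test_functions_diff)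
qed

text \<open>A substitute for Mazur's lemma: \<open>T m\<close> contains the convex hull of the tail
  \<open>\<phi> m, \<phi> (m + 1), \<dots>\<close>, and almost minimisers of the seminorm over \<open>T m\<close> form a Cauchy sequence
  by Clarkson's inequality.\<close>

lemma X_closed_test:
  assumes \<phi>: "\<And>k. \<phi> k \<in> test_functions \<Omega>" and K: "\<And>k. gag p \<alpha> (\<phi> k) \<le> ennreal K"
    and ae: "AE x in lborel. (\<lambda>k. \<phi> k x) \<longlonglongrightarrow> u x" and [measurable]: "u \<in> borel_measurable borel"
  shows "u \<in> X"
proof -
  \<comment> \<open>Membership is a pointwise condition: \<open>\<psi> x\<close> lies in every
    closed interval that contains the tail values at \<open>x\<close>. It is stable under midpoints,
    and it forces any choice of one element from each \<open>T m\<close> to converge wherever \<phi>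
    does.\<close>
  define T where "T m = {\<psi> \<in> test_functions \<Omega>. \<forall>x a \<epsilon>. (\<forall>k\<ge>m. \<bar>\<phi> k x - a\<bar> \<le> \<epsilon>) \<longrightarrow> \<bar>\<psi> x - a\<bar> \<le> \<epsilon>}" for m :: nat
  have Tmid: "(\<lambda>x. (\<psi> x + \<xi> x) / 2) \<in> T m" if "\<psi> \<in> T m" "\<xi> \<in> T m" for \<psi> \<xi> m
  proof -
    have "(\<lambda>x. (1/2) * (\<psi> x + \<xi> x)) \<in> test_functions \<Omega>"
      using that by (intro test_functions_cmult test_functions_add) (auto simp: T_def)
    moreover have "\<bar>(\<psi> x + \<xi> x) / 2 - a\<bar> \<le> \<epsilon>" if H: "\<forall>k\<ge>m. \<bar>\<phi> k x - a\<bar> \<le> \<epsilon>" for x a \<epsilon>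
    proof -
      have "\<bar>\<psi> x - a\<bar> \<le> \<epsilon>" "\<bar>\<xi> x - a\<bar> \<le> \<epsilon>" using \<open>\<psi> \<in> T m\<close> \<open>\<xi> \<in> T m\<close> H by (auto simp: T_def)
      then show ?thesis by (simp add: abs_le_iff field_simps)
    qed
    ultimately show ?thesis by (simp add: T_def)
  qed
  have Tanti: "T j \<subseteq> T m" if "m \<le> j" for m j using that by (auto simp: T_def)
  have \<phi>T: "\<phi> m \<in> T m" for m using \<phi> by (auto simp: T_def)
  define d where "d m = enn2real (INF \<psi>\<in>T m. gag p \<alpha> \<psi>)" for m
  have INF_le: "(INF \<psi>\<in>T m. gag p \<alpha> \<psi>) \<le> ennreal K" for m
    using INF_lower[OF \<phi>T[of m], of "gag p \<alpha>"] K[of m] by (rule order_trans)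
  have INF_eq: "(INF \<psi>\<in>T m. gag p \<alpha> \<psi>) = ennreal (d m)" for m
    using INF_le[of m] le_less_trans[OF _ ennreal_less_top] by (auto simp: d_def)
  have d0: "0 \<le> d m" for m by (simp add: d_def)
  have dlow: "ennreal (d m) \<le> gag p \<alpha> \<psi>" if "\<psi> \<in> T m" for \<psi> m
    using INF_lower[OF that, of "gag p \<alpha>"] by (simp add: INF_eq)
  have dmono: "d m \<le> d j" if "m \<le> j" for m j
  proof -
    have "ennreal (d m) \<le> ennreal (d j)" unfolding INF_eq[symmetric] by (intro INF_superset_mono Tanti that) auto
    then show ?thesis using d0 by simp
  qed
  have dK: "d m \<le> max K 0" for m
    using INF_le[of m] d0[of m] unfolding INF_eq by (auto simp: max_def ennreal_le_iff2)
  have "\<exists>\<psi>\<in>T m. gag p \<alpha> \<psi> < ennreal (d m + 1 / Suc m)" for m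
  proof -
    have "(INF \<psi>\<in>T m. gag p \<alpha> \<psi>) < ennreal (d m + 1 / Suc m)"
      unfolding INF_eq using d0 by (intro ennreal_lessI add_nonneg_pos) auto
    then show ?thesis by (simp add: INF_less_iff)
  qed
  then obtain v where v: "\<And>m. v m \<in> T m" "\<And>m. gag p \<alpha> (v m) < ennreal (d m + 1 / Suc m)" by metis
  have vt: "v m \<in> test_functions \<Omega>" for m using v(1) by (auto simp: T_def)
  note [measurable] = test_functions_borel[OF vt]
  \<comment> \<open>The infima increase because the sets \<open>T m\<close> shrink, and they stay
    below the common energy bound.\<close>
  obtain D where D: "d \<longlonglongrightarrow> D" "\<And>m. d m \<le> D"
    using incseq_convergent[of d "max K 0"] dmono dK by (auto simp: incseq_def)
  \<comment> \<open>Bounds the excess over \<open>d m\<close> of the mean of the energies of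
    \<open>v m\<close> and \<open>v j\<close>, for all \<open>j \<ge> m\<close> at once.\<close>
  define e where "e m = (D - d m) / 2 + 1 / Suc m" for m
  have e: "e \<longlonglongrightarrow> 0"
  proof -
    have "(\<lambda>m. (D - d m) / 2 + 1 / real (Suc m)) \<longlonglongrightarrow> (D - D) / 2 + 0"
      by (intro tendsto_intros D LIMSEQ_Suc[OF lim_1_over_n]) auto
    then show ?thesis by (simp add: e_def[abs_def])
  qed
  have close: "gag p \<alpha> (\<lambda>x. v m x - v j x) \<le> ennreal (2 powr p * e m)" if mj: "m \<le> j" for m j
  proof -
    have "1 / Suc j \<le> 1 / Suc m" using mj by (simp add: frac_le)
    define g where "g = gag p \<alpha> (\<lambda>x. (v m x - v j x) / 2)"
    \<comment> \<open>The midpoint still belongs to \<open>T m\<close>, so its energy is at least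
      \<open>d m\<close>; Clarkson's inequality then leaves no more than \<open>e m\<close> for the
      half difference.\<close>
    have "ennreal (d m) + g \<le> gag p \<alpha> (\<lambda>x. (v m x + v j x) / 2) + gag p \<alpha> (\<lambda>x. (v m x - v j x) / 2)"
      unfolding g_def using v(1) Tanti[OF mj] by (intro add_right_mono dlow Tmid) auto
    also have "\<dots> \<le> ennreal (1/2) * (gag p \<alpha> (v m) + gag p \<alpha> (v j))"
    proof -
      have "dq p \<alpha> (\<lambda>x. (v m x + v j x) / 2) = (\<lambda>z. (dq p \<alpha> (v m) z + dq p \<alpha> (v j) z) / 2)"
        "dq p \<alpha> (\<lambda>x. (v m x - v j x) / 2) = (\<lambda>z. (dq p \<alpha> (v m) z - dq p \<alpha> (v j) z) / 2)"
        by (auto simp: dq_def diff_divide_distrib add_divide_distrib)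
      then show ?thesis unfolding gag_def using p by (simp only:) (intro pint_clarkson, auto)
    qed
    also have "\<dots> \<le> ennreal (1/2) * (ennreal (d m + 1 / Suc m) + ennreal (d j + 1 / Suc j))"
      by (intro mult_left_mono add_mono less_imp_le[OF v(2)]) auto
    also have "\<dots> = ennreal (1/2 * ((d m + 1 / Suc m) + (d j + 1 / Suc j)))"
    proof -
      have "ennreal (d m + 1 / Suc m) + ennreal (d j + 1 / Suc j) = ennreal ((d m + 1 / Suc m) + (d j + 1 / Suc j))"
        by (rule ennreal_plus[symmetric]) (use d0 in auto)
      then show ?thesis by (simp only:) (rule ennreal_mult[symmetric], use d0 in \<open>auto intro!: add_nonneg_nonneg\<close>)
    qed
    also have "\<dots> \<le> ennreal (d m + e m)"
    proof (rule ennreal_leI)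
      have "1/2 * ((d m + a) + (d j + b)) \<le> d m + ((D - d m) / 2 + a)" if "b \<le> a" for a b :: real
        using that D(2)[of j] by (simp add: field_simps)
      from this[OF \<open>1 / Suc j \<le> 1 / Suc m\<close>]
      show "1/2 * ((d m + 1 / Suc m) + (d j + 1 / Suc j)) \<le> d m + e m" unfolding e_def .
    qed
    finally have sum: "ennreal (d m) + g \<le> ennreal (d m + e m)" .
    have e0: "0 \<le> e m" using D(2)[of m] by (simp add: e_def)
    have g: "g \<le> ennreal (e m)"
    proof -
      have "ennreal (d m) + g \<le> ennreal (d m) + ennreal (e m)" using sum d0 e0 by (simp add: ennreal_plus)
      then show ?thesis by (simp add: ennreal_add_left_cancel_le)
    qed
    have "gag p \<alpha> (\<lambda>x. v m x - v j x) = ennreal (2 powr p) * g"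
    proof -
      have "(\<lambda>x. 2 * ((v m x - v j x) / 2)) = (\<lambda>x. v m x - v j x)" by (intro ext) (simp add: field_simps)
      then show ?thesis unfolding g_def using gag_cmult[of "\<lambda>x. (v m x - v j x) / 2" p \<alpha> 2]
        by (simp only: abs_numeral) measurable
    qed
    also have "\<dots> \<le> ennreal (2 powr p) * ennreal (e m)" using g by (intro mult_left_mono) auto
    finally show ?thesis using e0 by (simp add: ennreal_mult)
  qed
  have vconv: "AE x in lborel. (\<lambda>m. v m x) \<longlonglongrightarrow> u x"
    using ae
  proof eventually_elim
    case (elim x)
    show ?case
    proof (rule metric_LIMSEQ_I)
      fix r :: real assume r: "0 < r"
      then obtain N where N: "\<And>k. k \<ge> N \<Longrightarrow> dist (\<phi> k x) (u x) < r / 2"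
        using metric_LIMSEQ_D[OF elim, of "r / 2"] by auto
      have "dist (v m x) (u x) < r" if "m \<ge> N" for m
      proof -
        have "\<bar>v m x - u x\<bar> \<le> r / 2"
        proof -
          have "\<forall>k\<ge>m. \<bar>\<phi> k x - u x\<bar> \<le> r / 2"
            using N that by (auto simp: dist_real_def intro!: less_imp_le)
          then show ?thesis using v(1)[of m] unfolding T_def by blast
        qed
        then show ?thesis using r by (simp add: dist_real_def)
      qed
      then show "\<exists>N. \<forall>m\<ge>N. dist (v m x) (u x) < r" by blast
    qed
  qed
  \<comment> \<open>Fatou's lemma for \<open>j\<close> tending to infinity in
    \<open>close\<close>.\<close>
  have lim: "gag p \<alpha> (\<lambda>x. v m x - u x) \<le> ennreal (2 powr p * e m)" for m
    unfolding gag_def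
  proof (rule pint_fatou_bound)
    have "AE x in lborel. (\<lambda>j. v m x - v j x) \<longlonglongrightarrow> v m x - u x"
      using vconv by eventually_elim (intro tendsto_intros)
    then show "AE z in lborel. (\<lambda>j. dq p \<alpha> (\<lambda>x. v m x - v j x) z) \<longlonglongrightarrow> dq p \<alpha> (\<lambda>x. v m x - u x) z"
      by (rule AE_tendsto_dq)
    show "\<forall>\<^sub>F j in sequentially. pint p lborel (dq p \<alpha> (\<lambda>x. v m x - v j x)) \<le> ennreal (2 powr p * e m)"
      using close by (auto simp: eventually_sequentially gag_def)
  qed (use p1 in auto)
  have "(\<lambda>m. gag p \<alpha> (\<lambda>x. v m x - u x)) \<longlonglongrightarrow> 0"
  proof (rule tendsto_sandwich[OF _ _ tendsto_const])
    show "(\<lambda>m. ennreal (2 powr p * e m)) \<longlonglongrightarrow> 0"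
      using tendsto_ennrealI[OF tendsto_mult_right_zero[OF e, of "2 powr p"]] by simp
  qed (use lim in auto)
  then show ?thesis using vt vconv by (auto simp: X_def)
qed

text \<open>The seminorm does not see additive constants, but Hardy's inequality passes summability
  on to the weighted L^p integrals, and these do control pointwise values away from 0.\<close>

lemma AE_tendsto_of_hardy:
  assumes w: "\<And>k. w k \<in> X" and s: "\<And>k. gag p \<alpha> (w k) \<le> ennreal ((1/2) ^ k)"
  shows "AE x in lborel. (\<lambda>k. w k x) \<longlonglongrightarrow> 0"
proof -
  note [measurable] = X_borel[OF w]
  have "(\<Sum>k. pint p lborel (hq \<alpha> 0 (w k))) \<le> (\<Sum>k. ennreal ((1/2) ^ k / C))"
    using hardy_X_le[OF w s] by (intro suminf_le) (auto simp: hardy_def)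
  also have "\<dots> < \<infinity>"
    using C by (subst suminf_ennreal2) (auto intro!: summable_divide summable_geometric)
  finally have "AE x in lborel. (\<lambda>k. hq \<alpha> 0 (w k) x) \<longlonglongrightarrow> 0"
    using p1 by (intro summable_pint_imp_AE_tendsto_0[of p]) auto
  moreover have "AE x in lborel. x \<noteq> (0::'a)" by (rule AE_lborel_singleton)
  ultimately show ?thesis
  proof eventually_elim
    case (elim x)
    then have "(\<lambda>k. hq \<alpha> 0 (w k) x * norm x powr \<alpha>) \<longlonglongrightarrow> 0 * norm x powr \<alpha>" by (intro tendsto_intros)
    then show ?case using elim by (simp add: hq_def)
  qed
qed

text \<open>Each \<open>u k\<close> is replaced by a test function within \<open>(1/2) ^ k\<close>
  in the seminorm. The errors tend to 0 almost everywhere by Hardy's inequality, so the limit is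
  unchanged and the case of test functions applies.\<close>

lemma X_closed:
  assumes u: "\<And>k. u k \<in> X" and K: "\<And>k. gag p \<alpha> (u k) \<le> ennreal K"
    and ae: "AE x in lborel. (\<lambda>k. u k x) \<longlonglongrightarrow> w x" and [measurable]: "w \<in> borel_measurable borel"
  shows "w \<in> X"
proof -
  note [measurable] = X_borel[OF u]
  have "\<exists>\<phi>\<in>test_functions \<Omega>. gag p \<alpha> (\<lambda>x. \<phi> x - u k x) \<le> ennreal ((1/2) ^ k)" for k
  proof -
    obtain \<phi> where \<phi>: "\<And>j. \<phi> j \<in> test_functions \<Omega>" "(\<lambda>j. gag p \<alpha> (\<lambda>x. \<phi> j x - u k x)) \<longlonglongrightarrow> 0"
      using u[of k] by (auto simp: X_def)
    have "\<forall>\<^sub>F j in sequentially. gag p \<alpha> (\<lambda>x. \<phi> j x - u k x) < ennreal ((1/2) ^ k)"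
      by (intro order_tendstoD(2)[OF \<phi>(2)]) simp
    then show ?thesis using \<phi>(1) by (auto dest!: eventually_happens intro: less_imp_le)
  qed
  then obtain \<phi> where \<phi>: "\<And>k. \<phi> k \<in> test_functions \<Omega>" "\<And>k. gag p \<alpha> (\<lambda>x. \<phi> k x - u k x) \<le> ennreal ((1/2) ^ k)"
    by metis
  note [measurable] = test_functions_borel[OF \<phi>(1)]
  have "AE x in lborel. (\<lambda>k. \<phi> k x - u k x) \<longlonglongrightarrow> 0"
    by (rule AE_tendsto_of_hardy) (auto intro!: X_diff[OF test_functions_X[OF \<phi>(1)] u] \<phi>(2))
  then have ae': "AE x in lborel. (\<lambda>k. \<phi> k x) \<longlonglongrightarrow> w x"
    using ae
  proof eventually_elim
    case (elim x)
    from tendsto_add[OF elim] show ?case by simp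
  qed
  show ?thesis
  proof (rule X_closed_test[OF \<phi>(1) _ ae'])
    fix k
    have "gag p \<alpha> (\<lambda>x. (\<phi> k x - u k x) + u k x) \<le> ennreal (2 powr p) * (gag p \<alpha> (\<lambda>x. \<phi> k x - u k x) + gag p \<alpha> (u k))"
      using p1 by (intro gag_add_le) auto
    also have "\<dots> \<le> ennreal (2 powr p) * (ennreal 1 + ennreal (max K 0))"
    proof (intro mult_left_mono add_mono)
      show "gag p \<alpha> (\<lambda>x. \<phi> k x - u k x) \<le> ennreal 1"
        by (rule order_trans[OF \<phi>(2)]) (intro ennreal_leI power_le_one, auto)
      show "gag p \<alpha> (u k) \<le> ennreal (max K 0)" by (rule order_trans[OF K]) (intro ennreal_leI, simp)
    qed auto
    also have "\<dots> = ennreal (2 powr p * (1 + max K 0))" by (simp add: ennreal_mult)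
    finally show "gag p \<alpha> (\<phi> k) \<le> ennreal (2 powr p * (1 + max K 0))" by simp
  qed measurable
qed

end

section \<open>Potentials\<close>

lemma borel_lebesgue_measurable:
  "f \<in> borel_measurable borel \<Longrightarrow> f \<in> borel_measurable lebesgue"
  by (rule measurable_completion) simp

text \<open>The finite set \<open>Y\<close> comes from a cover with smallness \<open>1\<close> only; smallness \<open>\<delta> / card Y\<close> is
  required afterwards near the points of \<open>Y\<close>.\<close>

lemma singular_potential_bound:
  fixes V :: "'a::euclidean_space \<Rightarrow> real"
  assumes s: "0 < s" and \<delta>: "0 < \<delta>"
    and loc: "\<And>y. y \<in> closure \<Omega> \<Longrightarrow> ((\<lambda>x. norm (x - y) powr s * V x) \<longlongrightarrow> 0) (at y within \<Omega>)"
    and inf: "((\<lambda>x. norm x powr s * V x) \<longlongrightarrow> 0) (inf at_infinity (principal \<Omega>))"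
  obtains Y R M where "finite Y" "0 < R" "0 \<le> M"
    "\<And>x. x \<in> \<Omega> \<Longrightarrow> x \<notin> Y \<Longrightarrow> \<bar>V x\<bar> \<le> \<delta> / norm x powr s
       + (\<Sum>y\<in>Y. \<delta> / (real (card Y) + 1) / norm (x - y) powr s) + M * indicator (cball 0 R) x"
proof -
  have "\<forall>\<^sub>F x in inf at_infinity (principal \<Omega>). norm (norm x powr s * V x) < \<delta>"
    using tendsto_norm[OF inf] \<delta> by (intro order_tendstoD) auto
  then obtain R0 where R0: "\<And>x. R0 \<le> norm x \<Longrightarrow> x \<in> \<Omega> \<Longrightarrow> \<bar>norm x powr s * V x\<bar> < \<delta>"
    by (auto simp: eventually_inf_principal eventually_at_infinity)
  define R where "R = max R0 1"
  have R: "0 < R" "\<And>x. R \<le> norm x \<Longrightarrow> x \<in> \<Omega> \<Longrightarrow> \<bar>norm x powr s * V x\<bar> < \<delta>"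
    using R0 by (auto simp: R_def)
  define S where "S = closure \<Omega> \<inter> cball 0 R"
  have "compact S" unfolding S_def by (intro closed_Int_compact) auto
  have near: "\<exists>r>0. \<forall>x\<in>\<Omega>. x \<noteq> y \<longrightarrow> dist x y < r \<longrightarrow> \<bar>norm (x - y) powr s * V x\<bar> < \<eta>"
    if "y \<in> closure \<Omega>" "0 < \<eta>" for y \<eta>
  proof -
    have "\<forall>\<^sub>F x in at y within \<Omega>. norm (norm (x - y) powr s * V x) < \<eta>"
      using tendsto_norm[OF loc[OF that(1)]] that(2) by (intro order_tendstoD) auto
    then show ?thesis by (auto simp: eventually_at)
  qed
  have "\<forall>y\<in>S. \<exists>r>0. \<forall>x\<in>\<Omega>. x \<noteq> y \<longrightarrow> dist x y < r \<longrightarrow> \<bar>norm (x - y) powr s * V x\<bar> < 1"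
    using near[of _ 1] by (auto simp: S_def)
  then obtain r where r: "\<And>y. y \<in> S \<Longrightarrow> 0 < r y"
    "\<And>y x. y \<in> S \<Longrightarrow> x \<in> \<Omega> \<Longrightarrow> x \<noteq> y \<Longrightarrow> dist x y < r y \<Longrightarrow> \<bar>norm (x - y) powr s * V x\<bar> < 1"
    by metis
  have "S \<subseteq> (\<Union>y\<in>S. ball y (r y))" using r(1) by force
  then obtain Y where Y: "Y \<subseteq> S" "finite Y" "S \<subseteq> (\<Union>y\<in>Y. ball y (r y))"
    using compactE_image[OF \<open>compact S\<close>, of S "\<lambda>y. ball y (r y)"] by auto
  define \<eta> where "\<eta> = \<delta> / (real (card Y) + 1)"
  have \<eta>: "0 < \<eta>" using \<delta> by (simp add: \<eta>_def add_nonneg_pos)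
  have "\<forall>y\<in>Y. \<exists>r>0. \<forall>x\<in>\<Omega>. x \<noteq> y \<longrightarrow> dist x y < r \<longrightarrow> \<bar>norm (x - y) powr s * V x\<bar> < \<eta>"
    using near[OF _ \<eta>] Y(1) by (auto simp: S_def)
  then obtain t where t: "\<And>y. y \<in> Y \<Longrightarrow> 0 < t y"
    "\<And>y x. y \<in> Y \<Longrightarrow> x \<in> \<Omega> \<Longrightarrow> x \<noteq> y \<Longrightarrow> dist x y < t y \<Longrightarrow> \<bar>norm (x - y) powr s * V x\<bar> < \<eta>"
    by metis
  \<comment> \<open>Beyond the radius \<open>t y\<close> but inside the covering radius
    \<open>r y\<close>, smallness 1 alone bounds \<open>V\<close> by
    \<open>1 / t y powr s\<close>.\<close>
  define M where "M = (\<Sum>y\<in>Y. 1 / t y powr s)"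
  have M: "0 \<le> M" unfolding M_def by (intro sum_nonneg) auto
  have bound: "\<bar>V x\<bar> \<le> a / norm z powr s" if "\<bar>norm z powr s * V x\<bar> < a" "z \<noteq> 0" for x z :: 'a and a
    using that by (simp add: abs_mult field_simps)
  show thesis
  proof
    fix x assume x: "x \<in> \<Omega>" "x \<notin> Y"
    have nn: "0 \<le> \<delta> / norm x powr s" "0 \<le> (\<Sum>y\<in>Y. \<eta> / norm (x - y) powr s)" "0 \<le> M * indicator (cball 0 R) x"
      using \<delta> \<eta> M by (auto intro!: sum_nonneg)
    have "\<bar>V x\<bar> \<le> \<delta> / norm x powr s + (\<Sum>y\<in>Y. \<eta> / norm (x - y) powr s) + M * indicator (cball 0 R) x"
    proof (cases "R \<le> norm x")
      case True
      have "\<bar>V x\<bar> \<le> \<delta> / norm x powr s" using R(2)[OF True x(1)] True R(1) by (intro bound) auto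
      then show ?thesis using nn by linarith
    next
      case False
      then have "x \<in> S" using x closure_subset by (auto simp: S_def)
      then obtain y where y: "y \<in> Y" "dist x y < r y" using Y(3) by (auto simp: dist_commute)
      have xy: "x \<noteq> y" using y x by auto
      show ?thesis
      proof (cases "dist x y < t y")
        case True
        have "\<bar>V x\<bar> \<le> \<eta> / norm (x - y) powr s" using t(2)[OF y(1) x(1) xy True] xy by (intro bound) auto
        also have "\<dots> \<le> (\<Sum>y\<in>Y. \<eta> / norm (x - y) powr s)"
          using y(1) Y(2) \<eta> by (intro member_le_sum) auto
        finally show ?thesis using nn by linarith
      next
        case far: False
        have "\<bar>V x\<bar> \<le> 1 / norm (x - y) powr s" using r(2)[OF _ x(1) xy y(2)] y(1) Y(1) xy by (intro bound) auto
        also have "\<dots> \<le> 1 / t y powr s"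
          using far t(1)[OF y(1)] s by (intro divide_left_mono powr_mono2 mult_pos_pos) (auto simp: dist_norm)
        also have "\<dots> \<le> M" unfolding M_def using y(1) Y(2) by (intro member_le_sum) auto
        finally show ?thesis using nn False by simp
      qed
    qed
    then show "\<bar>V x\<bar> \<le> \<delta> / norm x powr s
       + (\<Sum>y\<in>Y. \<delta> / (real (card Y) + 1) / norm (x - y) powr s) + M * indicator (cball 0 R) x"
      by (simp add: \<eta>_def)
  qed (use Y R M in auto)
qed

text \<open>By dominated convergence the integrable power has small integral over the set where
  \<bar>V\<bar> or the norm of \<open>x\<close> exceeds a large level. Cutting in height and in
  space at once leaves a bounded remainder living on a ball, which a local L^p norm can
  control.\<close>

lemma in_Lp_tail:
  fixes V :: "'a::euclidean_space \<Rightarrow> real"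
  assumes V: "in_Lp q \<Omega> V" and \<delta>: "0 < \<delta>"
  obtains M A where "0 < M" "A \<subseteq> \<Omega>"
    "\<And>x. x \<in> \<Omega> \<Longrightarrow> x \<notin> A \<Longrightarrow> \<bar>V x\<bar> \<le> M \<and> norm x \<le> M"
    "(\<lambda>x. indicator A x * \<bar>V x\<bar> powr q) \<in> borel_measurable lebesgue"
    "(\<integral>\<^sup>+x. ennreal (indicator A x * \<bar>V x\<bar> powr q) \<partial>lebesgue) \<le> ennreal \<delta>"
proof -
  define W where "W x = indicator \<Omega> x * V x" for x
  have [measurable]: "W \<in> borel_measurable lebesgue"
    using V by (simp add: in_Lp_def set_borel_measurable_def W_def[abs_def])
  define I where "I x = indicator \<Omega> x * \<bar>V x\<bar> powr q" for x
  have intI: "integrable lebesgue I"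
    using V by (simp add: in_Lp_def set_integrable_def I_def[abs_def])
  then have [measurable]: "I \<in> borel_measurable lebesgue" by auto
  have [measurable]: "(\<lambda>x::'a. norm x) \<in> borel_measurable lebesgue"
    by (rule borel_lebesgue_measurable) measurable
  define f where "f k x = (if real k < \<bar>W x\<bar> \<or> real k < norm x then ennreal (I x) else 0)" for k x
  have [measurable]: "f k \<in> borel_measurable lebesgue" for k unfolding f_def by measurable
  have "(\<lambda>k. \<integral>\<^sup>+x. f k x \<partial>lebesgue) \<longlonglongrightarrow> (\<integral>\<^sup>+x. 0 \<partial>(lebesgue :: 'a measure))"
  proof (rule nn_integral_dominated_convergence[where w = "\<lambda>x. ennreal (I x)"])
    show "(\<integral>\<^sup>+x. ennreal (I x) \<partial>lebesgue) < \<infinity>"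
      using integrableD(2)[OF intI] by (simp add: I_def abs_mult less_top[symmetric])
    show "AE x in lebesgue. (\<lambda>k. f k x) \<longlonglongrightarrow> 0"
    proof (intro AE_I2 tendsto_eventually)
      fix x
      obtain N :: nat where "max \<bar>W x\<bar> (norm x) \<le> real N" using real_arch_simple by blast
      then show "\<forall>\<^sub>F k in sequentially. f k x = 0"
        by (auto simp: f_def eventually_sequentially intro!: exI[of _ N])
    qed
  qed (auto simp: f_def)
  then have "\<forall>\<^sub>F k in sequentially. (\<integral>\<^sup>+x. f k x \<partial>lebesgue) < ennreal \<delta>"
    using \<delta> by (intro order_tendstoD(2)) auto
  then obtain N where N: "\<And>k. k \<ge> N \<Longrightarrow> (\<integral>\<^sup>+x. f k x \<partial>lebesgue) < ennreal \<delta>"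
    by (auto simp: eventually_sequentially)
  \<comment> \<open>At least 1, so that the level \<open>M\<close> is positive.\<close>
  define k where "k = max N 1"
  define A where "A = {x. x \<in> \<Omega> \<and> (real k < \<bar>V x\<bar> \<or> real k < norm x)}"
  have k: "(\<integral>\<^sup>+x. f k x \<partial>lebesgue) < ennreal \<delta>" "0 < k" using N by (auto simp: k_def)
  have fA: "f k x = ennreal (indicator A x * \<bar>V x\<bar> powr q)" for x
    by (auto simp: f_def A_def I_def W_def indicator_def)
  have eq: "indicator A x * \<bar>V x\<bar> powr q = (if real k < \<bar>W x\<bar> \<or> real k < norm x then I x else 0)" for x
    by (auto simp: A_def I_def W_def indicator_def)
  have meas: "(\<lambda>x. indicator A x * \<bar>V x\<bar> powr q) \<in> borel_measurable lebesgue" unfolding eq by measurable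
  show thesis
  proof (rule that)
    show "0 < real k" using k by simp
    show "A \<subseteq> \<Omega>" by (auto simp: A_def)
    show "(\<lambda>x. indicator A x * \<bar>V x\<bar> powr q) \<in> borel_measurable lebesgue" by (rule meas)
    show "(\<integral>\<^sup>+x. ennreal (indicator A x * \<bar>V x\<bar> powr q) \<partial>lebesgue) \<le> ennreal \<delta>"
      using k(1) by (simp add: fA less_imp_le)
    show "\<bar>V x\<bar> \<le> real k \<and> norm x \<le> real k" if "x \<in> \<Omega>" "x \<notin> A" for x
      using that by (auto simp: A_def)
  qed
qed

text \<open>Young's inequality with exponents \<open>1 / (1 - \<theta>)\<close> and
  \<open>1 / \<theta>\<close> for the factors \<open>s * a\<close> and \<open>t / s\<close>; the
  parameter \<open>s\<close> decides which term becomes small. The prefactors, being at most 1, are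
  dropped.\<close>

lemma young_scaled:
  fixes a t s \<theta> :: real
  assumes "0 \<le> a" "0 \<le> t" "0 < s" "0 < \<theta>" "\<theta> < 1"
  shows "a * t \<le> s powr (1 / (1 - \<theta>)) * a powr (1 / (1 - \<theta>)) + s powr (- 1 / \<theta>) * t powr (1 / \<theta>)"
proof -
  have "a * t = (s * a) * (t / s)" using assms by simp
  also have "\<dots> \<le> (s * a) powr (1 / (1 - \<theta>)) / (1 / (1 - \<theta>)) + (t / s) powr (1 / \<theta>) / (1 / \<theta>)"
    using assms by (intro Youngs_inequality) auto
  also have "\<dots> \<le> (s * a) powr (1 / (1 - \<theta>)) + (t / s) powr (1 / \<theta>)"
    using assms by (intro add_mono) (auto intro!: mult_left_le)
  also have "\<dots> = s powr (1 / (1 - \<theta>)) * a powr (1 / (1 - \<theta>)) + s powr (- 1 / \<theta>) * t powr (1 / \<theta>)"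
    using assms by (simp add: powr_mult powr_divide powr_minus divide_inverse inverse_powr mult.commute)
  finally show ?thesis .
qed

context frac_hardy
begin

text \<open>Four contributions are kept below \<open>\<epsilon> / 4\<close>: the two Young terms for
  the large part of \<open>V1\<close>, of which one is a Sobolev integral, and the Hardy terms of
  \<open>V2\<close>, centred at 0 (which also covers infinity) and at the finitely many points of
  \<open>Y\<close>. Hence sequences of bounded energy that vanish locally in L^p do so in the
  weighted sense.\<close>

lemma positive_potential_bound:
  fixes V V1 V2 :: "'a \<Rightarrow> real"
  assumes V: "AE x in lebesgue. x \<in> \<Omega> \<longrightarrow> max (V x) 0 = V1 x + V2 x"
    and V1: "in_Lp (real DIM('a) / (p * \<alpha>)) \<Omega> V1"
    and V2: "\<forall>y \<in> closure \<Omega>. ((\<lambda>x. norm (x - y) powr (p * \<alpha>) * V2 x) \<longlongrightarrow> 0) (at y within \<Omega>)"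
      "((\<lambda>x. norm x powr (p * \<alpha>) * V2 x) \<longlongrightarrow> 0) (inf at_infinity (principal \<Omega>))"
    and \<epsilon>: "0 < \<epsilon>" and K: "0 \<le> K"
  obtains M R where "0 \<le> M"
    "\<And>w. w \<in> X \<Longrightarrow> gag p \<alpha> w \<le> ennreal K \<Longrightarrow>
      (\<integral>\<^sup>+x. ennreal (indicator \<Omega> x * (max (V x) 0 * \<bar>w x\<bar> powr p)) \<partial>lebesgue)
        \<le> ennreal \<epsilon> + ennreal M * pint p lborel (\<lambda>x. indicat_real (cball 0 R) x * w x)"
proof -
  define \<theta> where "\<theta> = 1 - p * \<alpha> / real DIM('a)"
  have \<theta>: "0 < \<theta>" "\<theta> < 1" using n p1 \<alpha> by (auto simp: \<theta>_def)
  have q: "real DIM('a) / (p * \<alpha>) = 1 / (1 - \<theta>)" by (simp add: \<theta>_def)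
  obtain S where S: "0 < S" "\<And>u K. u \<in> X \<Longrightarrow> 0 \<le> K \<Longrightarrow> gag p \<alpha> u \<le> ennreal K \<Longrightarrow>
       pint (p / \<theta>) lborel u \<le> ennreal ((S * (K + 1)) powr (1 / \<theta>))"
    using sobolev_X unfolding \<theta>_def by metis
  define N where "N = (S * (K + 1)) powr (1 / \<theta>)"
  have N0: "0 < N" using S K by (simp add: N_def)
  \<comment> \<open>The order of the choices matters: \<open>s\<close> makes the factor times the
    Sobolev bound \<open>N\<close> equal to \<open>\<epsilon> / 4\<close>, and only afterwards is
    the tail of \<open>V1\<close> made small relative to the power of \<open>s\<close> in front of
    it.\<close>
  define s where "s = (4 * N / \<epsilon>) powr \<theta>"
  have s: "0 < s" using N0 \<epsilon> by (simp add: s_def)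
  have sN: "s powr (- 1 / \<theta>) * N = \<epsilon> / 4"
  proof -
    have "s powr (- 1 / \<theta>) = (4 * N / \<epsilon>) powr (- 1)" using \<theta> by (simp add: s_def powr_powr)
    also have "\<dots> = \<epsilon> / (4 * N)" using N0 \<epsilon> by (simp add: powr_minus_divide)
    finally show ?thesis using N0 by simp
  qed
  define \<delta>1 where "\<delta>1 = \<epsilon> / (4 * s powr (1 / (1 - \<theta>)))"
  have \<delta>1: "0 < \<delta>1" "s powr (1 / (1 - \<theta>)) * \<delta>1 = \<epsilon> / 4" using s \<epsilon> by (auto simp: \<delta>1_def)
  obtain M1 A where A: "0 < M1" "A \<subseteq> \<Omega>"
    "\<And>x. x \<in> \<Omega> \<Longrightarrow> x \<notin> A \<Longrightarrow> \<bar>V1 x\<bar> \<le> M1 \<and> norm x \<le> M1"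
    "(\<lambda>x. indicator A x * \<bar>V1 x\<bar> powr (1 / (1 - \<theta>))) \<in> borel_measurable lebesgue"
    "(\<integral>\<^sup>+x. ennreal (indicator A x * \<bar>V1 x\<bar> powr (1 / (1 - \<theta>))) \<partial>lebesgue) \<le> ennreal \<delta>1"
    using in_Lp_tail[OF V1[unfolded q] \<delta>1(1)] by blast
  \<comment> \<open>Hardy integrals are at most \<open>K / C\<close> for every centre;
    \<open>K + 1\<close> allows \<open>K = 0\<close>.\<close>
  define \<delta> where "\<delta> = \<epsilon> * C / (4 * (K + 1))"
  have \<delta>: "0 < \<delta>" "\<delta> * (K / C) \<le> \<epsilon> / 4" using \<epsilon> C K by (auto simp: \<delta>_def field_simps)
  have s0: "0 < p * \<alpha>" using p1 \<alpha> by simp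
  obtain Y R2 M2 where Y: "finite Y" "0 < R2" "0 \<le> M2"
    "\<And>x. x \<in> \<Omega> \<Longrightarrow> x \<notin> Y \<Longrightarrow> \<bar>V2 x\<bar> \<le> \<delta> / norm x powr (p * \<alpha>)
       + (\<Sum>y\<in>Y. \<delta> / (real (card Y) + 1) / norm (x - y) powr (p * \<alpha>)) + M2 * indicator (cball 0 R2) x"
    using singular_potential_bound[OF s0 \<delta>(1), of \<Omega> V2] V2 by blast
  define \<eta> where "\<eta> = \<delta> / (real (card Y) + 1)"
  have \<eta>: "0 < \<eta>" "real (card Y) * \<eta> \<le> \<delta>" using \<delta> by (auto simp: \<eta>_def field_simps add_nonneg_pos)
  define M where "M = M1 + M2"
  define R where "R = max M1 R2"
  have M: "0 \<le> M" using A Y by (simp add: M_def)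
  show thesis
  proof (rule that[OF M])
    fix w assume w: "w \<in> X" and wK: "gag p \<alpha> w \<le> ennreal K"
    note wb[measurable] = X_borel[OF w]
    \<comment> \<open>\<open>a\<close> and \<open>b\<close> are the two Young coefficients. Of the
      majorants below, \<open>F1\<close> and \<open>F2\<close> belong to the large part of
      \<open>V1\<close>, \<open>F3\<close> and \<open>F4\<close> to the singularities of
      \<open>V2\<close>, and \<open>F5\<close> to the bounded remainders of both.\<close>
    define a where "a = s powr (1 / (1 - \<theta>))"
    define b where "b = s powr (- 1 / \<theta>)"
    have ab: "0 \<le> a" "0 \<le> b" by (auto simp: a_def b_def)
    define F1 where "F1 x = ennreal a * ennreal (indicator A x * \<bar>V1 x\<bar> powr (1 / (1 - \<theta>)))" for x
    define F2 where "F2 x = ennreal b * ennreal (\<bar>w x\<bar> powr (p / \<theta>))" for x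
    define F3 where "F3 x = ennreal \<delta> * ennreal (\<bar>hq \<alpha> 0 w x\<bar> powr p)" for x
    define F4 where "F4 x = (\<Sum>y\<in>Y. ennreal \<eta> * ennreal (\<bar>hq \<alpha> y w x\<bar> powr p))" for x
    define F5 where "F5 x = ennreal M * ennreal (\<bar>indicat_real (cball 0 R) x * w x\<bar> powr p)" for x
    have bm: "F2 \<in> borel_measurable borel" "F3 \<in> borel_measurable borel" "F4 \<in> borel_measurable borel"
      "F5 \<in> borel_measurable borel"
      unfolding F2_def F3_def F4_def F5_def by measurable
    note [measurable] = bm[THEN borel_lebesgue_measurable] A(4)
    have [measurable]: "F1 \<in> borel_measurable lebesgue" unfolding F1_def by measurable
    have "AE x in lborel. x \<notin> Y" using Y(1) by (intro AE_not_in finite_imp_null_set_lborel)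
    then have "AE x in lebesgue. x \<notin> Y" by (rule AE_completion)
    with V have le: "AE x in lebesgue. ennreal (indicator \<Omega> x * (max (V x) 0 * \<bar>w x\<bar> powr p))
        \<le> F1 x + F2 x + F3 x + F4 x + F5 x"
    proof eventually_elim
      case (elim x)
      show ?case
      proof (cases "x \<in> \<Omega>")
        case True
        let ?t = "\<bar>w x\<bar> powr p"
        have t: "0 \<le> ?t" by simp
        have 1: "\<bar>V1 x\<bar> * ?t \<le> a * (indicator A x * \<bar>V1 x\<bar> powr (1 / (1 - \<theta>))) + b * \<bar>w x\<bar> powr (p / \<theta>)
            + M1 * (indicat_real (cball 0 R) x * ?t)"
        proof (cases "x \<in> A")
          case True
          have "\<bar>V1 x\<bar> * ?t \<le> a * \<bar>V1 x\<bar> powr (1 / (1 - \<theta>)) + b * ?t powr (1 / \<theta>)"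
            unfolding a_def b_def using s \<theta> by (intro young_scaled) auto
          then show ?thesis using True A(1) t by (simp add: powr_powr add_increasing2)
        next
          case False
          have "\<bar>V1 x\<bar> * ?t \<le> M1 * (indicat_real (cball 0 R) x * ?t)"
            using A(3)[OF \<open>x \<in> \<Omega>\<close> False] by (auto simp: R_def intro!: mult_right_mono)
          then show ?thesis using False ab by (simp add: add_increasing)
        qed
        have "\<bar>V2 x\<bar> * ?t \<le> (\<delta> / norm x powr (p * \<alpha>)
            + (\<Sum>y\<in>Y. \<eta> / norm (x - y) powr (p * \<alpha>)) + M2 * indicator (cball 0 R2) x) * ?t"
          using Y(4)[OF True] elim by (intro mult_right_mono) (auto simp: \<eta>_def)
        also have "\<dots> = \<delta> * \<bar>hq \<alpha> 0 w x\<bar> powr p + (\<Sum>y\<in>Y. \<eta> * \<bar>hq \<alpha> y w x\<bar> powr p)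
            + M2 * (indicator (cball 0 R2) x * ?t)"
          by (simp add: abs_hq_powr distrib_right sum_distrib_right mult.assoc)
        also have "\<dots> \<le> \<delta> * \<bar>hq \<alpha> 0 w x\<bar> powr p + (\<Sum>y\<in>Y. \<eta> * \<bar>hq \<alpha> y w x\<bar> powr p)
            + M2 * (indicat_real (cball 0 R) x * ?t)"
          using Y(3) by (intro add_left_mono mult_left_mono mult_right_mono) (auto simp: indicator_def R_def)
        finally have 2: "\<bar>V2 x\<bar> * ?t \<le> \<delta> * \<bar>hq \<alpha> 0 w x\<bar> powr p + (\<Sum>y\<in>Y. \<eta> * \<bar>hq \<alpha> y w x\<bar> powr p)
            + M2 * (indicat_real (cball 0 R) x * ?t)" .
        have ind: "indicat_real (cball 0 R) x * ?t = \<bar>indicat_real (cball 0 R) x * w x\<bar> powr p"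
          using p1 by (simp add: indicator_def)
        have "max (V x) 0 * ?t \<le> (\<bar>V1 x\<bar> + \<bar>V2 x\<bar>) * ?t"
          using elim True by (intro mult_right_mono) auto
        also have "\<dots> \<le> a * (indicator A x * \<bar>V1 x\<bar> powr (1 / (1 - \<theta>))) + b * \<bar>w x\<bar> powr (p / \<theta>)
            + \<delta> * \<bar>hq \<alpha> 0 w x\<bar> powr p + (\<Sum>y\<in>Y. \<eta> * \<bar>hq \<alpha> y w x\<bar> powr p)
            + M * \<bar>indicat_real (cball 0 R) x * w x\<bar> powr p"
          using 1 2 unfolding distrib_right M_def ind[symmetric] by linarith
        finally have "ennreal (indicator \<Omega> x * (max (V x) 0 * ?t)) \<le> ennreal (a * (indicator A x * \<bar>V1 x\<bar> powr (1 / (1 - \<theta>))) + b * \<bar>w x\<bar> powr (p / \<theta>)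
            + \<delta> * \<bar>hq \<alpha> 0 w x\<bar> powr p + (\<Sum>y\<in>Y. \<eta> * \<bar>hq \<alpha> y w x\<bar> powr p)
            + M * \<bar>indicat_real (cball 0 R) x * w x\<bar> powr p)"
          using True by (intro ennreal_leI) simp
        also have "\<dots> = F1 x + F2 x + F3 x + F4 x + F5 x"
        proof -
          have nn: "0 \<le> a * (indicator A x * \<bar>V1 x\<bar> powr (1 / (1 - \<theta>)))" "0 \<le> b * \<bar>w x\<bar> powr (p / \<theta>)"
            "0 \<le> \<delta> * \<bar>hq \<alpha> 0 w x\<bar> powr p" "0 \<le> (\<Sum>y\<in>Y. \<eta> * \<bar>hq \<alpha> y w x\<bar> powr p)"
            "0 \<le> M * \<bar>indicat_real (cball 0 R) x * w x\<bar> powr p"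
            using ab \<delta> \<eta> M by (auto intro!: sum_nonneg)
          have "F1 x = ennreal (a * (indicator A x * \<bar>V1 x\<bar> powr (1 / (1 - \<theta>))))"
            "F2 x = ennreal (b * \<bar>w x\<bar> powr (p / \<theta>))" "F3 x = ennreal (\<delta> * \<bar>hq \<alpha> 0 w x\<bar> powr p)"
            "F5 x = ennreal (M * \<bar>indicat_real (cball 0 R) x * w x\<bar> powr p)"
            unfolding F1_def F2_def F3_def F5_def using ab \<delta> M by (auto simp: ennreal_mult)
          moreover have "F4 x = ennreal (\<Sum>y\<in>Y. \<eta> * \<bar>hq \<alpha> y w x\<bar> powr p)"
            unfolding F4_def using \<eta> by (subst sum_ennreal[symmetric]) (auto simp: ennreal_mult)
          ultimately show ?thesis
            by (simp only: ennreal_plus nn add_nonneg_nonneg)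
        qed
        finally show ?thesis .
      qed simp
    qed
    have H: "hardy p \<alpha> c w \<le> ennreal (K / C)" for c by (rule hardy_X_le[OF w wK])
    have "(\<integral>\<^sup>+x. ennreal (indicator \<Omega> x * (max (V x) 0 * \<bar>w x\<bar> powr p)) \<partial>lebesgue)
        \<le> (\<integral>\<^sup>+x. F1 x + F2 x + F3 x + F4 x + F5 x \<partial>lebesgue)"
      using le by (rule nn_integral_mono_AE)
    also have "\<dots> = (\<integral>\<^sup>+x. F1 x \<partial>lebesgue) + (\<integral>\<^sup>+x. F2 x \<partial>lebesgue) + (\<integral>\<^sup>+x. F3 x \<partial>lebesgue)
        + (\<integral>\<^sup>+x. F4 x \<partial>lebesgue) + (\<integral>\<^sup>+x. F5 x \<partial>lebesgue)"
      by (simp add: nn_integral_add)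
    also have "(\<integral>\<^sup>+x. F5 x \<partial>lebesgue) = ennreal M * pint p lborel (\<lambda>x. indicat_real (cball 0 R) x * w x)"
      unfolding F5_def nn_integral_completion pint_def by (rule nn_integral_cmult) measurable
    also have "(\<integral>\<^sup>+x. F1 x \<partial>lebesgue) + (\<integral>\<^sup>+x. F2 x \<partial>lebesgue) + (\<integral>\<^sup>+x. F3 x \<partial>lebesgue) + (\<integral>\<^sup>+x. F4 x \<partial>lebesgue)
        \<le> ennreal (\<epsilon> / 4) + ennreal (\<epsilon> / 4) + ennreal (\<epsilon> / 4) + ennreal (\<epsilon> / 4)"
    proof (intro add_mono)
      have "(\<integral>\<^sup>+x. F1 x \<partial>lebesgue) = ennreal a * (\<integral>\<^sup>+x. ennreal (indicator A x * \<bar>V1 x\<bar> powr (1 / (1 - \<theta>))) \<partial>lebesgue)"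
        unfolding F1_def by (rule nn_integral_cmult) measurable
      also have "\<dots> \<le> ennreal a * ennreal \<delta>1" by (intro mult_left_mono A(5)) auto
      also have "\<dots> = ennreal (\<epsilon> / 4)"
        using ab \<delta>1 by (subst ennreal_mult[symmetric]) (auto simp: a_def)
      finally show "(\<integral>\<^sup>+x. F1 x \<partial>lebesgue) \<le> ennreal (\<epsilon> / 4)" .
      have "(\<integral>\<^sup>+x. F2 x \<partial>lebesgue) = ennreal b * pint (p / \<theta>) lborel w"
        unfolding F2_def nn_integral_completion pint_def by (rule nn_integral_cmult) measurable
      also have "\<dots> \<le> ennreal b * ennreal N"
        unfolding N_def by (intro mult_left_mono S(2)[OF w K wK]) auto
      also have "\<dots> = ennreal (\<epsilon> / 4)"
        using ab sN N0 by (subst ennreal_mult[symmetric]) (auto simp: b_def)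
      finally show "(\<integral>\<^sup>+x. F2 x \<partial>lebesgue) \<le> ennreal (\<epsilon> / 4)" .
      have "(\<integral>\<^sup>+x. F3 x \<partial>lebesgue) = ennreal \<delta> * hardy p \<alpha> 0 w"
        unfolding F3_def nn_integral_completion hardy_def pint_def by (rule nn_integral_cmult) measurable
      also have "\<dots> \<le> ennreal \<delta> * ennreal (K / C)" by (intro mult_left_mono H) auto
      also have "\<dots> = ennreal (\<delta> * (K / C))"
        using \<delta> K C by (subst ennreal_mult[symmetric]) auto
      also have "\<dots> \<le> ennreal (\<epsilon> / 4)" by (intro ennreal_leI \<delta>)
      finally show "(\<integral>\<^sup>+x. F3 x \<partial>lebesgue) \<le> ennreal (\<epsilon> / 4)" .
      have "(\<integral>\<^sup>+x. F4 x \<partial>lebesgue) = (\<Sum>y\<in>Y. ennreal \<eta> * hardy p \<alpha> y w)"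
        unfolding F4_def nn_integral_completion hardy_def pint_def
        by (subst nn_integral_sum) (auto simp: nn_integral_cmult)
      also have "\<dots> \<le> (\<Sum>y\<in>Y. ennreal \<eta> * ennreal (K / C))" by (intro sum_mono mult_left_mono H) auto
      also have "\<dots> = ennreal (real (card Y) * \<eta> * (K / C))"
      proof -
        have "ennreal \<eta> * ennreal (K / C) = ennreal (\<eta> * (K / C))"
          using \<eta> K C by (subst ennreal_mult) auto
        then have "(\<Sum>y\<in>Y. ennreal \<eta> * ennreal (K / C)) = ennreal (\<Sum>y\<in>Y. \<eta> * (K / C))"
          using \<eta> K C by (subst sum_ennreal[symmetric]) auto
        then show ?thesis by (simp add: mult.assoc)
      qed
      also have "\<dots> \<le> ennreal (\<epsilon> / 4)"
        by (intro ennreal_leI order_trans[OF mult_right_mono[OF \<eta>(2)] \<delta>(2)]) (use K C in auto)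
      finally show "(\<integral>\<^sup>+x. F4 x \<partial>lebesgue) \<le> ennreal (\<epsilon> / 4)" .
    qed
    also have "ennreal (\<epsilon> / 4) + ennreal (\<epsilon> / 4) + ennreal (\<epsilon> / 4) + ennreal (\<epsilon> / 4) = ennreal \<epsilon>"
      using \<epsilon> by (simp flip: ennreal_plus)
    finally show "(\<integral>\<^sup>+x. ennreal (indicator \<Omega> x * (max (V x) 0 * \<bar>w x\<bar> powr p)) \<partial>lebesgue)
        \<le> ennreal \<epsilon> + ennreal M * pint p lborel (\<lambda>x. indicat_real (cball 0 R) x * w x)"
      by (simp add: add_right_mono)
  qed
qed

end

section \<open>Test functions charging the positive part of the potential\<close>

text \<open>The set of positivity is not null, so it meets some compact set of an exhaustion in
  positive measure. Inner regularity gives a closed subset that is still not null, and there a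
  positive function has positive integral.\<close>

lemma locally_integrable_positive_compact:
  fixes V :: "'a::euclidean_space \<Rightarrow> real"
  assumes loc: "locally_integrable \<Omega> V" and op: "open \<Omega>"
    and ne: "\<not> (AE x in lebesgue. x \<in> \<Omega> \<longrightarrow> max (V x) 0 = 0)"
  obtains T where "compact T" "T \<subseteq> \<Omega>" "0 < (LINT x:T|lebesgue. V x)"
proof -
  obtain K where K: "\<And>n::nat. compact (K n)" "\<And>n. K n \<subseteq> \<Omega>" "\<Union>(range K) = \<Omega>"
    using open_Union_compact_subsets[OF op] by metis
  define E where "E n = {x \<in> K n. 0 < V x}" for n
  have E_sets: "E n \<in> sets lebesgue" for n
  proof -
    have "set_integrable lebesgue (K n) V" using loc K by (simp add: locally_integrable_def)
    then have [measurable]: "(\<lambda>x. indicator (K n) x *\<^sub>R V x) \<in> borel_measurable lebesgue"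
      unfolding set_integrable_def by auto
    have "{x \<in> space lebesgue. 0 < indicator (K n) x *\<^sub>R V x} \<in> sets lebesgue" by measurable
    moreover have "{x \<in> space lebesgue. 0 < indicator (K n) x *\<^sub>R V x} = E n"
      by (auto simp: E_def indicator_def)
    ultimately show ?thesis by simp
  qed
  have "\<exists>n. E n \<notin> null_sets lebesgue"
  proof (rule ccontr)
    assume "\<not> ?thesis"
    then have "(\<Union>n. E n) \<in> null_sets lebesgue" by (intro null_sets_UN) auto
    then have "AE x in lebesgue. x \<notin> (\<Union>n. E n)" by (rule AE_not_in)
    then have "AE x in lebesgue. x \<in> \<Omega> \<longrightarrow> max (V x) 0 = 0"
      by eventually_elim (use K(3) in \<open>auto simp: E_def max_def\<close>)
    then show False using ne by simp
  qed
  then obtain n where n: "E n \<notin> null_sets lebesgue" by blast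
  have bE: "bounded (E n)" by (rule bounded_subset[OF compact_imp_bounded[OF K(1)[of n]]]) (auto simp: E_def)
  have "E n \<in> lmeasurable" using bE E_sets by (rule bounded_set_imp_lmeasurable)
  then have em: "emeasure lebesgue (E n) = ennreal (measure lebesgue (E n))"
    by (intro emeasure_eq_ennreal_measure) (auto simp: fmeasurable_def)
  have "0 < measure lebesgue (E n)"
    using n E_sets em by (metis ennreal_0 measure_nonneg null_setsI order_le_less)
  \<comment> \<open>\<open>T\<close> misses less than the full measure of \<open>E n\<close>, so it
    cannot be null.\<close>
  then obtain T where T: "closed T" "T \<subseteq> E n" "emeasure lebesgue (E n - T) < ennreal (measure lebesgue (E n))"
    using sets_lebesgue_inner_closed[OF E_sets] by metis
  have cT: "compact T" using T bE by (meson bounded_subset compact_eq_bounded_closed)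
  have T\<Omega>: "T \<subseteq> \<Omega>" using T(2) K(2) by (auto simp: E_def)
  have Ts: "T \<in> sets lebesgue" using T(1) by auto
  have Tnn: "T \<notin> null_sets lebesgue"
  proof
    assume "T \<in> null_sets lebesgue"
    then have "emeasure lebesgue T = 0" by auto
    moreover have "emeasure lebesgue (E n) \<le> emeasure lebesgue T + emeasure lebesgue (E n - T)"
    proof -
      have "emeasure lebesgue (E n) = emeasure lebesgue (T \<union> (E n - T))" using T(2) by (intro arg_cong[where f = "emeasure lebesgue"]) auto
      also have "\<dots> \<le> emeasure lebesgue T + emeasure lebesgue (E n - T)"
        using Ts E_sets by (intro emeasure_subadditive) auto
      finally show ?thesis .
    qed
    ultimately show False using T(3) em by simp
  qed
  have int: "integrable lebesgue (\<lambda>x. indicator T x *\<^sub>R V x)"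
    using loc cT T\<Omega> by (simp add: locally_integrable_def set_integrable_def)
  have nonneg: "0 \<le> indicator T x *\<^sub>R V x" for x using T(2) by (auto simp: indicator_def E_def)
  have "0 \<le> (LINT x:T|lebesgue. V x)"
    unfolding set_lebesgue_integral_def by (intro integral_nonneg_AE AE_I2 nonneg)
  moreover have "(LINT x:T|lebesgue. V x) \<noteq> 0"
  proof
    assume "(LINT x:T|lebesgue. V x) = 0"
    moreover have "AE x in lebesgue. 0 \<le> indicator T x *\<^sub>R V x" by (intro AE_I2 nonneg)
    ultimately have "AE x in lebesgue. indicator T x *\<^sub>R V x = 0"
      unfolding set_lebesgue_integral_def using integral_nonneg_eq_0_iff_AE[OF int] by blast
    then have "AE x in lebesgue. x \<notin> T"
      by eventually_elim (use T(2) in \<open>auto simp: indicator_def E_def split: if_splits\<close>)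
    then show False using Tnn Ts by (simp add: AE_iff_null_sets)
  qed
  ultimately show thesis using cT T\<Omega> that by (metis order_le_less)
qed

text \<open>All factors lie in [0, 1], and some factor is below 1 exactly on the union of the balls,
  so powers of the product tend to 0 there and stay 1 elsewhere.\<close>

lemma tendsto_indicator_of_bumps:
  fixes F :: "'a::euclidean_space set"
  assumes F: "finite F" and r: "0 < r"
  defines "P \<equiv> \<lambda>x. \<Prod>c\<in>F. (1 - bump c r x)"
  shows "0 \<le> P x" "P x \<le> 1" "x \<notin> (\<Union>c\<in>F. ball c r) \<Longrightarrow> P x = 1"
    "(\<lambda>m. 1 - P x ^ Suc m) \<longlonglongrightarrow> indicat_real (\<Union>c\<in>F. ball c r) x"
proof -
  have b: "0 \<le> 1 - bump c r x" "1 - bump c r x \<le> 1" for c x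
    using bump_bounds[of c r x] by auto
  show P0: "0 \<le> P x" unfolding P_def by (intro prod_nonneg ballI b)
  show "P x \<le> 1" unfolding P_def by (intro prod_le_1) (use b in auto)
  show off: "P x = 1" if "x \<notin> (\<Union>c\<in>F. ball c r)"
  proof -
    have "bump c r x = 0" if "c \<in> F" for c
      using bump_pos_iff[of r c x] bump_bounds(1)[of c r x] r that \<open>x \<notin> _\<close> by fastforce
    then show ?thesis by (simp add: P_def)
  qed
  have on: "P x < 1" if x: "x \<in> (\<Union>c\<in>F. ball c r)"
  proof -
    obtain c where c: "c \<in> F" "x \<in> ball c r" using x by auto
    have "P x = (1 - bump c r x) * (\<Prod>c\<in>F - {c}. (1 - bump c r x))"
      unfolding P_def using F c(1) by (rule prod.remove)
    also have "\<dots> \<le> (1 - bump c r x) * 1"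
      by (intro mult_left_mono prod_le_1 b) (use b in auto)
    also have "\<dots> < 1" using bump_pos_iff[of r c x] c(2) r by simp
    finally show ?thesis .
  qed
  show "(\<lambda>m. 1 - P x ^ Suc m) \<longlonglongrightarrow> indicat_real (\<Union>c\<in>F. ball c r) x"
  proof (cases "x \<in> (\<Union>c\<in>F. ball c r)")
    case True
    have "(\<lambda>m. P x ^ m) \<longlonglongrightarrow> 0" using P0 on[OF True] by (intro LIMSEQ_power_zero) auto
    from tendsto_diff[OF tendsto_const LIMSEQ_Suc[OF this], of 1]
    have "(\<lambda>m. 1 - P x ^ Suc m) \<longlonglongrightarrow> 1 - 0" .
    then show ?thesis using True by simp
  next
    case False
    then show ?thesis using off by simp
  qed
qed

text \<open>The indicator of a compact set is the limit of indicators of finite unions of balls,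
  and these are limits of the smooth functions \<open>1 - (\<Prod>c. 1 - bump c) ^ m\<close>.\<close>

lemma exists_positive_test_function:
  fixes V :: "'a::euclidean_space \<Rightarrow> real"
  assumes p: "0 < p" and loc: "locally_integrable \<Omega> V" and op: "open \<Omega>"
    and ne: "\<not> (AE x in lebesgue. x \<in> \<Omega> \<longrightarrow> max (V x) 0 = 0)"
  obtains \<phi> where "\<phi> \<in> test_functions \<Omega>" "set_integrable lebesgue \<Omega> (\<lambda>x. V x * \<bar>\<phi> x\<bar> powr p)"
    "0 < (LINT x:\<Omega>|lebesgue. V x * \<bar>\<phi> x\<bar> powr p)"
proof -
  obtain T where T: "compact T" "T \<subseteq> \<Omega>" "0 < (LINT x:T|lebesgue. V x)"
    using locally_integrable_positive_compact[OF loc op ne] by blast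
  have Tne: "T \<noteq> {}" using T(3) by (auto simp: set_lebesgue_integral_def)
  obtain e where e: "0 < e" "(\<Union>x\<in>T. ball x e) \<subseteq> \<Omega>"
    using compact_subset_open_imp_ball_epsilon_subset[OF T(1) op T(2)] by blast
  \<comment> \<open>A compact neighbourhood of \<open>T\<close> inside \<Omega> that carries all
    approximating functions, so \<open>V\<close> restricted to it is an integrable majorant for both
    limits.\<close>
  define K where "K = {x. infdist x T \<le> e / 2}"
  have K: "compact K" unfolding K_def using e by (intro compact_infdist_le Tne T(1)) auto
  have K\<Omega>: "K \<subseteq> \<Omega>"
  proof
    fix x assume x: "x \<in> K"
    obtain y where "y \<in> T" "infdist x T = dist x y"
      using infdist_attains_inf[OF compact_imp_closed[OF T(1)] Tne] by blast
    then have "x \<in> ball y e" using x e(1) by (auto simp: K_def dist_commute)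
    then show "x \<in> \<Omega>" using e(2) \<open>y \<in> T\<close> by blast
  qed
  define r where "r i = e / 2 / real (Suc i)" for i
  have r: "0 < r i" "r i \<le> e / 2" for i using e(1) by (auto simp: r_def divide_le_eq mult_left_le)
  have r0: "r \<longlonglongrightarrow> 0"
  proof -
    have "(\<lambda>i. e / 2 * (1 / real (Suc i))) \<longlonglongrightarrow> e / 2 * 0"
      by (rule tendsto_mult[OF tendsto_const LIMSEQ_Suc[OF lim_1_over_n]])
    then show ?thesis by (simp add: r_def[abs_def])
  qed
  have "\<exists>F\<subseteq>T. finite F \<and> T \<subseteq> (\<Union>c\<in>F. ball c (r i))" for i
  proof -
    have "T \<subseteq> (\<Union>c\<in>T. ball c (r i))" using r by force
    then obtain F where "F \<subseteq> T" "finite F" "T \<subseteq> (\<Union>c\<in>F. ball c (r i))"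
      using compactE_image[OF T(1), of T "\<lambda>c. ball c (r i)"] by auto
    then show ?thesis by blast
  qed
  then obtain F where F: "\<And>i. F i \<subseteq> T" "\<And>i. finite (F i)" "\<And>i. T \<subseteq> (\<Union>c\<in>F i. ball c (r i))" by metis
  define U where "U i = (\<Union>c\<in>F i. ball c (r i))" for i
  have U_dist: "infdist x T < r i" if xU: "x \<in> U i" for x i
  proof -
    obtain c where "c \<in> F i" "x \<in> ball c (r i)" using xU unfolding U_def by blast
    then show ?thesis using infdist_le[of c T x] F(1)[of i] by (fastforce simp: dist_commute)
  qed
  have UK: "U i \<subseteq> K" for i
  proof
    fix x assume "x \<in> U i"
    then show "x \<in> K" using U_dist[of x i] r(2)[of i] by (simp add: K_def)
  qed
  define P where "P i x = (\<Prod>c\<in>F i. (1 - bump c (r i) x))" for i x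
  have P: "0 \<le> P i x" "P i x \<le> 1" "x \<notin> U i \<Longrightarrow> P i x = 1"
    "(\<lambda>m. 1 - P i x ^ Suc m) \<longlonglongrightarrow> indicat_real (U i) x" for i x
    unfolding P_def U_def by (rule tendsto_indicator_of_bumps[OF F(2)[of i] r(1)[of i]]; assumption)+
  define \<phi> where "\<phi> i m x = 1 - P i x ^ Suc m" for i m x
  have \<phi>_off: "\<phi> i m x = 0" if "x \<notin> U i" for i m x using P(3)[OF that] by (simp add: \<phi>_def)
  have \<phi>_bd: "\<bar>\<phi> i m x\<bar> \<le> 1" for i m x
    using power_le_one[OF P(1,2), of i x "Suc m"] zero_le_power[OF P(1), of i x "Suc m"] by (simp add: \<phi>_def)
  have \<phi>_test: "\<phi> i m \<in> test_functions \<Omega>" for i m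
  proof (rule test_functionsI)
    show "Ck k (\<phi> i m)" for k
      unfolding \<phi>_def P_def by (intro Ck_diff Ck_const Ck_power Ck_prod bump_Ck)
    show "bounded {x. \<phi> i m x \<noteq> 0}"
      by (rule bounded_subset[OF compact_imp_bounded[OF K]]) (use \<phi>_off UK in blast)
    show "\<phi> i m x = 0" if "x \<notin> \<Omega>" for x using that \<phi>_off UK K\<Omega> by blast
  qed
  define g where "g x = indicator K x *\<^sub>R V x" for x
  have g: "integrable lebesgue g"
    using loc K K\<Omega> by (simp add: locally_integrable_def set_integrable_def g_def[abs_def])
  then have [measurable]: "g \<in> borel_measurable lebesgue" by auto
  have [measurable]: "\<phi> i m \<in> borel_measurable lebesgue" for i m
    by (intro borel_lebesgue_measurable test_functions_borel[OF \<phi>_test])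
  have U_borel: "U i \<in> sets lebesgue" for i
  proof -
    have "open (U i)" unfolding U_def by auto
    then show ?thesis by auto
  qed
  note [measurable] = U_borel
  have T_sets [measurable]: "T \<in> sets lebesgue" using compact_imp_closed[OF T(1)] by auto
  \<comment> \<open>The two limits are taken one after the other: first an \<open>i\<close> is fixed
    for which the integral over \<open>U i\<close> is positive, then a power
    \<open>m\<close>.\<close>
  have "(\<lambda>i. LINT x|lebesgue. g x * indicator (U i) x) \<longlonglongrightarrow> (LINT x|lebesgue. g x * indicator T x)"
  proof (rule integral_dominated_convergence[where w = "\<lambda>x. norm (g x)"])
    show "AE x in lebesgue. (\<lambda>i. g x * indicator (U i) x) \<longlonglongrightarrow> g x * indicator T x"
    proof (intro AE_I2 tendsto_mult_left tendsto_eventually)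
      fix x
      show "\<forall>\<^sub>F i in sequentially. indicat_real (U i) x = indicator T x"
      proof (cases "x \<in> T")
        case True
        then have "x \<in> U i" for i using F(3)[of i] unfolding U_def by blast
        then show ?thesis using True by simp
      next
        case False
        then have "0 < infdist x T"
          using infdist_pos_not_in_closed[OF compact_imp_closed[OF T(1)] Tne] by blast
        then have "\<forall>\<^sub>F i in sequentially. r i < infdist x T" by (intro order_tendstoD(2)[OF r0])
        then show ?thesis
        proof eventually_elim
          case (elim i)
          then have "x \<notin> U i" using U_dist[of x i] by auto
          then show ?case using False by simp
        qed
      qed
    qed
  qed (use g in \<open>auto simp: indicator_def\<close>)
  moreover have "(LINT x|lebesgue. g x * indicator T x) = (LINT x:T|lebesgue. V x)"
  proof -
    have "T \<subseteq> K" using e(1) by (auto simp: K_def)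
    then show ?thesis unfolding set_lebesgue_integral_def g_def
      by (intro Bochner_Integration.integral_cong) (auto simp: indicator_def)
  qed
  ultimately have "\<forall>\<^sub>F i in sequentially. 0 < (LINT x|lebesgue. g x * indicator (U i) x)"
    using T(3) by (intro order_tendstoD(1)) auto
  then obtain i where i: "0 < (LINT x|lebesgue. g x * indicator (U i) x)" by (auto dest: eventually_happens)
  have "(\<lambda>m. LINT x|lebesgue. g x * \<bar>\<phi> i m x\<bar> powr p) \<longlonglongrightarrow> (LINT x|lebesgue. g x * indicator (U i) x)"
  proof (rule integral_dominated_convergence[where w = "\<lambda>x. norm (g x)"])
    show "AE x in lebesgue. (\<lambda>m. g x * \<bar>\<phi> i m x\<bar> powr p) \<longlonglongrightarrow> g x * indicator (U i) x"
    proof (intro AE_I2 tendsto_mult_left)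
      fix x
      have "(\<lambda>m. \<bar>\<phi> i m x\<bar> powr p) \<longlonglongrightarrow> \<bar>indicat_real (U i) x\<bar> powr p"
        unfolding \<phi>_def using p by (intro tendsto_abs_powr P(4)) auto
      then show "(\<lambda>m. \<bar>\<phi> i m x\<bar> powr p) \<longlonglongrightarrow> indicator (U i) x"
        by (cases "x \<in> U i") auto
    qed
    show "AE x in lebesgue. norm (g x * \<bar>\<phi> i m x\<bar> powr p) \<le> norm (g x)" for m
    proof (intro AE_I2)
      fix x
      have "\<bar>\<phi> i m x\<bar> powr p \<le> 1 powr p" using \<phi>_bd p by (intro powr_mono2) auto
      then show "norm (g x * \<bar>\<phi> i m x\<bar> powr p) \<le> norm (g x)" by (simp add: abs_mult mult_left_le)
    qed
  qed (use g in auto)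
  then have "\<forall>\<^sub>F m in sequentially. 0 < (LINT x|lebesgue. g x * \<bar>\<phi> i m x\<bar> powr p)"
    using i by (intro order_tendstoD(1)) auto
  then obtain m where m: "0 < (LINT x|lebesgue. g x * \<bar>\<phi> i m x\<bar> powr p)" by (auto dest: eventually_happens)
  have eq: "indicator \<Omega> x *\<^sub>R (V x * \<bar>\<phi> i m x\<bar> powr p) = g x * \<bar>\<phi> i m x\<bar> powr p" for x
    using \<phi>_off[of x i m] UK K\<Omega> by (cases "x \<in> U i") (auto simp: g_def indicator_def)
  show thesis
  proof
    show "\<phi> i m \<in> test_functions \<Omega>" by (rule \<phi>_test)
    show "0 < (LINT x:\<Omega>|lebesgue. V x * \<bar>\<phi> i m x\<bar> powr p)"
      unfolding set_lebesgue_integral_def eq by (rule m)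
    \<comment> \<open>The Bochner integral of a non-integrable function is 0 by convention, so a
      positive value already yields integrability.\<close>
    show "set_integrable lebesgue \<Omega> (\<lambda>x. V x * \<bar>\<phi> i m x\<bar> powr p)"
      unfolding set_integrable_def eq using m by (metis not_integrable_integral_eq less_irrefl)
  qed
qed

section \<open>Lower semicontinuity of the functional\<close>

text \<open>Outside \<open>Q\<close> both points lie off \<Omega>, where \<open>v\<close> vanishes
  a.e., so the difference quotient contributes nothing there. Changing \<open>u\<close> on a null
  set affects only a null set of pairs.\<close>

lemma gagliardo_eq_gag:
  fixes u v :: "'a::euclidean_space \<Rightarrow> real"
  assumes p: "p \<noteq> 0" and eq: "AE x in lborel. u x = v x" and off: "AE x in lborel. x \<notin> \<Omega> \<longrightarrow> v x = 0"
  shows "gagliardo p \<alpha> \<Omega> u = gag p \<alpha> v"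
  unfolding gagliardo_def gag_def pint_def nn_integral_completion
proof (rule nn_integral_cong_AE)
  from eq off have "AE x in lborel. u x = v x \<and> (x \<notin> \<Omega> \<longrightarrow> v x = 0)" by eventually_elim auto
  from AE_lborel_fst_snd[OF this]
  show "AE z in lborel. ennreal (\<bar>u (fst z) - u (snd z)\<bar> powr p / norm (fst z - snd z) powr (real DIM('a) + p * \<alpha>))
      * indicator (Q \<Omega>) z = ennreal (\<bar>dq p \<alpha> v z\<bar> powr p)"
  proof eventually_elim
    case (elim z)
    show ?case
    proof (cases "z \<in> Q \<Omega>")
      case True
      then show ?thesis using elim p by (simp add: abs_dq_powr)
    next
      case False
      then have "v (fst z) = 0" "v (snd z) = 0" using elim by (auto simp: Q_def mem_Times_iff)
      then show ?thesis using False by (simp add: dq_def)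
    qed
  qed
qed

lemma lebesgue_hardy:
  assumes "AE x in lborel. u x = v x"
  shows "(\<integral>\<^sup>+x. ennreal (\<bar>u x\<bar> powr p / norm x powr (p * \<alpha>)) \<partial>lebesgue) = hardy p \<alpha> 0 v"
  unfolding nn_integral_completion hardy_def pint_def
  by (intro nn_integral_cong_AE, use assms in eventually_elim) (simp add: abs_hq_powr)

context frac_hardy
begin

lemma X_off:
  assumes u: "u \<in> X"
  shows "AE x in lborel. x \<notin> \<Omega> \<longrightarrow> u x = 0"
proof -
  obtain \<phi> where \<phi>: "\<And>k. \<phi> k \<in> test_functions \<Omega>" "AE x in lborel. (\<lambda>k. \<phi> k x) \<longlonglongrightarrow> u x"
    using u by (auto simp: X_def)
  show ?thesis using \<phi>(2)
  proof eventually_elim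
    case (elim x)
    then show ?case using test_functionsD(3)[OF \<phi>(1), of x] by (auto simp: LIMSEQ_const_iff)
  qed
qed

lemma X0_iff: "u \<in> X0 p \<alpha> \<Omega> \<longleftrightarrow> u \<in> borel_measurable lebesgue \<and> (\<exists>v\<in>X. AE x in lborel. u x = v x)"
proof
  assume u: "u \<in> X0 p \<alpha> \<Omega>"
  then obtain \<phi> where \<phi>: "\<And>k. \<phi> k \<in> test_functions \<Omega>" "AE x in lebesgue. (\<lambda>k. \<phi> k x) \<longlonglongrightarrow> u x"
    "(\<lambda>k. gagliardo p \<alpha> \<Omega> (\<lambda>x. \<phi> k x - u x)) \<longlonglongrightarrow> 0" and um: "u \<in> borel_measurable lebesgue"
    by (auto simp: X0_def)
  obtain v where v: "v \<in> borel_measurable lborel" "AE x in lborel. u x = v x"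
    using completion_ex_borel_measurable_real[OF um] by blast
  have ae: "AE x in lborel. (\<lambda>k. \<phi> k x) \<longlonglongrightarrow> v x"
    using \<phi>(2)[unfolded AE_completion_iff] v(2) by eventually_elim simp
  have off: "AE x in lborel. x \<notin> \<Omega> \<longrightarrow> v x = 0"
    using ae
  proof eventually_elim
    case (elim x)
    then show ?case using test_functionsD(3)[OF \<phi>(1), of x] by (auto simp: LIMSEQ_const_iff)
  qed
  have "gagliardo p \<alpha> \<Omega> (\<lambda>x. \<phi> k x - u x) = gag p \<alpha> (\<lambda>x. \<phi> k x - v x)" for k
  proof (rule gagliardo_eq_gag[OF p1(3)])
    show "AE x in lborel. \<phi> k x - u x = \<phi> k x - v x" using v(2) by eventually_elim simp
    show "AE x in lborel. x \<notin> \<Omega> \<longrightarrow> \<phi> k x - v x = 0"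
      using off by eventually_elim (use test_functionsD(3)[OF \<phi>(1)] in auto)
  qed
  then have "v \<in> X" using \<phi>(1,3) v(1) ae by (auto simp: X_def)
  then show "u \<in> borel_measurable lebesgue \<and> (\<exists>v\<in>X. AE x in lborel. u x = v x)" using um v(2) by blast
next
  assume "u \<in> borel_measurable lebesgue \<and> (\<exists>v\<in>X. AE x in lborel. u x = v x)"
  then obtain v where um: "u \<in> borel_measurable lebesgue" and v: "v \<in> X" "AE x in lborel. u x = v x" by blast
  obtain \<phi> where \<phi>: "\<And>k. \<phi> k \<in> test_functions \<Omega>" "(\<lambda>k. gag p \<alpha> (\<lambda>x. \<phi> k x - v x)) \<longlonglongrightarrow> 0"
    "AE x in lborel. (\<lambda>k. \<phi> k x) \<longlonglongrightarrow> v x"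
    using v(1) by (auto simp: X_def)
  have "AE x in lebesgue. (\<lambda>k. \<phi> k x) \<longlonglongrightarrow> u x"
    unfolding AE_completion_iff using \<phi>(3) v(2) by eventually_elim simp
  moreover have "gagliardo p \<alpha> \<Omega> (\<lambda>x. \<phi> k x - u x) = gag p \<alpha> (\<lambda>x. \<phi> k x - v x)" for k
  proof (rule gagliardo_eq_gag[OF p1(3)])
    show "AE x in lborel. \<phi> k x - u x = \<phi> k x - v x" using v(2) by eventually_elim simp
    show "AE x in lborel. x \<notin> \<Omega> \<longrightarrow> \<phi> k x - v x = 0"
      using X_off[OF v(1)] by eventually_elim (use test_functionsD(3)[OF \<phi>(1)] in auto)
  qed
  ultimately show "u \<in> X0 p \<alpha> \<Omega>" using \<phi>(1,2) um by (auto simp: X0_def intro!: exI[of _ \<phi>])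
qed

text \<open>\<open>enn2real\<close> sends \<infinity> to 0, so \<open>G\<close> and \<open>H\<close>
  are faithful only for finite values; on \<open>X\<close> this is \<open>G_eq\<close> and
  \<open>H_eq\<close>.\<close>

definition G :: "('a \<Rightarrow> real) \<Rightarrow> real" where
  "G u = enn2real (gag p \<alpha> u)"

definition H :: "('a \<Rightarrow> real) \<Rightarrow> real" where
  "H u = enn2real (hardy p \<alpha> 0 u)"

lemma G_eq: "u \<in> X \<Longrightarrow> gag p \<alpha> u = ennreal (G u)"
  using X_gag_finite[of u] by (simp add: G_def less_top)

lemma H_eq:
  assumes u: "u \<in> X"
  shows "hardy p \<alpha> 0 u = ennreal (H u)"
proof -
  have "hardy p \<alpha> 0 u \<le> ennreal (G u / C)" using G_eq[OF u] by (intro hardy_X_le[OF u]) simp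
  then have "hardy p \<alpha> 0 u < top" using le_less_trans ennreal_less_top by blast
  then show ?thesis by (simp add: H_def less_top)
qed

lemma G_nonneg: "0 \<le> G u" and H_nonneg: "0 \<le> H u"
  by (auto simp: G_def H_def)

lemma C_H_le_G:
  assumes u: "u \<in> X"
  shows "C * H u \<le> G u"
proof -
  have "ennreal C * ennreal (H u) \<le> ennreal (G u)" using hardy_X[OF u, of 0] unfolding G_eq[OF u] H_eq[OF u] .
  then show ?thesis using C H_nonneg[of u] G_nonneg[of u] by (simp flip: ennreal_mult)
qed

lemma G_cmult: "u \<in> X \<Longrightarrow> G (\<lambda>x. c * u x) = \<bar>c\<bar> powr p * G u"
  and H_cmult: "u \<in> X \<Longrightarrow> H (\<lambda>x. c * u x) = \<bar>c\<bar> powr p * H u"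
  by (auto simp: G_def H_def gag_cmult hardy_cmult X_borel enn2real_mult)

lemma J_eq:
  assumes v: "v \<in> X" and eq: "AE x in lborel. u x = v x" and u: "u \<in> borel_measurable lebesgue"
    and [measurable]: "\<Omega> \<in> sets lebesgue"
  shows "J p \<alpha> \<mu> \<Omega> u = G v - \<mu> * H v"
proof -
  have "(LINT x:\<Omega>|lebesgue. \<bar>u x\<bar> powr p / norm x powr (p * \<alpha>)) = H v"
  proof -
    have [measurable]: "u \<in> borel_measurable lebesgue" by (rule u)
    have [measurable]: "(\<lambda>x::'a. norm x powr (p * \<alpha>)) \<in> borel_measurable lebesgue"
      by (rule borel_lebesgue_measurable) measurable
    have ae: "AE x in lebesgue. indicator \<Omega> x *\<^sub>R (\<bar>u x\<bar> powr p / norm x powr (p * \<alpha>)) = \<bar>u x\<bar> powr p / norm x powr (p * \<alpha>)"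
      unfolding AE_completion_iff using X_off[OF v] eq by eventually_elim (auto simp: indicator_def)
    then have "(LINT x:\<Omega>|lebesgue. \<bar>u x\<bar> powr p / norm x powr (p * \<alpha>)) = (LINT x|lebesgue. \<bar>u x\<bar> powr p / norm x powr (p * \<alpha>))"
      unfolding set_lebesgue_integral_def by (intro integral_cong_AE) auto
    also have "\<dots> = enn2real (\<integral>\<^sup>+x. ennreal (\<bar>u x\<bar> powr p / norm x powr (p * \<alpha>)) \<partial>lebesgue)"
      by (rule integral_eq_nn_integral) auto
    also have "\<dots> = H v" by (simp add: lebesgue_hardy[OF eq] H_def)
    finally show ?thesis .
  qed
  moreover have "gagliardo p \<alpha> \<Omega> u = gag p \<alpha> v"
    by (rule gagliardo_eq_gag[OF p1(3) eq X_off[OF v]])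
  ultimately show ?thesis by (simp add: J_def G_def)
qed

text \<open>Brezis and Lieb: the remainder \<open>G (u k - w) - \<mu> * H (u k - w)\<close> is nonnegative by Hardy's
  inequality, which makes the functional lower semicontinuous although it is not convex.\<close>

lemma functional_lower_semicontinuous:
  assumes u: "\<And>k. u k \<in> X" and K: "\<And>k. G (u k) \<le> K"
    and w: "w \<in> X" and ae: "AE x in lborel. (\<lambda>k. u k x) \<longlonglongrightarrow> w x"
    and \<mu>: "0 \<le> \<mu>" "\<mu> \<le> C" and lim: "(\<lambda>k. G (u k) - \<mu> * H (u k)) \<longlonglongrightarrow> l"
  shows "G w - \<mu> * H w \<le> l"
proof -
  note [measurable] = X_borel[OF u] X_borel[OF w]
  have gK: "gag p \<alpha> (u k) \<le> ennreal K" for k unfolding G_eq[OF u] by (intro ennreal_leI K)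
  have Glim: "(\<lambda>k. G (u k) - G (\<lambda>x. u k x - w x)) \<longlonglongrightarrow> G w"
    unfolding G_def gag_def dq_diff
    by (rule brezis_lieb[OF p1(1), where K = K]) (use AE_tendsto_dq[OF ae] gK in \<open>auto simp: gag_def\<close>)
  have "AE x in lborel. (\<lambda>k. hq \<alpha> 0 (u k) x) \<longlonglongrightarrow> hq \<alpha> 0 w x"
    using ae by eventually_elim (rule tendsto_hq)
  then have Hlim: "(\<lambda>k. H (u k) - H (\<lambda>x. u k x - w x)) \<longlonglongrightarrow> H w"
    unfolding H_def hardy_def hq_diff
    by (intro brezis_lieb[OF p1(1), where K = "K / C"]) (use hardy_X_le[OF u gK] in \<open>auto simp: hardy_def\<close>)
  have rem: "0 \<le> G (\<lambda>x. u k x - w x) - \<mu> * H (\<lambda>x. u k x - w x)" for k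
  proof -
    have "\<mu> * H (\<lambda>x. u k x - w x) \<le> C * H (\<lambda>x. u k x - w x)" by (intro mult_right_mono \<mu> H_nonneg)
    also have "\<dots> \<le> G (\<lambda>x. u k x - w x)" by (intro C_H_le_G X_diff u w)
    finally show ?thesis by simp
  qed
  show ?thesis
  proof (rule LIMSEQ_le)
    show "(\<lambda>k. (G (u k) - G (\<lambda>x. u k x - w x)) - \<mu> * (H (u k) - H (\<lambda>x. u k x - w x))) \<longlonglongrightarrow> G w - \<mu> * H w"
      by (intro tendsto_intros Glim Hlim)
    have "(G (u k) - G (\<lambda>x. u k x - w x)) - \<mu> * (H (u k) - H (\<lambda>x. u k x - w x)) \<le> G (u k) - \<mu> * H (u k)" for k
      using rem[of k] by (simp add: algebra_simps)
    then show "\<exists>N. \<forall>k\<ge>N. (G (u k) - G (\<lambda>x. u k x - w x)) - \<mu> * (H (u k) - H (\<lambda>x. u k x - w x)) \<le> G (u k) - \<mu> * H (u k)"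
      by blast
  qed (rule lim)
qed

end

section \<open>Existence of a minimiser\<close>

text \<open>Local integrability yields measurability on compact sets only; an increasing exhaustion
  carries it over to \<Omega>.\<close>

lemma locally_integrable_measurable:
  fixes V :: "'a::euclidean_space \<Rightarrow> real"
  assumes loc: "locally_integrable \<Omega> V" and op: "open \<Omega>"
  shows "(\<lambda>x. indicator \<Omega> x * V x) \<in> borel_measurable lebesgue"
proof -
  obtain K where K: "\<And>n::nat. compact (K n)" "\<And>n. K n \<subseteq> \<Omega>" "\<And>n. K n \<subseteq> interior (K (Suc n))" "\<Union>(range K) = \<Omega>"
    using open_Union_compact_subsets[OF op] by metis
  have "K n \<subseteq> K (Suc n)" for n by (rule subset_trans[OF K(3) interior_subset])
  then have mono: "K m \<subseteq> K n" if "m \<le> n" for m n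
    using that by (rule lift_Suc_mono_le)
  show ?thesis
  proof (rule borel_measurable_LIMSEQ_real)
    show "(\<lambda>x. indicator (K n) x *\<^sub>R V x) \<in> borel_measurable lebesgue" for n
      using loc K(1,2) unfolding locally_integrable_def set_integrable_def by blast
    show "(\<lambda>n. indicator (K n) x *\<^sub>R V x) \<longlonglongrightarrow> indicator \<Omega> x * V x" for x
    proof (rule tendsto_eventually)
      show "\<forall>\<^sub>F n in sequentially. indicator (K n) x *\<^sub>R V x = indicator \<Omega> x * V x"
      proof (cases "x \<in> \<Omega>")
        case True
        then obtain N where "x \<in> K N" using K(4) by blast
        then have "x \<in> K n" if "n \<ge> N" for n using mono[OF that] by blast
        then have "indicator (K n) x *\<^sub>R V x = indicator \<Omega> x * V x" if "n \<ge> N" for n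
          using True that by simp
        then show ?thesis unfolding eventually_sequentially by blast
      next
        case False
        then have "x \<notin> K n" for n using K(2) by blast
        then show ?thesis using False by simp
      qed
    qed
  qed
qed

context frac_hardy
begin

lemma minimizer_exists:
  assumes \<mu>: "0 \<le> \<mu>" "\<mu> < C" and op: "open \<Omega>" and V: "assumption_A p \<alpha> \<Omega> V"
  shows "\<exists>u \<in> admissible p \<alpha> \<Omega> V. ereal (J p \<alpha> \<mu> \<Omega> u) = lambda1 p \<alpha> \<mu> \<Omega> V"
proof -
  have loc: "locally_integrable \<Omega> V" and ne: "\<not> (AE x in lebesgue. x \<in> \<Omega> \<longrightarrow> max (V x) 0 = 0)"
    using V by (auto simp: assumption_A_def)
  obtain V1 V2 where V12: "AE x in lebesgue. x \<in> \<Omega> \<longrightarrow> max (V x) 0 = V1 x + V2 x"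
    "in_Lp (real DIM('a) / (p * \<alpha>)) \<Omega> V1"
    "\<forall>y \<in> closure \<Omega>. ((\<lambda>x. norm (x - y) powr (p * \<alpha>) * V2 x) \<longlongrightarrow> 0) (at y within \<Omega>)"
    "((\<lambda>x. norm x powr (p * \<alpha>) * V2 x) \<longlongrightarrow> 0) (inf at_infinity (principal \<Omega>))"
    using V unfolding assumption_A_def by blast
  have \<Omega>_sets [measurable]: "\<Omega> \<in> sets lebesgue" using op by auto
  have W[measurable]: "(\<lambda>x. indicator \<Omega> x * V x) \<in> borel_measurable lebesgue"
    by (rule locally_integrable_measurable[OF loc op])
  define Wp where "Wp x = max (indicator \<Omega> x * V x) 0" for x
  define Wm where "Wm x = max (- (indicator \<Omega> x * V x)) 0" for x
  have [measurable]: "Wp \<in> borel_measurable lebesgue" "Wm \<in> borel_measurable lebesgue"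
    unfolding Wp_def Wm_def by measurable
  have W0: "0 \<le> Wp x" "0 \<le> Wm x" for x by (auto simp: Wp_def Wm_def)
  \<comment> \<open>With the positive and negative parts of the potential as densities, the terms of
    the constraint become p-th power integrals again, and the limit lemmas for \<open>pint\<close>
    apply to them.\<close>
  define Np where "Np = density lebesgue (\<lambda>x. ennreal (Wp x))"
  define Nm where "Nm = density lebesgue (\<lambda>x. ennreal (Wm x))"
  have X_leb [measurable]: "v \<in> borel_measurable lebesgue" if "v \<in> X" for v
    by (rule borel_lebesgue_measurable[OF X_borel[OF that]])
  have X_N: "v \<in> borel_measurable Np" "v \<in> borel_measurable Nm" if "v \<in> X" for v
    using X_leb[OF that] by (auto simp: Np_def Nm_def)
  have pNp: "pint p Np v = (\<integral>\<^sup>+x. ennreal (indicator \<Omega> x * (max (V x) 0 * \<bar>v x\<bar> powr p)) \<partial>lebesgue)"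
    and pNm: "pint p Nm v = (\<integral>\<^sup>+x. ennreal (- (indicator \<Omega> x *\<^sub>R (V x * \<bar>v x\<bar> powr p))) \<partial>lebesgue)"
    and pNp': "pint p Np v = (\<integral>\<^sup>+x. ennreal (indicator \<Omega> x *\<^sub>R (V x * \<bar>v x\<bar> powr p)) \<partial>lebesgue)"
    if v: "v \<in> X" for v
  proof -
    note [measurable] = X_leb[OF v]
    have "pint p Np v = (\<integral>\<^sup>+x. ennreal (Wp x) * ennreal (\<bar>v x\<bar> powr p) \<partial>lebesgue)"
      unfolding pint_def Np_def by (rule nn_integral_density) measurable
    moreover have "pint p Nm v = (\<integral>\<^sup>+x. ennreal (Wm x) * ennreal (\<bar>v x\<bar> powr p) \<partial>lebesgue)"
      unfolding pint_def Nm_def by (rule nn_integral_density) measurable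
    moreover have "ennreal (Wp x) * ennreal (\<bar>v x\<bar> powr p) = ennreal (indicator \<Omega> x * (max (V x) 0 * \<bar>v x\<bar> powr p))"
      "ennreal (Wp x) * ennreal (\<bar>v x\<bar> powr p) = ennreal (indicator \<Omega> x *\<^sub>R (V x * \<bar>v x\<bar> powr p))"
      "ennreal (Wm x) * ennreal (\<bar>v x\<bar> powr p) = ennreal (- (indicator \<Omega> x *\<^sub>R (V x * \<bar>v x\<bar> powr p)))" for x
      using W0[of x]
      by (auto simp: Wp_def Wm_def max_def indicator_def ennreal_mult[symmetric] ennreal_neg mult_nonneg_nonpos2 mult_nonneg_nonpos mult_nonpos_nonneg)
    ultimately show "pint p Np v = (\<integral>\<^sup>+x. ennreal (indicator \<Omega> x * (max (V x) 0 * \<bar>v x\<bar> powr p)) \<partial>lebesgue)"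
      "pint p Nm v = (\<integral>\<^sup>+x. ennreal (- (indicator \<Omega> x *\<^sub>R (V x * \<bar>v x\<bar> powr p))) \<partial>lebesgue)"
      "pint p Np v = (\<integral>\<^sup>+x. ennreal (indicator \<Omega> x *\<^sub>R (V x * \<bar>v x\<bar> powr p)) \<partial>lebesgue)"
      by simp_all
  qed
  have Wv [measurable]: "(\<lambda>x. indicator \<Omega> x *\<^sub>R (V x * \<bar>v x\<bar> powr p)) \<in> borel_measurable lebesgue" if "v \<in> X" for v
  proof -
    note [measurable] = X_leb[OF that]
    have "(\<lambda>x. (indicator \<Omega> x * V x) * \<bar>v x\<bar> powr p) \<in> borel_measurable lebesgue" by measurable
    then show ?thesis by (simp add: mult.assoc)
  qed
  define F where "F v = G v - \<mu> * H v" for v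
  \<comment> \<open>Positive because \<mu> is strictly below \<open>C\<close>: the Hardy term
    consumes at most the share \<open>\<mu> / C\<close> of the seminorm.\<close>
  define \<kappa> where "\<kappa> = 1 - \<mu> / C"
  have \<kappa>: "0 < \<kappa>" using \<mu> C by (simp add: \<kappa>_def)
  have coercive: "\<kappa> * G v \<le> F v" if "v \<in> X" for v
  proof -
    have "\<mu> * H v = (\<mu> / C) * (C * H v)" using C by simp
    also have "\<dots> \<le> (\<mu> / C) * G v" using \<mu> C by (intro mult_left_mono C_H_le_G that) auto
    finally show ?thesis by (simp add: F_def \<kappa>_def algebra_simps)
  qed
  have F0: "0 \<le> F v" if "v \<in> X" for v
    using coercive[OF that] \<kappa> G_nonneg[of v] by (meson mult_nonneg_nonneg less_imp_le order_trans)
  have F_cmult: "F (\<lambda>x. c * v x) = \<bar>c\<bar> powr p * F v" if "v \<in> X" for c v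
    using that by (simp add: F_def G_cmult H_cmult algebra_simps)
  \<comment> \<open>Borel representatives of the admissible functions; \<open>admissible_adm\<close>
    shows that no value of the functional is lost.\<close>
  define adm where "adm = {v \<in> X. set_integrable lebesgue \<Omega> (\<lambda>x. V x * \<bar>v x\<bar> powr p) \<and>
     (LINT x:\<Omega>|lebesgue. V x * \<bar>v x\<bar> powr p) = 1}"
  have adm_scale: "(\<lambda>x. I powr (- 1 / p) * v x) \<in> adm"
    if v: "v \<in> X" and int: "set_integrable lebesgue \<Omega> (\<lambda>x. V x * \<bar>v x\<bar> powr p)"
      and I: "(LINT x:\<Omega>|lebesgue. V x * \<bar>v x\<bar> powr p) = I" "0 < I" for v I
  proof -
    have "\<bar>I powr (- 1 / p) * v x\<bar> powr p = (1 / I) * \<bar>v x\<bar> powr p" for x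
      using I(2) p1 by (simp add: abs_mult powr_powr powr_minus_divide powr_divide)
    then have eq: "(\<lambda>x. V x * \<bar>I powr (- 1 / p) * v x\<bar> powr p) = (\<lambda>x. (1 / I) * (V x * \<bar>v x\<bar> powr p))"
      by (simp add: mult_ac)
    have "set_integrable lebesgue \<Omega> (\<lambda>x. V x * \<bar>I powr (- 1 / p) * v x\<bar> powr p)"
      unfolding eq by (intro set_integrable_mult_right int)
    moreover have "(LINT x:\<Omega>|lebesgue. V x * \<bar>I powr (- 1 / p) * v x\<bar> powr p) = 1"
      unfolding eq using I by (subst set_integral_mult_right) simp
    ultimately show ?thesis using X_cmult[OF v] by (simp add: adm_def)
  qed
  have adm_admissible: "v \<in> admissible p \<alpha> \<Omega> V" "J p \<alpha> \<mu> \<Omega> v = F v" if "v \<in> adm" for v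
  proof -
    have v: "v \<in> X" using that by (simp add: adm_def)
    have "v \<in> X0 p \<alpha> \<Omega>" unfolding X0_iff using v X_leb[OF v] by (auto intro!: bexI[of _ v])
    then show "v \<in> admissible p \<alpha> \<Omega> V" using that by (simp add: admissible_def adm_def)
    show "J p \<alpha> \<mu> \<Omega> v = F v" unfolding F_def by (rule J_eq[OF v _ X_leb[OF v] \<Omega>_sets]) simp
  qed
  have admissible_adm: "\<exists>v\<in>adm. J p \<alpha> \<mu> \<Omega> u = F v" if u: "u \<in> admissible p \<alpha> \<Omega> V" for u
  proof -
    obtain v where um: "u \<in> borel_measurable lebesgue" and v: "v \<in> X" "AE x in lborel. u x = v x"
      using u by (auto simp: admissible_def X0_iff)
    have int: "integrable lebesgue (\<lambda>x. indicator \<Omega> x *\<^sub>R (V x * \<bar>u x\<bar> powr p))"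
      "(\<integral>x. indicator \<Omega> x *\<^sub>R (V x * \<bar>u x\<bar> powr p) \<partial>lebesgue) = 1"
      using u by (auto simp: admissible_def set_integrable_def set_lebesgue_integral_def)
    have ae: "AE x in lebesgue. indicator \<Omega> x *\<^sub>R (V x * \<bar>u x\<bar> powr p) = indicator \<Omega> x *\<^sub>R (V x * \<bar>v x\<bar> powr p)"
      using AE_completion[OF v(2)] by eventually_elim simp
    have "integrable lebesgue (\<lambda>x. indicator \<Omega> x *\<^sub>R (V x * \<bar>v x\<bar> powr p))"
      by (rule integrable_cong_AE_imp[OF int(1) Wv[OF v(1)]]) (use ae in eventually_elim, simp)
    moreover have "(\<integral>x. indicator \<Omega> x *\<^sub>R (V x * \<bar>v x\<bar> powr p) \<partial>lebesgue) = 1"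
      using int integral_cong_AE[OF borel_measurable_integrable[OF int(1)] Wv[OF v(1)] ae] by simp
    ultimately have "v \<in> adm" using v(1) by (simp add: adm_def set_integrable_def set_lebesgue_integral_def)
    moreover have "J p \<alpha> \<mu> \<Omega> u = F v" unfolding F_def by (rule J_eq[OF v um \<Omega>_sets])
    ultimately show ?thesis by blast
  qed
  obtain \<phi> where \<phi>: "\<phi> \<in> test_functions \<Omega>" "set_integrable lebesgue \<Omega> (\<lambda>x. V x * \<bar>\<phi> x\<bar> powr p)"
    "0 < (LINT x:\<Omega>|lebesgue. V x * \<bar>\<phi> x\<bar> powr p)"
    using exists_positive_test_function[OF p1(2) loc op ne] by blast
  \<comment> \<open>Over an empty set \<open>lambda1\<close> would be \<infinity> and could not be
    attained.\<close>
  have adm_ne: "adm \<noteq> {}" using adm_scale[OF test_functions_X[OF \<phi>(1)] \<phi>(2) refl \<phi>(3)] by blast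
  have adm_X: "v \<in> X" if "v \<in> adm" for v using that by (simp add: adm_def)
  define L where "L = Inf (F ` adm)"
  have bdd: "bdd_below (F ` adm)" using F0 adm_X by (intro bdd_belowI[of _ 0]) auto
  have L_le: "L \<le> F v" if "v \<in> adm" for v unfolding L_def using bdd that by (intro cInf_lower) auto
  have "\<exists>v\<in>adm. F v < L + 1 / Suc k" for k
  proof -
    have "Inf (F ` adm) < L + 1 / Suc k" by (simp add: L_def)
    then show ?thesis using cInf_lessD[of "F ` adm"] adm_ne by auto
  qed
  then obtain v where v: "\<And>k. v k \<in> adm" "\<And>k. F (v k) < L + 1 / Suc k" by metis
  have vX: "v k \<in> X" for k using v(1) adm_X by blast
  \<comment> \<open>The slack \<open>1 / Suc k\<close> of the minimising sequence is at most 1, so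
    coercivity bounds the energy by this constant.\<close>
  define K where "K = (L + 1) / \<kappa>"
  have GK: "G (v k) \<le> K" for k
  proof -
    have "1 / real (Suc k) \<le> 1" by simp
    then have "\<kappa> * G (v k) \<le> L + 1" using coercive[OF vX[of k]] v(2)[of k] by linarith
    then show ?thesis using \<kappa> by (simp add: K_def field_simps)
  qed
  have K0: "0 \<le> K" using GK[of 0] G_nonneg[of "v 0"] by linarith
  define K1 where "K1 = max K (K / C)"
  have gagK: "gag p \<alpha> (v k) \<le> ennreal K" for k unfolding G_eq[OF vX] by (intro ennreal_leI GK)
  have "gag p \<alpha> (v k) \<le> ennreal K1" for k
    by (rule order_trans[OF gagK]) (intro ennreal_leI, simp add: K1_def)
  moreover have "hardy p \<alpha> 0 (v k) \<le> ennreal K1" for k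
    by (rule order_trans[OF hardy_X_le[OF vX gagK]]) (intro ennreal_leI, simp add: K1_def)
  ultimately obtain r w where r: "strict_mono r" and wb: "w \<in> borel_measurable borel"
    and ae: "AE x in lborel. (\<lambda>k. v (r k) x) \<longlonglongrightarrow> w x"
    and loc_conv: "\<And>R. (\<lambda>k. pint p lborel (\<lambda>x. indicat_real (cball 0 R) x * (v (r k) x - w x))) \<longlonglongrightarrow> 0"
    using local_compactness[where u = v and K = K1, OF p1(1) \<alpha>(1) X_borel[OF vX]] by blast
  have w: "w \<in> X" by (rule X_closed[OF vX gagK ae wb])
  have aeleb: "AE x in lebesgue. (\<lambda>k. v (r k) x) \<longlonglongrightarrow> w x" by (rule AE_completion[OF ae])
  define K2 where "K2 = 2 powr p * (K + G w)"
  have K2: "0 \<le> K2" using K0 G_nonneg[of w] by (simp add: K2_def)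
  have zX: "(\<lambda>x. v (r k) x - w x) \<in> X" for k by (rule X_diff[OF vX w])
  have zK: "gag p \<alpha> (\<lambda>x. v (r k) x - w x) \<le> ennreal K2" for k
  proof -
    have "gag p \<alpha> (\<lambda>x. v (r k) x - w x) \<le> ennreal (2 powr p) * (gag p \<alpha> (v (r k)) + gag p \<alpha> w)"
      using vX w by (intro gag_diff_le p1 X_borel)
    also have "\<dots> \<le> ennreal (2 powr p) * (ennreal K + ennreal (G w))"
      using gagK G_eq[OF w] by (intro mult_left_mono add_mono) auto
    also have "\<dots> = ennreal K2" using K0 G_nonneg[of w] by (simp add: K2_def ennreal_mult)
    finally show ?thesis .
  qed
  \<comment> \<open>The bound for the positive potential is applied to the differences: they have
    bounded energy and vanish locally in L^p, so \<epsilon> is all that remains.\<close>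
  have Vp_conv: "(\<lambda>k. pint p Np (\<lambda>x. v (r k) x - w x)) \<longlonglongrightarrow> 0"
  proof (rule order_tendstoI)
    fix a :: ennreal assume a: "0 < a"
    obtain \<epsilon> where \<epsilon>: "0 < \<epsilon>" "ennreal \<epsilon> < a"
    proof (cases a)
      case (real t)
      then show thesis using a that[of "t / 2"] by (simp add: ennreal_less_iff)
    next
      case top
      then show thesis using that[of 1] by simp
    qed
    have \<epsilon>2: "0 < \<epsilon> / 2" using \<epsilon> by simp
    obtain M R where M: "0 \<le> M" "\<And>z. z \<in> X \<Longrightarrow> gag p \<alpha> z \<le> ennreal K2 \<Longrightarrow>
      (\<integral>\<^sup>+x. ennreal (indicator \<Omega> x * (max (V x) 0 * \<bar>z x\<bar> powr p)) \<partial>lebesgue)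
        \<le> ennreal (\<epsilon> / 2) + ennreal M * pint p lborel (\<lambda>x. indicat_real (cball 0 R) x * z x)"
      using positive_potential_bound[OF V12 \<epsilon>2 K2] by blast
    have "(\<lambda>k. ennreal M * pint p lborel (\<lambda>x. indicat_real (cball 0 R) x * (v (r k) x - w x))) \<longlonglongrightarrow> ennreal M * 0"
      by (intro ennreal_tendsto_cmult loc_conv) simp
    then have "\<forall>\<^sub>F k in sequentially. ennreal M * pint p lborel (\<lambda>x. indicat_real (cball 0 R) x * (v (r k) x - w x)) < ennreal (\<epsilon> / 2)"
      using \<epsilon>2 by (intro order_tendstoD(2)) auto
    then show "\<forall>\<^sub>F k in sequentially. pint p Np (\<lambda>x. v (r k) x - w x) < a"
    proof eventually_elim
      case (elim k)
      have "pint p Np (\<lambda>x. v (r k) x - w x) \<le> ennreal (\<epsilon> / 2) + ennreal M * pint p lborel (\<lambda>x. indicat_real (cball 0 R) x * (v (r k) x - w x))"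
        unfolding pNp[OF zX] by (rule M(2)[OF zX zK])
      also have "\<dots> \<le> ennreal (\<epsilon> / 2) + ennreal (\<epsilon> / 2)" using elim by (intro add_left_mono) simp
      also have "\<dots> = ennreal \<epsilon>" using \<epsilon> by (simp flip: ennreal_plus)
      finally show ?case using \<epsilon>(2) by (rule le_less_trans)
    qed
  qed simp
  \<comment> \<open>The same bound, now for \<open>w\<close> itself with \<epsilon> = 1; the local
    term is finite by Hardy's inequality.\<close>
  have Vp_fin: "pint p Np w < \<infinity>"
  proof -
    obtain M R where M: "0 \<le> M" "\<And>z. z \<in> X \<Longrightarrow> gag p \<alpha> z \<le> ennreal (G w) \<Longrightarrow>
      (\<integral>\<^sup>+x. ennreal (indicator \<Omega> x * (max (V x) 0 * \<bar>z x\<bar> powr p)) \<partial>lebesgue)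
        \<le> ennreal 1 + ennreal M * pint p lborel (\<lambda>x. indicat_real (cball 0 R) x * z x)"
      using positive_potential_bound[OF V12 zero_less_one G_nonneg] by blast
    have "pint p lborel (\<lambda>x. indicat_real (cball 0 R) x * w x) \<le> pint p lborel (\<lambda>x. indicat_real (cball 0 (max R 0)) x * w x)"
      by (intro pint_mono p1) (auto simp: indicator_def)
    also have "\<dots> \<le> ennreal (max R 0 powr (p * \<alpha>)) * hardy p \<alpha> 0 w"
      by (rule pint_indicator_le_hardy[OF p1(1) \<alpha>(1) _ wb]) simp
    also have "\<dots> < \<infinity>" using H_eq[OF w] by (simp add: ennreal_mult_less_top)
    finally have "ennreal 1 + ennreal M * pint p lborel (\<lambda>x. indicat_real (cball 0 R) x * w x) < \<infinity>"
      by (simp add: ennreal_mult_less_top)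
    moreover have "pint p Np w \<le> ennreal 1 + ennreal M * pint p lborel (\<lambda>x. indicat_real (cball 0 R) x * w x)"
      unfolding pNp[OF w] using M(2)[OF w] G_eq[OF w] by simp
    ultimately show ?thesis by (rule le_less_trans[rotated])
  qed
  define a where "a = enn2real (pint p Np w)"
  have a: "pint p Np w = ennreal a" "0 \<le> a" using Vp_fin by (auto simp: a_def less_top)
  \<comment> \<open>Written as a sum, because subtraction in \<open>ennreal\<close> is
    truncated.\<close>
  have constraint: "pint p Np (v k) = 1 + pint p Nm (v k)" "pint p Nm (v k) < \<infinity>" for k
  proof -
    let ?f = "\<lambda>x. indicator \<Omega> x *\<^sub>R (V x * \<bar>v k x\<bar> powr p)"
    have int: "integrable lebesgue ?f" "(\<integral>x. ?f x \<partial>lebesgue) = 1"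
      using v(1)[of k] by (auto simp: adm_def set_integrable_def set_lebesgue_integral_def)
    have fin: "pint p Np (v k) < \<infinity>" "pint p Nm (v k) < \<infinity>"
      using int(1) unfolding real_integrable_def pNp'[OF vX] pNm[OF vX] by (auto simp: less_top)
    then show "pint p Nm (v k) < \<infinity>" by simp
    have "enn2real (pint p Np (v k)) - enn2real (pint p Nm (v k)) = 1"
      using real_lebesgue_integral_def[OF int(1)] int(2) unfolding pNp'[OF vX] pNm[OF vX] by simp
    then have "enn2real (pint p Np (v k)) = 1 + enn2real (pint p Nm (v k))" by simp
    then have "ennreal (enn2real (pint p Np (v k))) = ennreal 1 + ennreal (enn2real (pint p Nm (v k)))"
      by simp
    then show "pint p Np (v k) = 1 + pint p Nm (v k)" using fin by (simp add: less_top)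
  qed
  have aeN: "AE x in Nm. (\<lambda>k. v (r k) x) \<longlonglongrightarrow> w x"
    unfolding Nm_def using aeleb by (subst AE_density) (auto elim: eventually_mono)
  \<comment> \<open>Along the sequence the negative part equals the positive part minus 1, hence is
    eventually at most \<open>a + \<epsilon> - 1\<close>, and Fatou's lemma passes this to
    \<open>w\<close>. The second conjunct is needed because \<open>ennreal\<close> would silently
    turn a negative bound into 0.\<close>
  have Vm_le: "pint p Nm w \<le> ennreal (a + \<epsilon> - 1) \<and> 0 \<le> a + \<epsilon> - 1" if \<epsilon>: "0 < \<epsilon>" for \<epsilon>
  proof -
    have ev: "\<forall>\<^sub>F k in sequentially. pint p Np (v (r k)) \<le> pint p Np w + ennreal \<epsilon>"
      using Vp_fin Vp_conv \<epsilon> by (intro pint_limsup p1 X_N vX w) auto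
    have ev2: "\<forall>\<^sub>F k in sequentially. pint p Nm (v (r k)) \<le> ennreal (a + \<epsilon> - 1) \<and> 0 \<le> a + \<epsilon> - 1"
      using ev
    proof eventually_elim
      case (elim k)
      obtain m where m: "pint p Nm (v (r k)) = ennreal m" "0 \<le> m"
        using constraint(2)[of "r k"] by (cases "pint p Nm (v (r k))") auto
      have "ennreal (1 + m) \<le> ennreal (a + \<epsilon>)"
        using elim m a \<epsilon> by (simp add: constraint(1) ennreal_plus)
      then have "1 + m \<le> a + \<epsilon>" using a \<epsilon> by (subst (asm) ennreal_le_iff) auto
      then show ?case using m by (auto intro!: ennreal_leI)
    qed
    have "pint p Nm w \<le> ennreal (a + \<epsilon> - 1)"
      by (rule pint_fatou_bound[OF p1(2) _ _ aeN]) (use X_N vX w eventually_mono[OF ev2] in auto)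
    moreover have "0 \<le> a + \<epsilon> - 1" using ev2 by (auto dest: eventually_happens)
    ultimately show ?thesis by simp
  qed
  have Vm_fin: "pint p Nm w < \<infinity>" using Vm_le[of 1] ennreal_less_top le_less_trans by fastforce
  define b where "b = enn2real (pint p Nm w)"
  have b: "pint p Nm w = ennreal b" "0 \<le> b" using Vm_fin by (auto simp: b_def less_top)
  \<comment> \<open>Letting \<epsilon> tend to 0. The constraint value \<open>a - b\<close> of the
    limit is thus at least 1, so the limit can be rescaled.\<close>
  have ab: "1 + b \<le> a"
  proof (rule field_le_epsilon)
    fix \<epsilon> :: real assume "0 < \<epsilon>"
    from Vm_le[OF this] have "ennreal b \<le> ennreal (a + \<epsilon> - 1)" "0 \<le> a + \<epsilon> - 1" unfolding b(1) by blast+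
    then have "b \<le> a + \<epsilon> - 1" by (simp only: ennreal_le_iff)
    then show "1 + b \<le> a + \<epsilon>" by simp
  qed
  have w_int: "set_integrable lebesgue \<Omega> (\<lambda>x. V x * \<bar>w x\<bar> powr p)"
    unfolding set_integrable_def real_integrable_def
    using Vp_fin Vm_fin Wv[OF w] by (auto simp: pNp'[OF w] pNm[OF w] less_top)
  have w_val: "(LINT x:\<Omega>|lebesgue. V x * \<bar>w x\<bar> powr p) = a - b"
    using real_lebesgue_integral_def[OF w_int[unfolded set_integrable_def]]
    unfolding set_lebesgue_integral_def a_def b_def pNp'[OF w] pNm[OF w] by simp
  have F_lim: "(\<lambda>k. F (v (r k))) \<longlonglongrightarrow> L"
  proof -
    have "(\<lambda>k. F (v k)) \<longlonglongrightarrow> L"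
    proof (rule tendsto_sandwich[OF _ _ tendsto_const])
      show "\<forall>\<^sub>F k in sequentially. L \<le> F (v k)" using L_le v(1) by simp
      show "\<forall>\<^sub>F k in sequentially. F (v k) \<le> L + 1 / Suc k" using v(2) by (simp add: less_imp_le)
      show "(\<lambda>k. L + 1 / Suc k) \<longlonglongrightarrow> L"
        using tendsto_add[OF tendsto_const LIMSEQ_Suc[OF lim_1_over_n], of L] by simp
    qed
    from LIMSEQ_subseq_LIMSEQ[OF this r] show ?thesis by (simp add: o_def)
  qed
  have Fw: "F w \<le> L"
    unfolding F_def using \<mu> F_lim GK
    by (intro functional_lower_semicontinuous[of "\<lambda>k. v (r k)" K w \<mu> L] vX w ae) (auto simp: F_def)
  define u where "u = (\<lambda>x. (a - b) powr (- 1 / p) * w x)"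
  have u: "u \<in> adm" unfolding u_def using ab by (intro adm_scale[OF w w_int w_val]) simp
  \<comment> \<open>Rescaling divides the functional by \<open>a - b\<close>; as \<open>F w\<close>
    is nonnegative and \<open>a - b\<close> is at least 1, it does not increase.\<close>
  have "F u \<le> F w"
  proof -
    have "F u = (1 / (a - b)) * F w"
      unfolding u_def F_cmult[OF w] using p1 ab by (simp add: powr_powr powr_minus_divide powr_divide)
    also have "\<dots> \<le> 1 * F w" using ab F0[OF w] by (intro mult_right_mono) auto
    finally show ?thesis by simp
  qed
  then have FuL: "F u \<le> L" using Fw by simp
  have "ereal (J p \<alpha> \<mu> \<Omega> u) = lambda1 p \<alpha> \<mu> \<Omega> V"
  proof (rule antisym)
    show "lambda1 p \<alpha> \<mu> \<Omega> V \<le> ereal (J p \<alpha> \<mu> \<Omega> u)"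
      unfolding lambda1_def by (rule INF_lower[OF adm_admissible(1)[OF u]])
    show "ereal (J p \<alpha> \<mu> \<Omega> u) \<le> lambda1 p \<alpha> \<mu> \<Omega> V"
      unfolding lambda1_def
    proof (rule INF_greatest)
      fix z assume "z \<in> admissible p \<alpha> \<Omega> V"
      then obtain y where "y \<in> adm" "J p \<alpha> \<mu> \<Omega> z = F y" using admissible_adm by blast
      then show "ereal (J p \<alpha> \<mu> \<Omega> u) \<le> ereal (J p \<alpha> \<mu> \<Omega> z)"
        using FuL L_le[of y] adm_admissible(2)[OF u] by simp
    qed
  qed
  then show ?thesis using adm_admissible(1)[OF u] by blast
qed

end

theorem theorem3p2:
  fixes \<Omega> :: "'a::euclidean_space set" and V :: "'a \<Rightarrow> real" and p \<alpha> \<mu> :: real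
  assumes "p \<ge> 2"
    and "0 < \<alpha>" "\<alpha> < 1"
    and "real DIM('a) > p * \<alpha>"
    and "0 \<le> \<mu>" "\<mu> < hardy_const TYPE('a) \<alpha> p"
    and "open \<Omega>" "connected \<Omega>" "lipschitz_boundary \<Omega>" "0 \<in> \<Omega>"
    and "assumption_A p \<alpha> \<Omega> V"
  shows "\<exists>u \<in> X0 p \<alpha> \<Omega>.
    set_integrable lebesgue \<Omega> (\<lambda>x. V x * \<bar>u x\<bar> powr p) \<and>
    (LINT x:\<Omega>|lebesgue. V x * \<bar>u x\<bar> powr p) = 1 \<and>
    ereal (J p \<alpha> \<mu> \<Omega> u) = lambda1 p \<alpha> \<mu> \<Omega> V"
proof -
  define S where "S = {C. C \<ge> 0 \<and> (\<forall>u \<in> test_functions (UNIV :: 'a set). gagliardo p \<alpha> UNIV u \<ge>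
          ennreal C * (\<integral>\<^sup>+x. ennreal (\<bar>u x\<bar> powr p / norm x powr (p * \<alpha>)) \<partial>lebesgue))}"
  have "0 \<in> S" by (simp add: S_def)
  moreover have "\<mu> < Sup S" using assms(6) by (simp add: hardy_const_def S_def)
  \<comment> \<open>valid even if \<open>S\<close> were unbounded, with its \<open>Sup\<close> arbitrary\<close>
  ultimately obtain c where c: "c \<in> S" "\<mu> < c" by (metis empty_iff less_cSupD)
  \<comment> \<open>Any admissible \<open>c\<close> above \<mu> will do, since coercivity costs only
    the factor \<open>1 - \<mu> / c\<close>.\<close>
  interpret frac_hardy p \<alpha> c \<Omega>
  proof
    show "ennreal c * hardy p \<alpha> 0 u \<le> gag p \<alpha> u" if u: "u \<in> test_functions UNIV" for u :: "'a \<Rightarrow> real"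
    proof -
      have "gagliardo p \<alpha> UNIV u = gag p \<alpha> u" using assms(1) by (intro gagliardo_eq_gag) auto
      moreover have "(\<integral>\<^sup>+x. ennreal (\<bar>u x\<bar> powr p / norm x powr (p * \<alpha>)) \<partial>lebesgue) = hardy p \<alpha> 0 u"
        by (rule lebesgue_hardy) simp
      ultimately show ?thesis using c(1) u unfolding S_def by force
    qed
  qed (use assms c in auto)
  show ?thesis
    using minimizer_exists[OF assms(5) c(2) assms(7) assms(11)] by (auto simp: admissible_def)
qed

end
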